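(* Let $G$ be a finitely generated group that has the $b_2-b_1$ property with respect to the prime $2$. Suppose that $$\sup \{ b_1(G_i; \mathbb{F}_2) : G_i \text{ is a finite index subgroup of } G \} = \infty.$$ Then, for infinitely many $n$, $$s_n(G) \geq s_n^{\triangleleft\triangleleft}(G) > 2^{n / ( \sqrt{\log n}\, \log\log n)}.$$
   Context: For a prime $p$, $\mathbb{F}_p$ is the field of order $p$, and for $r=1,2$, $b_r(G;\mathbb{F}_p)$ denotes the dimension over $\mathbb{F}_p$ of the group homology $H_r(G;\mathbb{F}_p)$. A group $G$ has the $b_2-b_1$ property with respect to the prime $p$ if there is a uniform upper bound on $b_2(G_i;\mathbb{F}_p)-b_1(G_i;\mathbb{F}_p)$ as $G_i$ ranges over all finite index subgroups of $G$. $s_n(G)$ is the number of subgroups of $G$ with index at most $n$. A subgroup $K$ of $G$ is subnormal if there is a finite sequence of subgroups $G=G_1\geq G_2\geq\dots\geq G_r=K$ such that each $G_i$ is normal in $G_{i-1}$. $s_n^{\triangleleft\triangleleft}(G)$ is the number of subnormal subgroups of $G$ with index at most $n$. $\log$ is the natural logarithm. *)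

theory Defs
  imports
    "HOL-Number_Theory.Residues"
    "HOL-Algebra.Generated_Groups"
    "HOL-Library.Extended_Real"
    "Jordan_Normal_Form.Missing_VectorSpace"
begin

section \<open>Group homology with trivial coefficients\<close>

text \<open>
  The homology of a group \<open>G\<close> with coefficients in a commutative ring \<open>K\<close> (trivial action) is the
  homology of the unnormalised bar complex
  \[ \cdots \to C_2 \to C_1 \to C_0 \to 0, \]
  where \<open>C\<^sub>n\<close> is the free \<open>K\<close>-module on the \<open>n\<close>-tuples \<open>[g\<^sub>1|...|g\<^sub>n]\<close> of elements of \<open>G\<close>, and
  \[ d[g_1|\dots|g_n] = [g_2|\dots|g_n]
      + \sum_{i=1}^{n-1} (-1)^i [g_1|\dots|g_i g_{i+1}|\dots|g_n]
      + (-1)^n [g_1|\dots|g_{n-1}]. \]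
  Tuples are lists, and an element of \<open>C\<^sub>n\<close> is its coefficient function, of finite support.
\<close>

text \<open>The ring multiplication inherited by the record type \<open>module\<close> plays no role in a module, so
  the fields \<open>mult\<close> and \<open>one\<close> are left undefined.\<close>

definition bar_chains ::
  "('k, 'r) ring_scheme \<Rightarrow> ('g, 'm) monoid_scheme \<Rightarrow> nat \<Rightarrow> ('k, 'g list \<Rightarrow> 'k) module" where
  "bar_chains K G n =
     \<lparr>carrier = {c. range c \<subseteq> carrier K
                   \<and> finite {xs. c xs \<noteq> \<zero>\<^bsub>K\<^esub>}
                   \<and> {xs. c xs \<noteq> \<zero>\<^bsub>K\<^esub>} \<subseteq> {xs. length xs = n \<and> set xs \<subseteq> carrier G}},
      monoid.mult = undefined, one = undefined,
      zero = (\<lambda>xs. \<zero>\<^bsub>K\<^esub>),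
      add = (\<lambda>c c' xs. c xs \<oplus>\<^bsub>K\<^esub> c' xs),
      smult = (\<lambda>a c xs. a \<otimes>\<^bsub>K\<^esub> c xs)\<rparr>"

definition bar_face :: "('g, 'm) monoid_scheme \<Rightarrow> nat \<Rightarrow> nat \<Rightarrow> 'g list \<Rightarrow> 'g list" where
  "bar_face G n i xs =
     (if i = 0 then tl xs
      else if i = n then butlast xs
      else take (i - 1) xs @ (xs ! (i - 1) \<otimes>\<^bsub>G\<^esub> xs ! i) # drop (i + 1) xs)"

text \<open>The differential \<open>C\<^sub>n \<rightarrow> C\<^bsub>n-1\<^esub>\<close>, given by the coefficient of the image at each tuple \<open>ys\<close>.\<close>

definition bar_boundary ::
  "('k, 'r) ring_scheme \<Rightarrow> ('g, 'm) monoid_scheme \<Rightarrow> nat \<Rightarrow> ('g list \<Rightarrow> 'k) \<Rightarrow> 'g list \<Rightarrow> 'k" where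
  "bar_boundary K G n c ys =
     (if n = 0 then \<zero>\<^bsub>K\<^esub>
      else \<Oplus>\<^bsub>K\<^esub>i \<in> {..n}. \<Oplus>\<^bsub>K\<^esub>xs \<in> {xs. c xs \<noteq> \<zero>\<^bsub>K\<^esub> \<and> bar_face G n i xs = ys}.
             ((\<ominus>\<^bsub>K\<^esub> \<one>\<^bsub>K\<^esub>) [^]\<^bsub>K\<^esub> i) \<otimes>\<^bsub>K\<^esub> c xs)"

definition bar_cycles ::
  "('k, 'r) ring_scheme \<Rightarrow> ('g, 'm) monoid_scheme \<Rightarrow> nat \<Rightarrow> ('g list \<Rightarrow> 'k) set" where
  "bar_cycles K G n = {c \<in> carrier (bar_chains K G n). bar_boundary K G n c = (\<lambda>ys. \<zero>\<^bsub>K\<^esub>)}"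

definition bar_boundaries ::
  "('k, 'r) ring_scheme \<Rightarrow> ('g, 'm) monoid_scheme \<Rightarrow> nat \<Rightarrow> ('g list \<Rightarrow> 'k) set" where
  "bar_boundaries K G n = bar_boundary K G (Suc n) ` carrier (bar_chains K G (Suc n))"

text \<open>The scalar multiple \<open>a \<cdot> (N + x) = N + a \<cdot> x\<close> of a coset \<open>X = N + x\<close> is \<open>N + a \<cdot> X\<close>; the outer
  sum with \<open>N\<close> is needed when \<open>a\<close> is not a unit.\<close>

definition quotient_module ::
  "('k, 'v, 'm) module_scheme \<Rightarrow> 'v set \<Rightarrow> ('k, 'v set) module" where
  "quotient_module M N =
     \<lparr>carrier = a_rcosets\<^bsub>M\<^esub> N,
      monoid.mult = undefined, one = undefined,
      zero = N,
      add = (\<lambda>X Y. X <+>\<^bsub>M\<^esub> Y),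
      smult = (\<lambda>a X. N <+>\<^bsub>M\<^esub> ((\<lambda>x. a \<odot>\<^bsub>M\<^esub> x) ` X))\<rparr>"

definition group_homology ::
  "('k, 'r) ring_scheme \<Rightarrow> ('g, 'm) monoid_scheme \<Rightarrow> nat \<Rightarrow> ('k, ('g list \<Rightarrow> 'k) set) module" where
  "group_homology K G n =
     quotient_module ((bar_chains K G n)\<lparr>carrier := bar_cycles K G n\<rparr>) (bar_boundaries K G n)"

definition vs_edim :: "('k, 'r) ring_scheme \<Rightarrow> ('k, 'v, 'm) module_scheme \<Rightarrow> enat" where
  "vs_edim K V = (if vectorspace.fin_dim K V then enat (vectorspace.dim K V) else \<infinity>)"

text \<open>\<open>betti r G p\<close> is $b_r(G; \mathbf{F}_p)$, for \<open>p\<close> prime.\<close>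

definition betti :: "nat \<Rightarrow> ('g, 'm) monoid_scheme \<Rightarrow> nat \<Rightarrow> enat" where
  "betti r G p = vs_edim (residue_ring (int p)) (group_homology (residue_ring (int p)) G r)"


section \<open>Finite index subgroups and subgroup growth\<close>

definition finitely_generated_group :: "('g, 'm) monoid_scheme \<Rightarrow> bool" where
  "finitely_generated_group G \<longleftrightarrow>
     group G \<and> (\<exists>S. finite S \<and> S \<subseteq> carrier G \<and> generate G S = carrier G)"

definition finite_index_subgroups :: "('g, 'm) monoid_scheme \<Rightarrow> 'g set set" where
  "finite_index_subgroups G = {H. subgroup H G \<and> finite (rcosets\<^bsub>G\<^esub> H)}"

text \<open>The difference is taken in the extended reals, where \<open>\<infinity> - n = \<infinity>\<close>, so a bound forces
  \<open>b\<^sub>2\<close> to be finite whenever \<open>b\<^sub>1\<close> is; the latter holds for all finite index subgroups of a finitely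
  generated group.\<close>

definition b2_b1_property :: "('g, 'm) monoid_scheme \<Rightarrow> nat \<Rightarrow> bool" where
  "b2_b1_property G p \<longleftrightarrow>
     (\<exists>C::real. \<forall>H \<in> finite_index_subgroups G.
        ereal_of_enat (betti 2 (G\<lparr>carrier := H\<rparr>) p) - ereal_of_enat (betti 1 (G\<lparr>carrier := H\<rparr>) p)
          \<le> ereal C)"

definition subnormal :: "'g set \<Rightarrow> ('g, 'm) monoid_scheme \<Rightarrow> bool" where
  "subnormal K G \<longleftrightarrow>
     (\<exists>(S :: nat \<Rightarrow> 'g set) r. 1 \<le> r \<and> S 1 = carrier G \<and> S r = K
        \<and> (\<forall>i \<in> {1..r}. subgroup (S i) G)
        \<and> (\<forall>i \<in> {2..r}. S i \<lhd> G\<lparr>carrier := S (i - 1)\<rparr>))"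

text \<open>In a finitely generated group the sets counted here are finite.\<close>

definition subgroup_growth :: "('g, 'm) monoid_scheme \<Rightarrow> nat \<Rightarrow> nat" where
  "subgroup_growth G n =
     card {H \<in> finite_index_subgroups G. card (rcosets\<^bsub>G\<^esub> H) \<le> n}"

definition subnormal_growth :: "('g, 'm) monoid_scheme \<Rightarrow> nat \<Rightarrow> nat" where
  "subnormal_growth G n =
     card {H \<in> finite_index_subgroups G. subnormal H G \<and> card (rcosets\<^bsub>G\<^esub> H) \<le> n}"

end

theory Submission
  imports Defs
    "HOL-Library.Z2"
    "HOL-Library.Function_Algebras"
    "HOL-Library.Product_Plus"
    "HOL-Library.FuncSet"
    "HOL-Library.Sublist"
begin

text \<open>
  For a subgroup \<open>H\<close> of finite index write \<open>b(H)\<close> for the dimension of \<open>Hom(H, F\<^sub>2)\<close> and \<open>\<Phi>(H)\<close> for the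
  common kernel of these homomorphisms, so that \<open>H / \<Phi>(H)\<close> is the group \<open>E = F\<^sub>2\<^sup>b\<close>. The proof rests on
  one inequality: if \<open>b\<^sub>2 - b\<^sub>1 \<le> C\<close> on all finite index subgroups, then for every \<open>l\<close>
  \[ b(\Phi(H)) \ge b \cdot \binom{b}{l} - (C + 1) \cdot 2^b \qquad (b = b(H)). \]

  The reason is a count of crossed homomorphisms (\<open>card_hom2_common_kernel_ge\<close>). Functions \<open>E \<rightarrow> F\<^sub>2\<close> are
  polynomials in the \<open>b\<close> coordinates, with one basis element for each set \<open>S\<close> of coordinates, namely their
  product. Translation changes a polynomial only by terms of lower degree, so the polynomials of degree at most \<open>l\<close> form a module
  on which \<open>H\<close> acts unipotently. The quotient by the polynomials of degree less than \<open>l\<close> is a trivial module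
  of dimension \<open>b choose l\<close>, and the crossed homomorphisms into it have dimension \<open>b \<cdot> (b choose l)\<close>. The
  lower monomials are put back one at a time. Each step replaces a quotient module by an extension of it by the
  trivial module \<open>F\<^sub>2\<close>: a crossed homomorphism lifts if its obstruction in \<open>H\<^sup>2(H; F\<^sub>2)\<close> vanishes, which
  costs at most \<open>b\<^sub>2\<close> dimensions, and the lifts of a given one form a coset of \<open>Hom(H, F\<^sub>2)\<close>, which
  gains \<open>b\<close> dimensions (\<open>crossed_homs_insert\<close>). The net loss is at most \<open>C\<close> in each of at most \<open>2\<^sup>b\<close>
  steps. Finally a crossed homomorphism, evaluated at the origin of \<open>E\<close>, restricts to a homomorphism on
  \<open>\<Phi>(H)\<close>; it is determined by this restriction and by the \<open>2\<^sup>b\<close> values at the origin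
  that it takes on representatives of \<open>E\<close>.

  With \<open>l = b div 2\<close> the binomial coefficient is at least \<open>2\<^sup>b / (2 sqrt b)\<close>, so \<open>b(\<Phi>(H)) \<ge> sqrt b \<cdot> 2\<^sup>b / 4\<close> once
  \<open>b\<close> is large. Along the tower \<open>H\<^sub>0 = H\<close>, \<open>H\<^sub>i\<^sub>+\<^sub>1 = \<Phi>(H\<^sub>i)\<close> the index grows by the factor \<open>2\<^sup>b\<close> in each step.
  The index of \<open>H\<^sub>i\<close> becomes negligible against \<open>b(H\<^sub>i\<^sub>+\<^sub>1)\<close>, and the factor \<open>sqrt b\<close> is
  comparable with the square root of the logarithm of the next index; hence eventually
  \<open>b(H\<^sub>i) > n / (sqrt (ln n) \<cdot> ln (ln n))\<close>, where \<open>n\<close> is twice the bound for the index of \<open>H\<^sub>i\<close> (\<open>growth_along_tower\<close>).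
  The kernels of the \<open>2\<^bsup>b(H\<^sub>i)\<^esup>\<close> elements of \<open>Hom(H\<^sub>i, F\<^sub>2)\<close> are distinct, normal in \<open>H\<^sub>i\<close>, and of index at
  most \<open>n\<close> in the whole group, so they give the lower bound if \<open>H\<^sub>i\<close> is subnormal.

  The hypothesis provides a subgroup \<open>H\<close> with large \<open>b(H)\<close> which need not be subnormal. Let \<open>N\<close> be its normal
  core and \<open>H\<^sub>i\<close> its tower. The groups \<open>N \<inter> H\<^sub>i\<close> are subnormal, and passing from \<open>H\<^sub>i\<close> to \<open>N \<inter> H\<^sub>i\<close> lowers \<open>b\<close> by at
  most the index of \<open>N\<close>, whereas \<open>b(H\<^sub>i)\<close> tends to infinity. Some \<open>N \<inter> H\<^sub>i\<close> is therefore subnormal with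
  large \<open>b\<close>, and its own tower is subnormal throughout (\<open>subnormal_of_large_rank2\<close>).

  Homology enters through two consequences of the bar complex, both obtained by separating a chain from a
  subspace by a linear functional (\<open>additive_separation\<close>): \<open>b\<^sub>1 \<le> b(H)\<close>, and a 2-cocycle that vanishes on
  \<open>b\<^sub>2\<close> suitable 2-cycles is a coboundary. Finiteness of all the sets counted comes from coset tables
  (\<open>finite_subgroups_of_bounded_index\<close>).
\<close>

section \<open>Linear algebra over the field with two elements\<close>

text \<open>These two default rules would turn field arithmetic into bit operations, out of reach of the rules
  for sums and products.\<close>
declare add_bit_eq_xor [simp del] mult_bit_eq_and [simp del]

lemma bit_add_self [simp]: "x + x = (0::bit)"
  by (cases x) (simp_all add: add_bit_eq_xor)

lemma bit_add_self_left [simp]: "x + (x + y) = (y::bit)"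
  by (simp flip: add.assoc)

lemma bit_add_eq_0_iff: "x + y = 0 \<longleftrightarrow> x = (y::bit)"
  by (metis add.right_neutral bit_add_self_left bit_add_self)

lemma UNIV_bit: "(UNIV :: bit set) = {0, 1}"
  by (metis (full_types) UNIV_eq_I bit_not_zero_iff insertCI)

lemma card_bit_lists: "card {v :: bit list. length v = n} = 2 ^ n"
proof -
  have "card {v. set v \<subseteq> {0, 1 :: bit} \<and> length v = n} = card {0, 1 :: bit} ^ n"
    by (rule card_lists_length_eq) simp
  then show ?thesis by (simp flip: UNIV_bit) (simp add: UNIV_bit numeral_2_eq_2)
qed

lemma bit_fun_add_self [simp]: "f + f = (0 :: 'a \<Rightarrow> bit)"
  by (simp add: fun_eq_iff)

text \<open>A subspace maximal among those that contain \<open>S\<close> and avoid \<open>v\<close> has index 2: if \<open>x\<close> lies outside it,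
  adjoining \<open>x\<close> produces \<open>v\<close>, so \<open>x + v\<close> lies inside. The functional is the projection to the quotient.
  In characteristic 2 additive means linear, so no scalars appear.\<close>
lemma additive_separation:
  fixes S :: "'v::ab_group_add set"
  assumes char2: "\<And>x::'v. x + x = 0"
    and S0: "0 \<in> S" and Sadd: "\<And>x y. x \<in> S \<Longrightarrow> y \<in> S \<Longrightarrow> x + y \<in> S" and v: "v \<notin> S"
  obtains L :: "'v \<Rightarrow> bit"
    where "\<And>x y. L (x + y) = L x + L y" "\<And>s. s \<in> S \<Longrightarrow> L s = 0" "L v = 1"
proof -
  define A where "A = {M. S \<subseteq> M \<and> v \<notin> M \<and> (\<forall>x\<in>M. \<forall>y\<in>M. x + y \<in> M)}"
  have "\<exists>M\<in>A. \<forall>X\<in>A. M \<subseteq> X \<longrightarrow> X = M"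
  proof (rule subset_Zorn_nonempty)
    show "A \<noteq> {}" using Sadd v by (auto simp: A_def)
    fix \<C> assume "\<C> \<noteq> {}" and ch: "subset.chain A \<C>"
    then have sub: "\<C> \<subseteq> A" and tot: "\<And>X Y. X \<in> \<C> \<Longrightarrow> Y \<in> \<C> \<Longrightarrow> X \<subseteq> Y \<or> Y \<subseteq> X"
      by (auto simp: subset_chain_def)
    have "x + y \<in> \<Union>\<C>" if "x \<in> \<Union>\<C>" "y \<in> \<Union>\<C>" for x y
    proof -
      from \<open>x \<in> \<Union>\<C>\<close> obtain X where X: "X \<in> \<C>" "x \<in> X" ..
      from \<open>y \<in> \<Union>\<C>\<close> obtain Y where Y: "Y \<in> \<C>" "y \<in> Y" ..
      note XY = X Y
      then consider "X \<subseteq> Y" | "Y \<subseteq> X" using tot by blast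
      then show ?thesis
        using XY sub unfolding A_def by cases blast+
    qed
    moreover obtain X where "X \<in> \<C>" using \<open>\<C> \<noteq> {}\<close> by blast
    moreover have "X \<in> A" using \<open>X \<in> \<C>\<close> sub by blast
    then have "S \<subseteq> X" by (simp add: A_def)
    then have "S \<subseteq> \<Union>\<C>" using \<open>X \<in> \<C>\<close> by blast
    moreover have "v \<notin> \<Union>\<C>" using sub by (auto simp: A_def)
    ultimately show "\<Union>\<C> \<in> A" unfolding A_def by blast
  qed
  then obtain M where M: "M \<in> A" and max: "\<And>X. X \<in> A \<Longrightarrow> M \<subseteq> X \<Longrightarrow> X = M" by blast
  have SM: "S \<subseteq> M" and vM: "v \<notin> M" and add: "\<And>x y. x \<in> M \<Longrightarrow> y \<in> M \<Longrightarrow> x + y \<in> M"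
    using M by (auto simp: A_def)
  have M0: "0 \<in> M" using SM S0 by blast
  have cancel: "a + (a + b) = b" for a b :: 'v
    by (simp add: char2 flip: add.assoc)
  have coset: "x + v \<in> M" if x: "x \<notin> M" for x
  proof (rule ccontr)
    assume xv: "x + v \<notin> M"
    define X where "X = M \<union> (+) x ` M"
    have v': "v \<noteq> x + m" if "m \<in> M" for m
      using that xv cancel by metis
    have "a + b \<in> X" if "a \<in> X" "b \<in> X" for a b
    proof -
      have "a + b = c + d \<or> a + b = x + (c + d)" if "a = c \<or> a = x + c" "b = d \<or> b = x + d" for c d
        using that cancel by (metis add.assoc add.commute)
      then show ?thesis using that add by (auto simp: X_def)
           (metis cancel add.assoc add.left_commute imageI)+
    qed
    then have "X \<in> A" using SM vM v' by (auto simp: A_def X_def)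
    then have "X = M" using max by (auto simp: X_def)
    moreover have "x \<in> X" using M0 by (auto simp: X_def image_iff intro!: bexI[of _ 0])
    ultimately show False using x by simp
  qed
  define L where "L = (\<lambda>x. if x \<in> M then 0 else 1 :: bit)"
  have *: "x + y \<in> M \<longleftrightarrow> (x \<in> M \<longleftrightarrow> y \<in> M)" for x y
  proof -
    have "x + y \<notin> M" if "x \<in> M" "y \<notin> M" for x y
      using that add cancel by metis
    moreover have "x + y \<in> M" if "x \<notin> M" "y \<notin> M"
    proof -
      have "(x + v) + (y + v) = x + y" using cancel by (metis add.assoc add.commute)
      then show ?thesis using add[OF coset coset] that by metis
    qed
    ultimately show ?thesis using add by (metis add.commute)
  qed
  show thesis
    by (rule that[of L]) (use SM vM * in \<open>auto simp: L_def\<close>)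
qed

definition fin_supp :: "('a \<Rightarrow> bit) set" where
  "fin_supp = {w. finite {x. w x \<noteq> 0}}"

text \<open>The evaluation of a cochain \<open>f\<close> on a chain \<open>w\<close>; a meaningful sum only for \<open>w\<close> of finite support.\<close>
definition pairing :: "('a \<Rightarrow> bit) \<Rightarrow> ('a \<Rightarrow> bit) \<Rightarrow> bit" where
  "pairing f w = (\<Sum>x | w x \<noteq> 0. f x)"

lemma pairing_superset:
  assumes "finite A" "{x. w x \<noteq> 0} \<subseteq> A"
  shows "pairing f w = (\<Sum>x\<in>A. f x * w x)"
  unfolding pairing_def using assms
  by (intro sum.mono_neutral_cong_left) auto

lemma fin_supp_add: "v \<in> fin_supp \<Longrightarrow> w \<in> fin_supp \<Longrightarrow> v + w \<in> fin_supp"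
  unfolding fin_supp_def mem_Collect_eq
  by (rule finite_subset[of _ "{x. v x \<noteq> 0} \<union> {x. w x \<noteq> 0}"]) auto

lemma pairing_add_right:
  assumes "v \<in> fin_supp" "w \<in> fin_supp"
  shows "pairing f (v + w) = pairing f v + pairing f w"
proof -
  define A where "A = {x. v x \<noteq> 0} \<union> {x. w x \<noteq> 0}"
  have A: "finite A" using assms by (simp add: A_def fin_supp_def)
  have "pairing f (v + w) = (\<Sum>x\<in>A. f x * (v + w) x)"
    by (rule pairing_superset[OF A]) (auto simp: A_def)
  also have "\<dots> = (\<Sum>x\<in>A. f x * v x) + (\<Sum>x\<in>A. f x * w x)"
    by (simp add: distrib_left sum.distrib)
  also have "\<dots> = pairing f v + pairing f w"
    using pairing_superset[OF A, of v f] pairing_superset[OF A, of w f] by (simp add: A_def)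
  finally show ?thesis .
qed

definition single :: "'a \<Rightarrow> 'a \<Rightarrow> bit" where
  "single x = (\<lambda>y. if y = x then 1 else 0)"

lemma single_fin_supp [simp]: "single x \<in> fin_supp"
  by (simp add: fin_supp_def single_def)

lemma pairing_single [simp]: "pairing f (single x) = f x"
proof -
  have "{y. single x y \<noteq> 0} = {x}" by (auto simp: single_def)
  then show ?thesis by (simp add: pairing_def)
qed

lemma fin_supp_sum_single:
  assumes "w \<in> fin_supp" shows "w = (\<Sum>x | w x \<noteq> 0. single x)"
proof
  fix y :: 'a
  have "(\<Sum>x\<in>A. single x) y = (\<Sum>x\<in>A. single x y)" if "finite A" for A :: "'a set"
    using that by (induction rule: finite_induct) auto
  then have "(\<Sum>x | w x \<noteq> 0. single x) y = (\<Sum>x | w x \<noteq> 0. single x y)"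
    using assms by (simp add: fin_supp_def)
  also have "\<dots> = w y"
    using assms by (simp add: single_def fin_supp_def)
  finally show "w y = (\<Sum>x | w x \<noteq> 0. single x) y" by simp
qed

lemma additive_eq_pairing:
  assumes L: "\<And>v w. L (v + w) = L v + (L w :: bit)" and w: "w \<in> fin_supp"
  shows "L w = pairing (\<lambda>x. L (single x)) w"
proof -
  have L0: "L 0 = 0" using L[of 0 0] by (metis add.right_neutral bit_add_self)
  have "L (\<Sum>x\<in>A. single x) = (\<Sum>x\<in>A. L (single x))" if "finite A" for A
    using that by (induction rule: finite_induct) (simp_all only: sum.empty sum.insert L L0 simp_thms)
  moreover have "finite {x. w x \<noteq> 0}" using w by (simp add: fin_supp_def)
  ultimately show ?thesis
    unfolding pairing_def by (subst fin_supp_sum_single[OF w]) simp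
qed

lemma sum_fun_apply: "(\<Sum>a\<in>A. h a) y = (\<Sum>a\<in>A. h a y :: bit)"
  by (induction A rule: infinite_finite_induct) auto

lemma fin_supp_sum: "(\<And>a. a \<in> A \<Longrightarrow> h a \<in> fin_supp) \<Longrightarrow> (\<Sum>a\<in>A. h a) \<in> fin_supp"
proof (induction A rule: infinite_finite_induct)
  case (insert a A)
  then show ?case unfolding sum.insert[OF insert.hyps] by (intro fin_supp_add) auto
qed (simp_all add: fin_supp_def)

lemma pairing_sum: "(\<And>a. a \<in> A \<Longrightarrow> h a \<in> fin_supp) \<Longrightarrow> pairing f (\<Sum>a\<in>A. h a) = (\<Sum>a\<in>A. pairing f (h a))"
proof (induction A rule: infinite_finite_induct)
  case (insert a A)
  then show ?case
    unfolding sum.insert[OF insert.hyps] by (subst pairing_add_right) (auto intro!: fin_supp_sum)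
qed (simp_all add: pairing_def)

section \<open>Homomorphisms to the field with two elements\<close>

text \<open>Fixing the value 0 outside the carrier makes equality of homomorphisms the equality of functions, so
  that \<open>hom2 G\<close> can be counted.\<close>
definition hom2 :: "('g, 'm) monoid_scheme \<Rightarrow> ('g \<Rightarrow> bit) set" where
  "hom2 G = {f. (\<forall>x\<in>carrier G. \<forall>y\<in>carrier G. f (x \<otimes>\<^bsub>G\<^esub> y) = f x + f y) \<and> (\<forall>x. x \<notin> carrier G \<longrightarrow> f x = 0)}"

lemma hom2_mult: "f \<in> hom2 G \<Longrightarrow> x \<in> carrier G \<Longrightarrow> y \<in> carrier G \<Longrightarrow> f (x \<otimes>\<^bsub>G\<^esub> y) = f x + f y"
  by (simp add: hom2_def)

lemma hom2_outside: "f \<in> hom2 G \<Longrightarrow> x \<notin> carrier G \<Longrightarrow> f x = 0"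
  by (simp add: hom2_def)

lemma hom2_add: "f \<in> hom2 G \<Longrightarrow> g \<in> hom2 G \<Longrightarrow> f + g \<in> hom2 G"
  by (simp add: hom2_def algebra_simps)

lemma hom2_zero: "0 \<in> hom2 G"
  by (simp add: hom2_def)

lemma (in group) hom2_one: "f \<in> hom2 G \<Longrightarrow> f \<one> = 0"
  using hom2_mult[of f G \<one> \<one>] by (metis bit_add_self one_closed r_one)

lemma (in group) hom2_inv: "f \<in> hom2 G \<Longrightarrow> x \<in> carrier G \<Longrightarrow> f (inv x) = f x"
  using hom2_mult[of f G x "inv x"] hom2_one[of f] by (simp add: bit_add_eq_0_iff)

text \<open>A finite space of functions is coordinatised by its values at suitable points. Greedily choose a
  point \<open>g\<close> at which some member does not vanish; the members vanishing at \<open>g\<close> form a smaller space, and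
  the value at \<open>g\<close> is the one further coordinate.\<close>
lemma evaluation_coordinates:
  fixes W :: "('a \<Rightarrow> bit) set"
  assumes "finite W" "0 \<in> W" "\<And>f g. f \<in> W \<Longrightarrow> g \<in> W \<Longrightarrow> f + g \<in> W"
    and "\<And>f x. f \<in> W \<Longrightarrow> x \<notin> A \<Longrightarrow> f x = 0"
  shows "\<exists>gs. set gs \<subseteq> A \<and> bij_betw (\<lambda>f. map f gs) W {v. length v = length gs}"
  using assms
proof (induction "card W" arbitrary: W rule: less_induct)
  case less
  note add = less.prems(3)
  show ?case
  proof (cases "W = {0}")
    case True
    then show ?thesis by (intro exI[of _ "[]"]) (auto simp: bij_betw_def)
  next
    case False
    then obtain f0 where f0: "f0 \<in> W" "f0 \<noteq> 0" using less.prems(2) by blast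
    then obtain g where g: "f0 g = 1" by (auto simp: fun_eq_iff)
    then have gA: "g \<in> A" using less.prems(4) f0(1) by force
    define W' where "W' = {f \<in> W. f g = 0}"
    have W'W: "W' \<subseteq> W" by (auto simp: W'_def)
    have "f0 \<notin> W'" using g by (simp add: W'_def)
    then have "card W' < card W" using f0 W'W less.prems(1) by (intro psubset_card_mono) auto
    moreover have "finite W'" "0 \<in> W'" "\<And>f g. f \<in> W' \<Longrightarrow> g \<in> W' \<Longrightarrow> f + g \<in> W'"
      using less.prems(1-3) by (auto simp: W'_def)
    moreover have "f x = 0" if "f \<in> W'" "x \<notin> A" for f x
      using that W'W by (intro less.prems(4)) auto
    ultimately have "\<exists>gs. set gs \<subseteq> A \<and> bij_betw (\<lambda>f. map f gs) W' {v. length v = length gs}"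
      by (rule less.hyps)
    then obtain gs where gs: "set gs \<subseteq> A" "bij_betw (\<lambda>f. map f gs) W' {v. length v = length gs}"
      by (elim exE conjE)
    have inj: "f = f'" if "f \<in> W" "f' \<in> W" and eq: "\<And>x. x \<in> set (g # gs) \<Longrightarrow> f x = f' x" for f f'
    proof -
      have "f + f' \<in> W'" using add that by (auto simp: W'_def)
      moreover have "map (f + f') gs = map 0 gs" using eq by auto
      moreover have "0 \<in> W'" using less.prems(2) by (simp add: W'_def)
      ultimately have "f + f' = 0"
        using inj_onD[OF bij_betw_imp_inj_on[OF gs(2)], of "f + f'" 0] by blast
      then have "f x + f' x = 0" for x by (simp add: fun_eq_iff)
      then show "f = f'" by (auto simp: bit_add_eq_0_iff)
    qed
    have surj: "\<exists>f\<in>W. map f (g # gs) = v" if len: "length v = length (g # gs)" for v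
    proof -
      obtain a u where v: "v = a # u" using len by (cases v) auto
      with len have u: "length u = length gs" by simp
      have lift: "\<exists>f\<in>W'. map f gs = u'" if "length u' = length gs" for u'
      proof -
        have "u' \<in> (\<lambda>f. map f gs) ` W'" using that bij_betw_imp_surj_on[OF gs(2)] by simp
        then show ?thesis by (elim imageE) (rule bexI, rule sym)
      qed
      show ?thesis
      proof (cases "a = 0")
        case True
        then show ?thesis using lift[OF u] v by (auto simp: W'_def)
      next
        case False
        obtain f where f: "f \<in> W'" "map f gs = map2 (+) u (map f0 gs)"
          using lift[of "map2 (+) u (map f0 gs)"] u by auto
        have "map (f0 + f) gs = u"
        proof (rule nth_equalityI)
          fix i assume i: "i < length (map (f0 + f) gs)"
          have "f (gs ! i) = u ! i + f0 (gs ! i)" using arg_cong[OF f(2), of "\<lambda>l. l ! i"] i u by simp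
          then show "map (f0 + f) gs ! i = u ! i" using i by (simp add: add.left_commute)
        qed (simp add: u)
        then show ?thesis using f f0 g False v add by (intro bexI[of _ "f0 + f"]) (auto simp: W'_def)
      qed
    qed
    show ?thesis
    proof (intro exI[of _ "g # gs"] conjI)
      show "bij_betw (\<lambda>f. map f (g # gs)) W {v. length v = length (g # gs)}"
      proof (rule bij_betwI')
        fix v assume "v \<in> {v :: bit list. length v = length (g # gs)}"
        then show "\<exists>f\<in>W. v = map f (g # gs)" using surj by (metis mem_Collect_eq)
      next
        fix f f' assume "f \<in> W" "f' \<in> W"
        then show "(map f (g # gs) = map f' (g # gs)) = (f = f')" using inj by (metis map_eq_conv)
      qed simp
    qed (use gA gs in auto)
  qed
qed

text \<open>A basis \<open>\<phi>\<close> of the homomorphisms to \<open>F\<^sub>2\<close> together with elements \<open>g\<close> of the group dual to it. The elements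
  \<open>g\<close> serve twice: they span the first homology, and their products represent all points of the
  elementary abelian quotient.\<close>
locale hom2_basis = group G for G :: "('g, 'm) monoid_scheme" (structure) +
  fixes b :: nat and \<phi> :: "nat \<Rightarrow> 'g \<Rightarrow> bit" and g :: "nat \<Rightarrow> 'g"
  assumes \<phi>: "\<And>i. i < b \<Longrightarrow> \<phi> i \<in> hom2 G"
    and g: "\<And>i. i < b \<Longrightarrow> g i \<in> carrier G"
    and dual: "\<And>i j. i < b \<Longrightarrow> j < b \<Longrightarrow> \<phi> i (g j) = (if i = j then 1 else 0)"
    and expand: "\<And>f x. f \<in> hom2 G \<Longrightarrow> f x = (\<Sum>i<b. f (g i) * \<phi> i x)"
    and card_hom2: "card (hom2 G) = 2 ^ b"

lemma (in group) hom2_basis_exists: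
  assumes "finite (hom2 G)"
  obtains b \<phi> g where "hom2_basis G b \<phi> g"
proof -
  have "\<exists>gs. set gs \<subseteq> carrier G \<and> bij_betw (\<lambda>f. map f gs) (hom2 G) {v. length v = length gs}"
    by (rule evaluation_coordinates[OF assms hom2_zero]) (rule hom2_add hom2_outside; assumption)+
  then obtain gs where gs: "set gs \<subseteq> carrier G" "bij_betw (\<lambda>f. map f gs) (hom2 G) {v. length v = length gs}"
    by (elim exE conjE)
  define b where "b = length gs"
  have "\<exists>f\<in>hom2 G. map f gs = map (\<lambda>j. if i = j then 1 else 0) [0..<b]" for i
  proof -
    have "map (\<lambda>j. if i = j then 1 else 0) [0..<b] \<in> (\<lambda>f. map f gs) ` hom2 G"
      using gs(2) by (simp add: bij_betw_def b_def)
    then show ?thesis by (elim imageE) (rule bexI, rule sym)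
  qed
  then have "\<forall>i. \<exists>f. f \<in> hom2 G \<and> map f gs = map (\<lambda>j. if i = j then 1 else 0) [0..<b]" by blast
  then obtain \<phi> where "\<forall>i. \<phi> i \<in> hom2 G \<and> map (\<phi> i) gs = map (\<lambda>j. if i = j then 1 else 0) [0..<b]"
    by (rule choice[THEN exE])
  then have \<phi>: "\<And>i. \<phi> i \<in> hom2 G" "\<And>i. map (\<phi> i) gs = map (\<lambda>j. if i = j then 1 else 0) [0..<b]" by simp_all
  have dual: "\<phi> i (gs ! j) = (if i = j then 1 else 0)" if "j < b" for i j
    using arg_cong[OF \<phi>(2), of "\<lambda>l. l ! j"] that by (simp add: b_def)
  have expand: "f x = (\<Sum>i<b. f (gs ! i) * \<phi> i x)" if f: "f \<in> hom2 G" for f x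
  proof -
    define f' where "f' = (\<lambda>x. \<Sum>i<b. f (gs ! i) * \<phi> i x)"
    have f': "f' \<in> hom2 G"
      unfolding f'_def hom2_def mem_Collect_eq
      by (simp add: hom2_mult[OF \<phi>(1)] hom2_outside[OF \<phi>(1)] distrib_left sum.distrib)
    have "map f' gs = map f gs"
    proof (rule nth_equalityI)
      fix j assume j: "j < length (map f' gs)"
      then have "j < b" by (simp add: b_def)
      then have "f' (gs ! j) = (\<Sum>i<b. if i = j then f (gs ! i) else 0)"
        unfolding f'_def by (intro sum.cong) (simp_all add: dual)
      then show "map f' gs ! j = map f gs ! j" using j \<open>j < b\<close> by simp
    qed simp
    then have "f' = f"
      by (rule inj_onD[OF bij_betw_imp_inj_on[OF gs(2)] _ f' f])
    then have "f x = f' x" by (simp only:)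
    then show ?thesis unfolding f'_def .
  qed
  have same_card: "card (hom2 G) = card {v :: bit list. length v = length gs}"
    by (rule bij_betw_same_card[OF gs(2)])
  have "hom2_basis_axioms G b \<phi> ((!) gs)"
  proof (rule hom2_basis_axioms.intro)
    show "gs ! i \<in> carrier G" if "i < b" for i
      by (rule subsetD[OF gs(1)]) (use that in \<open>simp add: b_def\<close>)
    show "\<phi> i (gs ! j) = (if i = j then 1 else 0)" if "i < b" "j < b" for i j by (rule dual[OF that(2)])
    show "f x = (\<Sum>i<b. f (gs ! i) * \<phi> i x)" if "f \<in> hom2 G" for f x by (rule expand[OF that])
    show "card (hom2 G) = 2 ^ b" unfolding same_card b_def by (rule card_bit_lists)
  qed (rule \<phi>(1))
  then have "hom2_basis G b \<phi> ((!) gs)" by (rule hom2_basis.intro[OF is_group])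
  then show thesis by (rule that)
qed

section \<open>Crossed homomorphisms into truncated polynomial functions\<close>

definition cocycles2 :: "('g, 'm) monoid_scheme \<Rightarrow> ('g \<Rightarrow> 'g \<Rightarrow> bit) set" where
  "cocycles2 G = {f. \<forall>x\<in>carrier G. \<forall>y\<in>carrier G. \<forall>z\<in>carrier G.
     f y z + f (x \<otimes>\<^bsub>G\<^esub> y) z + f x (y \<otimes>\<^bsub>G\<^esub> z) + f x y = 0}"

text \<open>The finite sets \<open>Z j\<close> are the supports of 2-chains \<open>[x|y]\<close> with coefficients in \<open>F\<^sub>2\<close>. The
  condition bounds the second cohomology by \<open>m\<close> dimensions, in a form that yields additive obstruction maps.\<close>
definition h2_detected_by :: "('g, 'm) monoid_scheme \<Rightarrow> nat \<Rightarrow> (nat \<Rightarrow> ('g \<times> 'g) set) \<Rightarrow> bool" where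
  "h2_detected_by G m Z \<longleftrightarrow>
     (\<forall>f\<in>cocycles2 G. (\<forall>j<m. (\<Sum>(x, y)\<in>Z j. f x y) = 0) \<longrightarrow>
        (\<exists>u. \<forall>x\<in>carrier G. \<forall>y\<in>carrier G. f x y = u x + u y + u (x \<otimes>\<^bsub>G\<^esub> y)))"

text \<open>The counting form of the rank-nullity inequality: subtracting one chosen member of each fibre
  embeds the fibre into \<open>B0\<close>.\<close>
lemma card_le_fibres:
  fixes B B0 :: "'v::ab_group_add set"
  assumes "finite K" "\<kappa> ` B \<subseteq> K" "finite B0"
    and diff: "\<And>f g. f \<in> B \<Longrightarrow> g \<in> B \<Longrightarrow> \<kappa> f = \<kappa> g \<Longrightarrow> f - g \<in> B0"
  shows "finite B" "card B \<le> card B0 * card K"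
proof -
  define r where "r = (\<lambda>v. SOME g. g \<in> B \<and> \<kappa> g = v)"
  have r: "r (\<kappa> f) \<in> B \<and> \<kappa> (r (\<kappa> f)) = \<kappa> f" if "f \<in> B" for f
    unfolding r_def by (rule someI[of _ f]) (use that in simp)
  define F where "F = (\<lambda>f. (f - r (\<kappa> f), \<kappa> f))"
  have "inj_on F B" by (auto simp: inj_on_def F_def)
  moreover have "F ` B \<subseteq> B0 \<times> K" using diff r assms(2) by (auto simp: F_def)
  moreover have "finite (B0 \<times> K)" using assms by simp
  ultimately show "finite B" "card B \<le> card B0 * card K"
    by (auto simp: inj_on_finite card_inj_on_le simp flip: card_cartesian_product)
qed

context hom2_basis
begin

definition monomial :: "nat set \<Rightarrow> 'g \<Rightarrow> bit" where
  "monomial U x = (\<Prod>i\<in>U. \<phi> i x)"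

lemma monomial_empty [simp]: "monomial {} x = 1"
  by (simp add: monomial_def)

lemma monomial_mult:
  assumes "U \<subseteq> {..<b}" "x \<in> carrier G" "y \<in> carrier G"
  shows "monomial U (x \<otimes> y) = (\<Sum>V\<in>Pow U. monomial V x * monomial (U - V) y)"
proof -
  have "monomial U (x \<otimes> y) = (\<Prod>i\<in>U. \<phi> i x + \<phi> i y)"
    unfolding monomial_def using assms \<phi> by (intro prod.cong) (auto simp: hom2_mult)
  then show ?thesis
    using prod_add[of U "\<lambda>i. \<phi> i x" "\<lambda>i. \<phi> i y"] finite_subset[OF assms(1)] by (simp add: monomial_def)
qed

text \<open>A family of coefficients \<open>q\<close> stands for the polynomial with \<open>q T\<close> in front of the monomial \<open>T\<close>. Replacing the
  argument \<open>v\<close> by \<open>v + \<phi>(x)\<close> expands each monomial, and this is the resulting coefficient at \<open>S\<close>.\<close>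
definition translate :: "'g \<Rightarrow> (nat set \<Rightarrow> bit) \<Rightarrow> nat set \<Rightarrow> bit" where
  "translate x q S = (\<Sum>T | S \<subseteq> T \<and> T \<subseteq> {..<b}. monomial (T - S) x * q T)"

lemma finite_above: "finite {T. S \<subseteq> T \<and> T \<subseteq> {..<b :: nat}}"
  by (rule finite_subset[of _ "Pow {..<b}"]) auto

text \<open>Translations compose because monomials are products of homomorphisms; the double sum over
  \<open>S \<subseteq> T \<subseteq> R\<close> is regrouped by the set \<open>T - S\<close>.\<close>
lemma translate_translate:
  assumes "x \<in> carrier G" "y \<in> carrier G"
  shows "translate x (translate y q) S = translate (x \<otimes> y) q S"
proof -
  let ?A = "\<lambda>S. {T. S \<subseteq> T \<and> T \<subseteq> {..<b}}"
  have "translate x (translate y q) S = (\<Sum>T\<in>?A S. \<Sum>R\<in>?A T. monomial (T - S) x * monomial (R - T) y * q R)"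
    by (simp add: translate_def sum_distrib_left mult.assoc)
  also have "\<dots> = (\<Sum>(T, R)\<in>Sigma (?A S) ?A. monomial (T - S) x * monomial (R - T) y * q R)"
    using finite_above by (intro sum.Sigma) auto
  also have "\<dots> = (\<Sum>(R, V)\<in>Sigma (?A S) (\<lambda>R. Pow (R - S)). monomial V x * monomial (R - S - V) y * q R)"
    by (rule sum.reindex_bij_witness[of _ "\<lambda>(R, V). (S \<union> V, R)" "\<lambda>(T, R). (R, T - S)"])
       (auto intro!: arg_cong2[of _ _ _ _ "(*)"] arg_cong2[of _ _ _ _ monomial])
  also have "\<dots> = (\<Sum>R\<in>?A S. \<Sum>V\<in>Pow (R - S). monomial V x * monomial (R - S - V) y * q R)"
    using finite_above finite_subset[of _ "{..<b}"] by (intro sum.Sigma[symmetric]) auto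
  also have "\<dots> = translate (x \<otimes> y) q S"
    unfolding translate_def
  proof (rule sum.cong)
    fix R assume R: "R \<in> ?A S"
    then have "R - S \<subseteq> {..<b}" by auto
    then show "(\<Sum>V\<in>Pow (R - S). monomial V x * monomial (R - S - V) y * q R) = monomial (R - S) (x \<otimes> y) * q R"
      by (simp add: monomial_mult[OF _ assms] sum_distrib_right)
  qed simp
  finally show ?thesis .
qed

lemma translate_add: "translate x (\<lambda>T. q T + q' T) S = translate x q S + translate x q' S"
  by (simp add: translate_def distrib_left sum.distrib)

lemma translate_split:
  assumes "S \<subseteq> {..<b}"
  shows "translate x q S = q S + (\<Sum>T | S \<subset> T \<and> T \<subseteq> {..<b}. monomial (T - S) x * q T)"
proof -
  have "{T. S \<subseteq> T \<and> T \<subseteq> {..<b}} = insert S {T. S \<subset> T \<and> T \<subseteq> {..<b}}" using assms by auto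
  moreover have "finite {T. S \<subset> T \<and> T \<subseteq> {..<b}}"
    by (rule finite_subset[OF _ finite_above[of S]]) auto
  ultimately show ?thesis by (simp add: translate_def)
qed

text \<open>The crossed homomorphisms into the polynomials of degree at most \<open>l\<close> modulo those without a monomial in \<open>\<U>\<close>.
  For an up-closed \<open>\<U>\<close> this is a quotient module, because the coefficient of a translate at \<open>S\<close> involves only
  the coefficients at supersets of \<open>S\<close>. Degrees above \<open>l\<close> are imposed to vanish, but their sets may belong to
  \<open>\<U>\<close>, which keeps \<open>\<U>\<close> up-closed.\<close>
definition crossed_homs :: "nat \<Rightarrow> nat set set \<Rightarrow> (nat set \<Rightarrow> 'g \<Rightarrow> bit) set" where
  "crossed_homs l \<U> = {c. (\<forall>S x. S \<notin> \<U> \<or> l < card S \<or> x \<notin> carrier G \<longrightarrow> c S x = 0) \<and>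
     (\<forall>S\<in>\<U>. \<forall>x\<in>carrier G. \<forall>y\<in>carrier G. c S (x \<otimes> y) = c S x + translate x (\<lambda>T. c T y) S)}"

lemma crossed_homs_eq: "c \<in> crossed_homs l \<U> \<Longrightarrow> S \<in> \<U> \<Longrightarrow> x \<in> carrier G \<Longrightarrow> y \<in> carrier G \<Longrightarrow>
    c S (x \<otimes> y) = c S x + translate x (\<lambda>T. c T y) S"
  by (simp add: crossed_homs_def)

lemma crossed_homs_zero: "c \<in> crossed_homs l \<U> \<Longrightarrow> S \<notin> \<U> \<or> l < card S \<or> x \<notin> carrier G \<Longrightarrow> c S x = 0"
  by (simp add: crossed_homs_def)

lemma crossed_homs_diff: "c \<in> crossed_homs l \<U> \<Longrightarrow> d \<in> crossed_homs l \<U> \<Longrightarrow> c - d \<in> crossed_homs l \<U>"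
  unfolding crossed_homs_def by (auto simp: translate_add add_ac)

definition up_closed :: "nat set set \<Rightarrow> bool" where
  "up_closed \<U> \<longleftrightarrow> \<U> \<subseteq> Pow {..<b} \<and> (\<forall>S\<in>\<U>. \<forall>T. S \<subseteq> T \<and> T \<subseteq> {..<b} \<longrightarrow> T \<in> \<U>)"

lemma up_closedD: "up_closed \<U> \<Longrightarrow> S \<in> \<U> \<Longrightarrow> S \<subseteq> T \<Longrightarrow> T \<subseteq> {..<b} \<Longrightarrow> T \<in> \<U>"
  unfolding up_closed_def by blast

lemma translate_cong: "(\<And>T. S \<subseteq> T \<Longrightarrow> T \<subseteq> {..<b} \<Longrightarrow> q T = q' T) \<Longrightarrow> translate x q S = translate x q' S"
  unfolding translate_def by (intro sum.cong) auto

text \<open>Extending the quotient module by one trivial dimension. The coefficient at \<open>S\<close> must solve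
  \<open>u (x y) = u x + u y + high x y\<close>, where \<open>high\<close> is a 2-cocycle that depends additively on the given
  coefficients. Solvability is ensured by \<open>m\<close> additive conditions, and two solutions differ by a homomorphism.\<close>
lemma crossed_homs_insert:
  assumes up: "up_closed \<U>" "up_closed (insert S \<U>)" and S: "S \<notin> \<U>" "card S \<le> l"
    and fin: "finite (crossed_homs l \<U>)" and h2: "h2_detected_by G m Z" and finb: "finite (hom2 G)"
  shows "finite (crossed_homs l (insert S \<U>))"
    and "2 ^ b * card (crossed_homs l \<U>) \<le> 2 ^ m * card (crossed_homs l (insert S \<U>))"
proof -
  have SI: "S \<subseteq> {..<b}" using up(2) by (auto simp: up_closed_def)
  have above: "T \<in> \<U>" if "S \<subset> T" "T \<subseteq> {..<b}" for T
    using up_closedD[OF up(2), of S T] that by blast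
  have noS: "translate x (\<lambda>T. (c(S := u)) T y) T = translate x (\<lambda>T. c T y) T" if "T \<in> \<U>" for c u x y T
  proof (rule translate_cong)
    fix T' assume "T \<subseteq> T'" "T' \<subseteq> {..<b}"
    then have "T' \<noteq> S" using up_closedD[OF up(1) that, of T'] S(1) by blast
    then show "(c(S := u)) T' y = c T' y" by simp
  qed
  \<comment> \<open>The part of the translate at \<open>S\<close> that comes from the coefficients at proper supersets of \<open>S\<close>.\<close>
  define high where "high = (\<lambda>c x y. \<Sum>T | S \<subset> T \<and> T \<subseteq> {..<b}. monomial (T - S) x * c T (y :: 'g))"
  have high_upd: "high (c(S := u)) = high c" for c u
    unfolding high_def by (intro ext sum.cong) auto
  have crossed_homs_S: "c(S := u) \<in> crossed_homs l (insert S \<U>)"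
    if c: "c \<in> crossed_homs l \<U>" and u: "\<And>x :: 'g. x \<notin> carrier G \<Longrightarrow> u x = 0"
      and eq: "\<And>x y. x \<in> carrier G \<Longrightarrow> y \<in> carrier G \<Longrightarrow> u (x \<otimes> y) = u x + u y + high c x y" for c u
    unfolding crossed_homs_def mem_Collect_eq
  proof (intro conjI allI impI ballI)
    fix T x assume "T \<notin> insert S \<U> \<or> l < card T \<or> x \<notin> carrier G"
    then show "(c(S := u)) T x = 0" using crossed_homs_zero[OF c, of T x] u[of x] S by auto
  next
    fix T x y assume *: "T \<in> insert S \<U>" "x \<in> carrier G" "y \<in> carrier G"
    show "(c(S := u)) T (x \<otimes> y) = (c(S := u)) T x + translate x (\<lambda>T. (c(S := u)) T y) T"
    proof (cases "T = S")
      case True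
      have "translate x (\<lambda>T. (c(S := u)) T y) S = u y + high (c(S := u)) x y"
        unfolding translate_split[OF SI] high_def by simp
      then show ?thesis using eq[OF *(2,3)] unfolding high_upd True by (simp add: add.assoc)
    next
      case False
      then have "T \<in> \<U>" using * by simp
      then show ?thesis using False * noS[of T x c u y] crossed_homs_eq[OF c, of T x y] by simp
    qed
  qed
  have restrict: "c(S := 0) \<in> crossed_homs l \<U>" if "c \<in> crossed_homs l (insert S \<U>)" for c
    unfolding crossed_homs_def mem_Collect_eq
  proof (intro conjI allI impI ballI)
    fix T x assume "T \<notin> \<U> \<or> l < card T \<or> x \<notin> carrier G"
    then show "(c(S := 0)) T x = 0" using crossed_homs_zero[OF that, of T x] by auto
  next
    fix T x y assume *: "T \<in> \<U>" "x \<in> carrier G" "y \<in> carrier G"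
    then have "T \<noteq> S" using S(1) by blast
    then show "(c(S := 0)) T (x \<otimes> y) = (c(S := 0)) T x + translate x (\<lambda>T. (c(S := 0)) T y) T"
      using * crossed_homs_eq[OF that, of T x y] noS[OF *(1), of x c 0 y] by simp
  qed
  show fin': "finite (crossed_homs l (insert S \<U>))"
  proof (rule card_le_fibres(1))
    show "(\<lambda>c. c(S := 0)) ` crossed_homs l (insert S \<U>) \<subseteq> crossed_homs l \<U>" using restrict by auto
    show "finite ((\<lambda>h. (\<lambda>_. 0)(S := h)) ` hom2 G)" using finb by simp
    fix c d assume cd: "c \<in> crossed_homs l (insert S \<U>)" "d \<in> crossed_homs l (insert S \<U>)" and eq: "c(S := 0) = d(S := 0)"
    define e where "e = c - d"
    have e: "e \<in> crossed_homs l (insert S \<U>)" using crossed_homs_diff[OF cd] by (simp add: e_def)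
    have eT: "e T = 0" if "T \<noteq> S" for T using eq that fun_cong[OF eq, of T] by (simp add: e_def fun_eq_iff)
    have "e S \<in> hom2 G" unfolding hom2_def mem_Collect_eq
    proof (intro conjI ballI allI impI)
      fix x y assume "x \<in> carrier G" "y \<in> carrier G"
      then have "e S (x \<otimes> y) = e S x + translate x (\<lambda>T. e T y) S" using crossed_homs_eq[OF e] by simp
      also have "translate x (\<lambda>T. e T y) S = e S y" 
      proof -
        have "(\<Sum>T | S \<subset> T \<and> T \<subseteq> {..<b}. monomial (T - S) x * e T y) = 0"
        proof (intro sum.neutral ballI)
          fix T assume "T \<in> {T. S \<subset> T \<and> T \<subseteq> {..<b}}"
          then have "T \<noteq> S" by blast
          then show "monomial (T - S) x * e T y = 0" by (simp add: eT)
        qed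
        then show ?thesis unfolding translate_split[OF SI] by simp
      qed
      finally show "e S (x \<otimes> y) = e S x + e S y" .
    next
      fix x assume "x \<notin> carrier G"
      then show "e S x = 0" using crossed_homs_zero[OF e, of S x] by simp
    qed
    moreover have "e = (\<lambda>_. 0)(S := e S)" using eT by (auto simp: fun_eq_iff)
    ultimately show "c - d \<in> (\<lambda>h. (\<lambda>_. 0)(S := h)) ` hom2 G" unfolding e_def[symmetric] by blast
  qed (rule fin)
  define obstruction where "obstruction = (\<lambda>c. map (\<lambda>j. \<Sum>(x, y)\<in>Z j. high c x y) [0..<m])"
  define B0 where "B0 = {c \<in> crossed_homs l \<U>. \<forall>j<m. (\<Sum>(x, y)\<in>Z j. high c x y) = 0}"
  have high_diff: "high (c - d) x y = high c x y - high d x y" for c d x y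
    by (simp add: high_def distrib_left sum.distrib)
  have "card (crossed_homs l \<U>) \<le> card B0 * card {v :: bit list. length v = m}"
  proof (rule card_le_fibres(2))
    show "finite {v :: bit list. length v = m}" using card_bit_lists[of m] by (simp add: card_ge_0_finite)
    show "finite B0" using fin by (simp add: B0_def)
    fix c d assume cd: "c \<in> crossed_homs l \<U>" "d \<in> crossed_homs l \<U>" and eq: "obstruction c = obstruction d"
    have "(\<Sum>(x, y)\<in>Z j. high (c - d) x y) = 0" if "j < m" for j
      using arg_cong[OF eq, of "\<lambda>v. v ! j"] that
      by (simp add: obstruction_def high_diff case_prod_unfold sum.distrib)
    then show "c - d \<in> B0" using crossed_homs_diff[OF cd] by (simp add: B0_def)
  qed (auto simp: obstruction_def)
  then have le1: "card (crossed_homs l \<U>) \<le> 2 ^ m * card B0" by (simp add: card_bit_lists mult.commute)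
  have "\<exists>u. (\<forall>x. x \<notin> carrier G \<longrightarrow> u x = 0) \<and>
      (\<forall>x\<in>carrier G. \<forall>y\<in>carrier G. u (x \<otimes> y) = u x + u y + high c x y)" if c: "c \<in> B0" for c
  proof -
    have c': "c \<in> crossed_homs l \<U>" using c by (simp add: B0_def)
    have "high c \<in> cocycles2 G" unfolding cocycles2_def mem_Collect_eq
    \<comment> \<open>The cocycle identity is the associativity of translation, with the terms at \<open>S\<close> itself split off.\<close>
    proof (intro ballI)
      fix x y z assume xyz: "x \<in> carrier G" "y \<in> carrier G" "z \<in> carrier G"
      have split: "translate x' q S = q S + (\<Sum>T | S \<subset> T \<and> T \<subseteq> {..<b}. monomial (T - S) x' * q T)" for x' q
        by (rule translate_split[OF SI])
      define q where "q = (\<lambda>T. c T z)"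
      have "(\<Sum>T | S \<subset> T \<and> T \<subseteq> {..<b}. monomial (T - S) x * c T (y \<otimes> z)) =
          (\<Sum>T | S \<subset> T \<and> T \<subseteq> {..<b}. monomial (T - S) x * (c T y + translate y q T))"
        using above crossed_homs_eq[OF c' _ xyz(2,3)] by (intro sum.cong) (auto simp: q_def)
      then have 1: "high c x (y \<otimes> z) = high c x y + (\<Sum>T | S \<subset> T \<and> T \<subseteq> {..<b}. monomial (T - S) x * translate y q T)"
        by (simp add: high_def distrib_left sum.distrib)
      have 2: "high c x' z = translate x' q S + q S" for x'
        unfolding split[of x' q] by (simp add: high_def q_def add.commute)
      have 3: "(\<Sum>T | S \<subset> T \<and> T \<subseteq> {..<b}. monomial (T - S) x * translate y q T) = translate x (translate y q) S + translate y q S"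
        unfolding split[of x "translate y q"] by (simp add: add.commute)
      show "high c y z + high c (x \<otimes> y) z + high c x (y \<otimes> z) + high c x y = 0"
        by (simp add: 1 2 3 translate_translate[OF xyz(1,2)] add_ac)
    qed
    then obtain u where u: "\<And>x y. x \<in> carrier G \<Longrightarrow> y \<in> carrier G \<Longrightarrow> high c x y = u x + u y + u (x \<otimes> y)"
      using h2 c unfolding h2_detected_by_def B0_def by auto
    define u' where "u' = (\<lambda>x. if x \<in> carrier G then u x else 0)"
    show ?thesis by (rule exI[of _ u']) (auto simp: u'_def u add_ac)
  qed
  then obtain u where u0: "\<And>c x. c \<in> B0 \<Longrightarrow> x \<notin> carrier G \<Longrightarrow> u c x = 0"
    and u: "\<And>c x y. c \<in> B0 \<Longrightarrow> x \<in> carrier G \<Longrightarrow> y \<in> carrier G \<Longrightarrow> u c (x \<otimes> y) = u c x + u c y + high c x y"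
    by metis
  define F where "F = (\<lambda>(c, h). c(S := u c + h))"
  have B0S: "c S = 0" if "c \<in> B0" for c using that S(1) by (auto simp: B0_def crossed_homs_def fun_eq_iff)
  have "inj_on F (B0 \<times> hom2 G)"
  proof (rule inj_onI, clarify)
    fix c h d k assume *: "c \<in> B0" "h \<in> hom2 G" "d \<in> B0" "k \<in> hom2 G" "F (c, h) = F (d, k)"
    have "c T = d T" for T
      using fun_cong[OF *(5), of T] B0S[OF *(1)] B0S[OF *(3)] by (cases "T = S") (auto simp: F_def)
    then have cd: "c = d" by (rule ext)
    have "u c + h = u c + k" using fun_cong[OF *(5), of S] cd by (simp add: F_def)
    then show "c = d \<and> h = k" using cd by (metis add_left_cancel)
  qed
  moreover have "F ` (B0 \<times> hom2 G) \<subseteq> crossed_homs l (insert S \<U>)"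
  proof clarify
    fix c h assume "c \<in> B0" "h \<in> hom2 G"
    then show "F (c, h) \<in> crossed_homs l (insert S \<U>)" unfolding F_def prod.case
      by (intro crossed_homs_S) (auto simp: B0_def u u0 hom2_mult add_ac dest: hom2_outside)
  qed
  ultimately have "card (B0 \<times> hom2 G) \<le> card (crossed_homs l (insert S \<U>))" using fin' by (rule card_inj_on_le)
  then have le2: "card B0 * 2 ^ b \<le> card (crossed_homs l (insert S \<U>))" by (simp add: card_hom2 card_cartesian_product)
  show "2 ^ b * card (crossed_homs l \<U>) \<le> 2 ^ m * card (crossed_homs l (insert S \<U>))"
  proof -
    have "2 ^ b * card (crossed_homs l \<U>) \<le> 2 ^ b * (2 ^ m * card B0)" using le1 by (rule mult_le_mono2)
    also have "\<dots> = 2 ^ m * (card B0 * 2 ^ b)" by (simp only: mult_ac)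
    also have "\<dots> \<le> 2 ^ m * card (crossed_homs l (insert S \<U>))" using le2 by (rule mult_le_mono2)
    finally show ?thesis .
  qed
qed

definition top_layer :: "nat \<Rightarrow> nat set set" where
  "top_layer l = {S. S \<subseteq> {..<b} \<and> l \<le> card S}"

text \<open>On the top layer the translation action is trivial, so the coefficients there are independent homomorphisms.\<close>
lemma crossed_homs_top_layer:
  assumes fin: "finite (hom2 G)"
  shows "finite (crossed_homs l (top_layer l))" "card (crossed_homs l (top_layer l)) = 2 ^ (b * (b choose l))"
proof -
  define A where "A = {S. S \<subseteq> {..<b} \<and> card S = l}"
  have finA: "finite A" unfolding A_def by (rule finite_subset[of _ "Pow {..<b}"]) auto
  have cA: "card A = b choose l" unfolding A_def using n_subsets[of "{..<b}" l] by simp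
  have larger: "l < card T" if "S \<subset> T" "T \<subseteq> {..<b}" "l \<le> card S" for S T
    using psubset_card_mono[OF finite_subset[OF that(2)] that(1)] that(3) by simp
  have translate_top: "translate x q S = q S" if S: "S \<in> top_layer l" and q: "\<And>T. l < card T \<Longrightarrow> q T = 0" for x q S
  proof -
    have "(\<Sum>T | S \<subset> T \<and> T \<subseteq> {..<b}. monomial (T - S) x * q T) = 0"
    proof (intro sum.neutral ballI)
      fix T assume "T \<in> {T. S \<subset> T \<and> T \<subseteq> {..<b}}"
      then have "l < card T" using larger[of S T] S by (simp add: top_layer_def)
      then show "monomial (T - S) x * q T = 0" by (simp add: q)
    qed
    then show ?thesis using translate_split[of S x q] S by (simp add: top_layer_def)
  qed
  define F where "F = (\<lambda>h S. if S \<in> A then h S else (0 :: 'g \<Rightarrow> bit))"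
  have "bij_betw F (PiE A (\<lambda>_. hom2 G)) (crossed_homs l (top_layer l))"
  proof (rule bij_betw_byWitness[where f' = "\<lambda>c. restrict c A"])
    show "\<forall>h\<in>PiE A (\<lambda>_. hom2 G). restrict (F h) A = h"
      by (auto simp: F_def fun_eq_iff PiE_def extensional_def)
    have cA: "S \<notin> A \<Longrightarrow> c S = 0" if "c \<in> crossed_homs l (top_layer l)" for c S
      using crossed_homs_zero[OF that, of S] by (intro ext) (auto simp: A_def top_layer_def)
    show "\<forall>c\<in>crossed_homs l (top_layer l). F (restrict c A) = c"
      using cA by (auto simp: F_def fun_eq_iff)
    show "F ` PiE A (\<lambda>_. hom2 G) \<subseteq> crossed_homs l (top_layer l)"
    proof clarify
      fix h assume "h \<in> PiE A (\<lambda>_. hom2 G)"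
      then have h: "h S \<in> hom2 G" if "S \<in> A" for S using that by auto
      show "F h \<in> crossed_homs l (top_layer l)"
        unfolding crossed_homs_def mem_Collect_eq
      proof (intro conjI allI impI ballI)
        fix S x assume "S \<notin> top_layer l \<or> l < card S \<or> x \<notin> carrier G"
        then have "S \<in> A \<Longrightarrow> x \<notin> carrier G" by (auto simp: A_def top_layer_def)
        then show "F h S x = 0" using hom2_outside[OF h] by (auto simp: F_def)
      next
        fix S x y assume S: "S \<in> top_layer l" and xy: "x \<in> carrier G" "y \<in> carrier G"
        have "translate x (\<lambda>T. F h T y) S = F h S y" by (rule translate_top[OF S]) (simp add: F_def A_def)
        moreover have "F h S (x \<otimes> y) = F h S x + F h S y"
          using hom2_mult[OF h xy] by (simp add: F_def)
        ultimately show "F h S (x \<otimes> y) = F h S x + translate x (\<lambda>T. F h T y) S" by simp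
      qed
    qed
    show "(\<lambda>c. restrict c A) ` crossed_homs l (top_layer l) \<subseteq> PiE A (\<lambda>_. hom2 G)"
    proof (intro image_subsetI restrict_PiE_iff[THEN iffD2] ballI)
      fix c S assume c: "c \<in> crossed_homs l (top_layer l)" and "S \<in> A"
      then have S: "S \<in> top_layer l" by (simp add: A_def top_layer_def)
      show "c S \<in> hom2 G" unfolding hom2_def mem_Collect_eq
      proof (intro conjI ballI allI impI)
        fix x y assume xy: "x \<in> carrier G" "y \<in> carrier G"
        have "translate x (\<lambda>T. c T y) S = c S y" by (rule translate_top[OF S]) (rule crossed_homs_zero[OF c], simp)
        then show "c S (x \<otimes> y) = c S x + c S y" using crossed_homs_eq[OF c S xy] by simp
      next
        fix x assume "x \<notin> carrier G"
        then show "c S x = 0" using crossed_homs_zero[OF c, of S x] by simp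
      qed
    qed
  qed
  moreover have "finite (PiE A (\<lambda>_. hom2 G))" using finA fin by (intro finite_PiE) auto
  moreover have "card (PiE A (\<lambda>_. hom2 G)) = 2 ^ (b * (b choose l))"
    using finA by (simp add: card_PiE card_hom2 cA power_mult)
  ultimately show "finite (crossed_homs l (top_layer l))" "card (crossed_homs l (top_layer l)) = 2 ^ (b * (b choose l))"
    using bij_betw_finite[of F] bij_betw_same_card[of F] by auto
qed

text \<open>Remove from \<open>\<U>\<close> a set of least cardinality below the top layer: what remains is again up-closed, so every \<open>\<U>\<close>
  is reached from the top layer by single insertions, each losing a factor of at most \<open>2\<^sup>C\<close>.\<close>
lemma card_crossed_homs_ge:
  assumes fin: "finite (hom2 G)" and h2: "h2_detected_by G m Z" and m: "m \<le> b + C"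
    and "up_closed \<U>" "top_layer l \<subseteq> \<U>"
  shows "finite (crossed_homs l \<U>) \<and>
    2 ^ (b * (b choose l)) \<le> 2 ^ (C * card (\<U> - top_layer l)) * card (crossed_homs l \<U>)"
  using assms(4,5)
proof (induction "card (\<U> - top_layer l)" arbitrary: \<U> rule: less_induct)
  case less
  show ?case
  proof (cases "\<U> = top_layer l")
    case True
    then show ?thesis using crossed_homs_top_layer[OF fin, of l] by simp
  next
    case False
    define D where "D = \<U> - top_layer l"
    have finU: "finite \<U>" using less.prems(1) unfolding up_closed_def by (auto intro: finite_subset)
    have "D \<noteq> {}" using False less.prems(2) by (auto simp: D_def)
    then obtain S0 where "S0 \<in> D" by blast
    then obtain S where S: "S \<in> D" and Smin: "\<And>T. T \<in> D \<Longrightarrow> card S \<le> card T"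
      using ex_has_least_nat[of "\<lambda>S. S \<in> D" S0 card] by blast
    define \<V> where "\<V> = \<U> - {S}"
    have SU: "S \<in> \<U>" "S \<notin> top_layer l" using S by (auto simp: D_def)
    have SI: "S \<subseteq> {..<b}" using SU less.prems(1) by (auto simp: up_closed_def)
    have Sl: "card S < l" using SU SI by (auto simp: top_layer_def)
    have U: "\<U> = insert S \<V>" using SU by (auto simp: \<V>_def)
    have "up_closed \<V>"
      unfolding up_closed_def
    proof (intro conjI ballI allI impI)
      show "\<V> \<subseteq> Pow {..<b}" using less.prems(1) by (auto simp: up_closed_def \<V>_def)
      fix T R assume T: "T \<in> \<V>" and R: "T \<subseteq> R \<and> R \<subseteq> {..<b}"
      then have "R \<in> \<U>" using up_closedD[OF less.prems(1), of T R] by (simp add: \<V>_def)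
      moreover have "R \<noteq> S"
      proof
        assume "R = S"
        then have "T \<subset> S" using T R by (auto simp: \<V>_def)
        then have "card T < card S" using finite_subset[OF SI finite_lessThan] by (intro psubset_card_mono)
        moreover have "T \<in> D" using T \<open>card T < card S\<close> Sl by (auto simp: \<V>_def D_def top_layer_def)
        ultimately show False using Smin[of T] by simp
      qed
      ultimately show "R \<in> \<V>" by (simp add: \<V>_def)
    qed
    moreover have "top_layer l \<subseteq> \<V>" using less.prems(2) SU by (auto simp: \<V>_def)
    moreover have cardD: "card D = Suc (card (\<V> - top_layer l))"
    proof -
      have "D = insert S (\<V> - top_layer l)" using SU by (auto simp: D_def \<V>_def)
      then show ?thesis using finU by (simp add: \<V>_def)
    qed
    ultimately have IH: "finite (crossed_homs l \<V>)"
      "2 ^ (b * (b choose l)) \<le> 2 ^ (C * card (\<V> - top_layer l)) * card (crossed_homs l \<V>)"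
      using less.hyps[of \<V>] by (simp_all add: D_def)
    have step: "finite (crossed_homs l (insert S \<V>))"
      "2 ^ b * card (crossed_homs l \<V>) \<le> 2 ^ m * card (crossed_homs l (insert S \<V>))"
    proof -
      have "S \<notin> \<V>" by (simp add: \<V>_def)
      then show "finite (crossed_homs l (insert S \<V>))"
        "2 ^ b * card (crossed_homs l \<V>) \<le> 2 ^ m * card (crossed_homs l (insert S \<V>))"
        using crossed_homs_insert[OF \<open>up_closed \<V>\<close> _ _ less_imp_le[OF Sl] IH(1) h2 fin] less.prems(1) U by simp_all
    qed
    have "2 ^ b * card (crossed_homs l \<V>) \<le> 2 ^ (b + C) * card (crossed_homs l \<U>)"
    proof -
      have "(2::nat) ^ m \<le> 2 ^ (b + C)" using m by (intro power_increasing) auto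
      then have "2 ^ m * card (crossed_homs l \<U>) \<le> 2 ^ (b + C) * card (crossed_homs l \<U>)" by (rule mult_le_mono1)
      then show ?thesis using step(2) unfolding U[symmetric] by (rule order_trans[rotated])
    qed
    then have "card (crossed_homs l \<V>) \<le> 2 ^ C * card (crossed_homs l \<U>)" by (simp add: power_add mult.assoc)
    then have "2 ^ (C * card (\<V> - top_layer l)) * card (crossed_homs l \<V>) \<le>
        2 ^ (C * card (\<V> - top_layer l)) * (2 ^ C * card (crossed_homs l \<U>))" by (rule mult_le_mono2)
    also have "\<dots> = 2 ^ (C * card D) * card (crossed_homs l \<U>)"
      unfolding cardD by (simp add: power_add)
    finally have "2 ^ (b * (b choose l)) \<le> 2 ^ (C * card D) * card (crossed_homs l \<U>)"
      using IH(2) by (rule order_trans[rotated])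
    then show ?thesis using step(1) unfolding U[symmetric] D_def by (rule conjI[rotated])
  qed
qed

definition common_kernel :: "'g set" where
  "common_kernel = {x \<in> carrier G. \<forall>i<b. \<phi> i x = 0}"

text \<open>The product of the dual elements \<open>g j\<close> over \<open>j \<in> U\<close> has the required coordinates.\<close>
lemma coordinates_surj:
  assumes "U \<subseteq> {..<b}"
  shows "\<exists>x\<in>carrier G. \<forall>i<b. \<phi> i x = (if i \<in> U then 1 else 0)"
  using finite_subset[OF assms finite_lessThan] assms
proof (induction U rule: finite_induct)
  case empty
  then show ?case using hom2_one \<phi> by (intro bexI[of _ \<one>]) auto
next
  case (insert j U)
  then obtain x where x: "x \<in> carrier G" "\<And>i. i < b \<Longrightarrow> \<phi> i x = (if i \<in> U then 1 else 0)" by auto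
  have j: "j < b" "j \<notin> U" using insert by auto
  show ?case
  proof (intro bexI[of _ "x \<otimes> g j"] allI impI)
    fix i assume i: "i < b"
    show "\<phi> i (x \<otimes> g j) = (if i \<in> insert j U then 1 else 0)"
      using hom2_mult[OF \<phi>[OF i] x(1) g[OF j(1)]] x(2)[OF i] dual[OF i j(1)] j(2) by auto
  qed (use x g j in auto)
qed

text \<open>The empty monomial is the value at the origin. On the common kernel all other monomials vanish, so
  there the coefficient at the empty set is a homomorphism; together with its values at representatives
  \<open>p U\<close> of all points of the quotient it determines the whole family, since the values at \<open>p S \<otimes> x\<close>
  recover the coefficient at \<open>S\<close> by induction on \<open>S\<close>.\<close>
lemma card_hom2_common_kernel_ge:
  assumes fin: "finite (hom2 G)" and h2: "h2_detected_by G m Z" and m: "m \<le> b + C"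
    and finK: "finite (hom2 (G\<lparr>carrier := common_kernel\<rparr>))"
  shows "2 ^ (b * (b choose l)) \<le> 2 ^ ((C + 1) * 2 ^ b) * card (hom2 (G\<lparr>carrier := common_kernel\<rparr>))"
proof -
  define X where "X = crossed_homs l (Pow {..<b})"
  have "up_closed (Pow {..<b})" by (auto simp: up_closed_def)
  moreover have "top_layer l \<subseteq> Pow {..<b}" by (auto simp: top_layer_def)
  ultimately have X: "finite X" "2 ^ (b * (b choose l)) \<le> 2 ^ (C * card (Pow {..<b} - top_layer l)) * card X"
    using card_crossed_homs_ge[OF fin h2 m] by (auto simp: X_def)
  have "card (Pow {..<b} - top_layer l) \<le> card (Pow {..<b})" by (intro card_mono) auto
  then have "(2::nat) ^ (C * card (Pow {..<b} - top_layer l)) \<le> 2 ^ (C * 2 ^ b)"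
    by (intro power_increasing) (auto simp: card_Pow)
  then have X2: "2 ^ (b * (b choose l)) \<le> 2 ^ (C * 2 ^ b) * card X"
    using X(2) mult_le_mono1 order_trans by blast
  obtain p where p: "\<And>U. U \<subseteq> {..<b} \<Longrightarrow> p U \<in> carrier G"
      "\<And>U i. U \<subseteq> {..<b} \<Longrightarrow> i < b \<Longrightarrow> \<phi> i (p U) = (if i \<in> U then 1 else 0)"
  proof -
    have "\<forall>U. \<exists>x. U \<subseteq> {..<b} \<longrightarrow> x \<in> carrier G \<and> (\<forall>i<b. \<phi> i x = (if i \<in> U then 1 else 0))"
      using coordinates_surj by blast
    then obtain p where "\<forall>U. U \<subseteq> {..<b} \<longrightarrow> p U \<in> carrier G \<and> (\<forall>i<b. \<phi> i (p U) = (if i \<in> U then 1 else 0))"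
      by (rule choice[THEN exE])
    then show thesis by (intro that[of p]) simp_all
  qed
  define F where "F = (\<lambda>c :: nat set \<Rightarrow> 'g \<Rightarrow> bit. (\<lambda>x. if x \<in> common_kernel then c {} x else (0::bit),
      \<lambda>U\<in>Pow {..<b}. c {} (p U)))"
  have monomial_p: "monomial T (p U) = (if T \<subseteq> U then 1 else 0)" if "U \<subseteq> {..<b}" "T \<subseteq> {..<b}" for T U
  proof -
    have "monomial T (p U) = (\<Prod>i\<in>T. if i \<in> U then 1 else 0)"
      unfolding monomial_def using that p(2)[OF that(1)] by (intro prod.cong) auto
    also have "\<dots> = (if T \<subseteq> U then 1 else 0)"
    proof (cases "T \<subseteq> U")
      case True
      then show ?thesis by (simp add: subset_iff prod.neutral)
    next
      case False
      then show ?thesis using finite_subset[OF that(2)] by (auto intro!: prod_zero)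
    qed
    finally show ?thesis .
  qed
  have monomial_kernel: "monomial T x = 0" if "x \<in> common_kernel" "T \<subseteq> {..<b}" "T \<noteq> {}" for T x
    unfolding monomial_def using that finite_subset[OF that(2)]
    by (intro prod_zero) (auto simp: common_kernel_def)
  have eq_kernel: "c {} (x \<otimes> y) = c {} x + c {} y"
    if c: "c \<in> X" and x: "x \<in> common_kernel" and y: "y \<in> carrier G" for c x y
  proof -
    have "(\<Sum>T | {} \<subset> T \<and> T \<subseteq> {..<b}. monomial (T - {}) x * c T y) = 0"
      using monomial_kernel[OF x] by (intro sum.neutral) auto
    then show ?thesis
      using crossed_homs_eq[OF c[unfolded X_def], of "{}" x y] translate_split[of "{}" x "\<lambda>T. c T y"] x y
      by (simp add: common_kernel_def)
  qed
  have "inj_on F X"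
  proof (rule inj_onI)
    fix c d assume cd: "c \<in> X" "d \<in> X" and eq: "F c = F d"
    define e where "e = c - d"
    have e: "e \<in> X" using crossed_homs_diff cd by (simp add: e_def X_def)
    have eK: "e {} x = 0" if "x \<in> common_kernel" for x
      using fun_cong[OF arg_cong[OF eq, of fst], of x] that by (simp add: F_def e_def)
    have ep: "e {} (p U) = 0" if "U \<subseteq> {..<b}" for U
      using fun_cong[OF arg_cong[OF eq, of snd], of U] that by (simp add: F_def e_def)
    have e0: "e {} x = 0" if x: "x \<in> carrier G" for x
    proof -
      define U where "U = {i. i < b \<and> \<phi> i x = 1}"
      have U: "U \<subseteq> {..<b}" by (auto simp: U_def)
      have "\<phi> i (x \<otimes> inv (p U)) = 0" if "i < b" for i
      proof -
        have "\<phi> i (x \<otimes> inv (p U)) = \<phi> i x + \<phi> i (p U)"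
          using hom2_mult[OF \<phi>[OF that] x, of "inv (p U)"] hom2_inv[OF \<phi>[OF that], of "p U"] p(1)[OF U] by simp
        then show ?thesis using p(2)[OF U that] that by (cases "\<phi> i x = 0") (auto simp: U_def)
      qed
      then have k: "x \<otimes> inv (p U) \<in> common_kernel" using x p(1)[OF U] by (simp add: common_kernel_def)
      have "e {} (x \<otimes> inv (p U) \<otimes> p U) = 0"
        using eq_kernel[OF e k p(1)[OF U]] eK[OF k] ep[OF U] by simp
      then show ?thesis using x p(1)[OF U] by (simp add: m_assoc)
    qed
    have "e S x = 0" if "S \<subseteq> {..<b}" "x \<in> carrier G" for S x
      using finite_subset[OF that(1) finite_lessThan] that
    proof (induction S rule: finite_psubset_induct)
      case (psubset S)
      have "(\<Sum>T | {} \<subseteq> T \<and> T \<subseteq> {..<b}. monomial (T - {}) (p S) * e T x) = (\<Sum>T\<in>{S}. e T x)"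
      proof (rule sum.mono_neutral_cong_right)
        show "finite {T. {} \<subseteq> T \<and> T \<subseteq> {..<b}}" by (rule finite_above)
        show "\<forall>T\<in>{T. {} \<subseteq> T \<and> T \<subseteq> {..<b}} - {S}. monomial (T - {}) (p S) * e T x = 0"
        proof
          fix T assume T: "T \<in> {T. {} \<subseteq> T \<and> T \<subseteq> {..<b}} - {S}"
          then show "monomial (T - {}) (p S) * e T x = 0"
            using monomial_p[of S T] psubset.IH[of T] psubset.prems by (cases "T \<subseteq> S") auto
        qed
      qed (use psubset.prems monomial_p[of S S] in auto)
      then have "translate (p S) (\<lambda>T. e T x) {} = e S x" by (simp add: translate_def)
      moreover have "e {} (p S \<otimes> x) = e {} (p S) + translate (p S) (\<lambda>T. e T x) {}"
        using crossed_homs_eq[OF e[unfolded X_def], of "{}" "p S" x] p(1) psubset.prems by simp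
      ultimately show ?case using e0 p(1) psubset.prems by simp
    qed
    then have "e S x = 0" for S x
      using crossed_homs_zero[OF e[unfolded X_def], of S x] by (cases "S \<subseteq> {..<b} \<and> x \<in> carrier G") auto
    then have "c S x + d S x = 0" for S x by (simp add: e_def)
    then show "c = d" by (intro ext) (simp add: bit_add_eq_0_iff)
  qed
  moreover have "F ` X \<subseteq> hom2 (G\<lparr>carrier := common_kernel\<rparr>) \<times> PiE (Pow {..<b}) (\<lambda>_. UNIV)"
  proof (rule image_subsetI)
    fix c assume c: "c \<in> X"
    have K_carrier: "x \<in> carrier G" if "x \<in> common_kernel" for x using that by (simp add: common_kernel_def)
    have "x \<otimes> y \<in> common_kernel" if "x \<in> common_kernel" "y \<in> common_kernel" for x y
      using that \<phi> by (auto simp: common_kernel_def hom2_mult)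
    then have "(\<lambda>x. if x \<in> common_kernel then c {} x else 0) \<in> hom2 (G\<lparr>carrier := common_kernel\<rparr>)"
      using eq_kernel[OF c] K_carrier by (simp add: hom2_def)
    then show "F c \<in> hom2 (G\<lparr>carrier := common_kernel\<rparr>) \<times> PiE (Pow {..<b}) (\<lambda>_. UNIV)"
      by (simp add: F_def)
  qed
  moreover have fin': "finite (PiE (Pow {..<b}) (\<lambda>_. UNIV :: bit set))"
    by (intro finite_PiE) (auto simp: UNIV_bit)
  ultimately have "card X \<le> card (hom2 (G\<lparr>carrier := common_kernel\<rparr>) \<times> PiE (Pow {..<b}) (\<lambda>_. UNIV :: bit set))"
    using finK by (intro card_inj_on_le) auto
  also have "\<dots> = 2 ^ 2 ^ b * card (hom2 (G\<lparr>carrier := common_kernel\<rparr>))"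
    by (simp add: card_cartesian_product card_PiE card_Pow UNIV_bit numeral_2_eq_2)
  finally have "2 ^ (b * (b choose l)) \<le> 2 ^ (C * 2 ^ b) * (2 ^ 2 ^ b * card (hom2 (G\<lparr>carrier := common_kernel\<rparr>)))"
    using X2 mult_le_mono2 order_trans by blast
  then show ?thesis by (simp add: power_add mult.assoc mult.left_commute add_mult_distrib)
qed

end

section \<open>Mod 2 homology\<close>

abbreviation R2 :: "int ring" where "R2 \<equiv> residue_ring 2"

lemma field_R2: "field R2"
proof -
  interpret residues_prime 2 R2 by unfold_locales simp_all
  show ?thesis by (rule is_field)
qed

lemma R2_simps:
  "carrier R2 = {0, 1}" "x \<oplus>\<^bsub>R2\<^esub> y = (x + y) mod 2" "x \<otimes>\<^bsub>R2\<^esub> y = (x * y) mod 2"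
  "\<zero>\<^bsub>R2\<^esub> = 0" "\<one>\<^bsub>R2\<^esub> = 1"
  by (auto simp: residue_ring_def)

lemma R2_minus_one_pow: "(\<ominus>\<^bsub>R2\<^esub> \<one>\<^bsub>R2\<^esub>) [^]\<^bsub>R2\<^esub> (i :: nat) = 1"
proof -
  interpret residues_prime 2 R2 by unfold_locales simp_all
  have "\<ominus>\<^bsub>R2\<^esub> \<one>\<^bsub>R2\<^esub> = \<one>\<^bsub>R2\<^esub>" by (simp add: res_neg_eq res_one_eq)
  then show ?thesis using nat_pow_one[of i] by (simp only: res_one_eq)
qed

text \<open>The isomorphism from \<open>F\<^sub>2\<close> as a type to the ring of residues modulo 2.\<close>
definition int_of_bit :: "bit \<Rightarrow> int" where
  "int_of_bit a = (if a = 0 then 0 else 1)"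

lemma int_of_bit_add: "int_of_bit (a + b) = (int_of_bit a + int_of_bit b) mod 2"
  by (cases a; cases b) (simp_all add: int_of_bit_def)

lemma int_of_bit_inj: "int_of_bit a = int_of_bit b \<longleftrightarrow> a = b"
  by (cases a; cases b) (simp_all add: int_of_bit_def)

lemma int_of_bit_simps [simp]: "int_of_bit 0 = 0" "int_of_bit 1 = 1"
  by (simp_all add: int_of_bit_def)

lemma int_of_bit_range: "int_of_bit a \<in> {0, 1}"
  by (simp add: int_of_bit_def)

lemma finsum_int_of_bit:
  assumes "finite A"
  shows "(\<Oplus>\<^bsub>R2\<^esub>a\<in>A. int_of_bit (h a)) = int_of_bit (\<Sum>a\<in>A. h a)"
  using assms
proof (induction A rule: finite_induct)
  case empty
  interpret residues_prime 2 R2 by unfold_locales simp_all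
  show ?case by (simp add: R2_simps)
next
  case (insert a A)
  interpret residues_prime 2 R2 by unfold_locales simp_all
  have "(\<Oplus>\<^bsub>R2\<^esub>a\<in>insert a A. int_of_bit (h a)) = int_of_bit (h a) \<oplus>\<^bsub>R2\<^esub> (\<Oplus>\<^bsub>R2\<^esub>a\<in>A. int_of_bit (h a))"
    using insert.hyps int_of_bit_range by (intro finsum_insert) (auto simp: R2_simps(1))
  then show ?case using insert by (simp add: R2_simps(2) int_of_bit_add)
qed

definition chains2 :: "('g, 'm) monoid_scheme \<Rightarrow> nat \<Rightarrow> ('g list \<Rightarrow> bit) set" where
  "chains2 G n = {w \<in> fin_supp. \<forall>xs. w xs \<noteq> 0 \<longrightarrow> length xs = n \<and> set xs \<subseteq> carrier G}"

text \<open>The bar differential over \<open>F\<^sub>2\<close>, where signs disappear.\<close>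
definition boundary2 :: "('g, 'm) monoid_scheme \<Rightarrow> nat \<Rightarrow> ('g list \<Rightarrow> bit) \<Rightarrow> 'g list \<Rightarrow> bit" where
  "boundary2 G n w = (\<Sum>xs | w xs \<noteq> 0. \<Sum>i\<le>n. single (bar_face G n i xs))"

definition coboundary2 :: "('g, 'm) monoid_scheme \<Rightarrow> nat \<Rightarrow> ('g list \<Rightarrow> bit) \<Rightarrow> 'g list \<Rightarrow> bit" where
  "coboundary2 G n f xs = (\<Sum>i\<le>n. f (bar_face G n i xs))"

lemma pairing_boundary2: "pairing f (boundary2 G n w) = pairing (coboundary2 G n f) w"
  unfolding boundary2_def
  by (simp add: pairing_sum fin_supp_sum) (simp add: pairing_def coboundary2_def)

lemma boundary2_apply: "boundary2 G n w ys = pairing (coboundary2 G n (single ys)) w"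
proof -
  have "single zs ys = single ys zs" for zs by (simp add: single_def)
  then show ?thesis by (simp add: boundary2_def sum_fun_apply pairing_def coboundary2_def)
qed

lemma boundary2_add:
  "v \<in> fin_supp \<Longrightarrow> w \<in> fin_supp \<Longrightarrow> boundary2 G n (v + w) = boundary2 G n v + boundary2 G n w"
  by (rule ext) (simp add: boundary2_apply pairing_add_right)

lemma chains2_add: "v \<in> chains2 G n \<Longrightarrow> w \<in> chains2 G n \<Longrightarrow> v + w \<in> chains2 G n"
  unfolding chains2_def mem_Collect_eq
proof (intro conjI allI impI)
  assume *: "v \<in> fin_supp \<and> (\<forall>xs. v xs \<noteq> 0 \<longrightarrow> length xs = n \<and> set xs \<subseteq> carrier G)"
    "w \<in> fin_supp \<and> (\<forall>xs. w xs \<noteq> 0 \<longrightarrow> length xs = n \<and> set xs \<subseteq> carrier G)"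
  then show "v + w \<in> fin_supp" by (intro fin_supp_add) auto
  fix xs assume "(v + w) xs \<noteq> 0"
  then have "v xs \<noteq> 0 \<or> w xs \<noteq> 0" by (cases "v xs = 0") auto
  then show "length xs = n" "set xs \<subseteq> carrier G" using * by blast+
qed

lemma chains2_zero: "0 \<in> chains2 G n"
  by (simp add: chains2_def fin_supp_def)

lemma chains2_fin_supp: "w \<in> chains2 G n \<Longrightarrow> w \<in> fin_supp"
  by (simp add: chains2_def)

lemma chains2_supp: "w \<in> chains2 G n \<Longrightarrow> w xs \<noteq> 0 \<Longrightarrow> length xs = n \<and> set xs \<subseteq> carrier G"
  unfolding chains2_def by blast

lemma single_chains2: "length xs = n \<Longrightarrow> set xs \<subseteq> carrier G \<Longrightarrow> single xs \<in> chains2 G n"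
  by (auto simp: chains2_def) (auto simp: single_def split: if_splits)

lemma (in group) bar_face_closed:
  assumes xs: "length xs = Suc n" "set xs \<subseteq> carrier G" and i: "i \<le> Suc n"
  shows "length (bar_face G (Suc n) i xs) = n" "set (bar_face G (Suc n) i xs) \<subseteq> carrier G"
proof -
  have 1: "set (tl xs) \<subseteq> carrier G" "set (butlast xs) \<subseteq> carrier G"
    using set_mono_suffix[OF suffix_tl, of xs] set_mono_prefix[OF prefixeq_butlast, of xs] xs(2) by blast+
  have 2: "set (take j xs) \<subseteq> carrier G" "set (drop j xs) \<subseteq> carrier G" for j
    using xs(2) by (auto dest: in_set_takeD in_set_dropD)
  have 3: "xs ! j \<in> carrier G" if "j < Suc n" for j using xs that nth_mem[of j xs] by auto
  show "length (bar_face G (Suc n) i xs) = n" using xs i by (auto simp: bar_face_def)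
  show "set (bar_face G (Suc n) i xs) \<subseteq> carrier G"
    using xs i 1 2 3 by (auto simp: bar_face_def)
qed

lemma (in group) boundary2_closed: "w \<in> chains2 G (Suc n) \<Longrightarrow> boundary2 G (Suc n) w \<in> chains2 G n"
proof -
  assume w: "w \<in> chains2 G (Suc n)"
  have sum: "(\<Sum>a\<in>A. h a) \<in> chains2 G n" if "\<And>a. a \<in> A \<Longrightarrow> h a \<in> chains2 G n" for A :: "'x set" and h
    using that
  proof (induction A rule: infinite_finite_induct)
    case (insert a A)
    then show ?case unfolding sum.insert[OF insert.hyps] by (intro chains2_add) auto
  qed (simp_all add: chains2_zero)
  show ?thesis unfolding boundary2_def
    by (intro sum single_chains2 bar_face_closed) (use chains2_supp[OF w] in auto)
qed

definition cycles2 :: "('g, 'm) monoid_scheme \<Rightarrow> nat \<Rightarrow> ('g list \<Rightarrow> bit) set" where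
  "cycles2 G n = {w \<in> chains2 G n. boundary2 G n w = 0}"

definition boundaries2 :: "('g, 'm) monoid_scheme \<Rightarrow> nat \<Rightarrow> ('g list \<Rightarrow> bit) set" where
  "boundaries2 G n = boundary2 G (Suc n) ` chains2 G (Suc n)"

definition to_int_chain :: "('a \<Rightarrow> bit) \<Rightarrow> 'a \<Rightarrow> int" where
  "to_int_chain w = (\<lambda>x. int_of_bit (w x))"

lemma to_int_chain_inj: "to_int_chain v = to_int_chain w \<longleftrightarrow> v = w"
  by (auto simp: to_int_chain_def fun_eq_iff int_of_bit_inj)

lemma int_of_bit_nonzero: "int_of_bit a \<noteq> 0 \<longleftrightarrow> a \<noteq> 0"
  by (simp add: int_of_bit_def)

lemma carrier_bar_chains: "carrier (bar_chains R2 G n) = to_int_chain ` chains2 G n"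
proof (intro equalityI subsetI)
  fix c assume "c \<in> carrier (bar_chains R2 G n)"
  then have c: "\<And>xs. c xs \<in> {0, 1}" "finite {xs. c xs \<noteq> 0}" "{xs. c xs \<noteq> 0} \<subseteq> {xs. length xs = n \<and> set xs \<subseteq> carrier G}"
    by (auto simp: bar_chains_def R2_simps)
  define w where "w = (\<lambda>xs. if c xs = 0 then 0 else 1 :: bit)"
  have "c = to_int_chain w"
  proof
    fix xs show "c xs = to_int_chain w xs" using c(1)[of xs] by (auto simp: to_int_chain_def w_def)
  qed
  moreover have "w \<in> chains2 G n"
    using c(2,3) by (auto simp: chains2_def fin_supp_def w_def)
  ultimately show "c \<in> to_int_chain ` chains2 G n" by blast
next
  fix c assume "c \<in> to_int_chain ` chains2 G n"
  then obtain w where w: "w \<in> chains2 G n" "c = to_int_chain w" by blast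
  have "{xs. c xs \<noteq> 0} = {xs. w xs \<noteq> 0}" unfolding w(2) to_int_chain_def int_of_bit_nonzero ..
  moreover have "range c \<subseteq> {0, 1}" using int_of_bit_range by (auto simp: w(2) to_int_chain_def)
  ultimately show "c \<in> carrier (bar_chains R2 G n)"
    using w(1) by (auto simp: bar_chains_def R2_simps chains2_def fin_supp_def)
qed

text \<open>Sorting the faces of the support by the value \<open>ys\<close> turns the coefficientwise formula for the
  differential into the sum of all faces.\<close>
lemma bar_boundary_to_int_chain:
  assumes w: "w \<in> chains2 G n" and n: "n > 0"
  shows "bar_boundary R2 G n (to_int_chain w) = to_int_chain (boundary2 G n w)"
proof
  fix ys
  have fin: "finite {xs. w xs \<noteq> 0}" using w by (simp add: chains2_def fin_supp_def)
  let ?S = "\<lambda>i. {xs. w xs \<noteq> 0 \<and> bar_face G n i xs = ys}"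
  have finS: "finite (?S i)" for i by (rule finite_subset[OF _ fin]) auto
  have "bar_boundary R2 G n (to_int_chain w) ys =
      (\<Oplus>\<^bsub>R2\<^esub>i\<in>{..n}. \<Oplus>\<^bsub>R2\<^esub>xs\<in>?S i. int_of_bit (w xs))"
  proof -
    have "(1 * int_of_bit a) mod 2 = int_of_bit a" for a by (simp add: int_of_bit_def)
    moreover have "n \<noteq> 0" using n by simp
    ultimately show ?thesis
      unfolding bar_boundary_def R2_minus_one_pow to_int_chain_def R2_simps(3,4) int_of_bit_nonzero
      by (simp only: if_False)
  qed
  also have "\<dots> = int_of_bit (\<Sum>i\<le>n. \<Sum>xs\<in>?S i. w xs)"
    by (simp only: finsum_int_of_bit finS finite_atMost)
  also have "(\<Sum>i\<le>n. \<Sum>xs\<in>?S i. w xs) = (\<Sum>i\<le>n. \<Sum>xs | w xs \<noteq> 0. single (bar_face G n i xs) ys)"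
  proof (rule sum.cong[OF refl])
    fix i
    have "(\<Sum>xs\<in>?S i. w xs) = (\<Sum>xs\<in>?S i. single (bar_face G n i xs) ys)"
      by (intro sum.cong) (auto simp: single_def)
    also have "\<dots> = (\<Sum>xs | w xs \<noteq> 0. single (bar_face G n i xs) ys)"
      using fin by (intro sum.mono_neutral_left) (auto simp: single_def)
    finally show "(\<Sum>xs\<in>?S i. w xs) = (\<Sum>xs | w xs \<noteq> 0. single (bar_face G n i xs) ys)" .
  qed
  also have "\<dots> = boundary2 G n w ys"
    unfolding boundary2_def sum_fun_apply by (rule sum.swap)
  finally show "bar_boundary R2 G n (to_int_chain w) ys = to_int_chain (boundary2 G n w) ys"
    by (simp add: to_int_chain_def)
qed

lemma bar_cycles_eq: fixes G :: "('b, 'm) monoid_scheme" shows "n > 0 \<Longrightarrow> bar_cycles R2 G n = to_int_chain ` cycles2 G n"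
proof -
  assume n: "n > 0"
  have zero: "to_int_chain w = (\<lambda>_. 0) \<longleftrightarrow> w = 0" for w :: "'b list \<Rightarrow> bit"
    by (auto simp: to_int_chain_def fun_eq_iff int_of_bit_def)
  have "bar_boundary R2 G n (to_int_chain w) = (\<lambda>_. 0) \<longleftrightarrow> boundary2 G n w = 0" if "w \<in> chains2 G n" for w
    unfolding bar_boundary_to_int_chain[OF that n] by (rule zero)
  then show ?thesis
    unfolding bar_cycles_def carrier_bar_chains cycles2_def R2_simps(4) by blast
qed

lemma bar_boundaries_eq: "bar_boundaries R2 G n = to_int_chain ` boundaries2 G n"
  unfolding bar_boundaries_def carrier_bar_chains boundaries2_def image_image
  by (intro image_cong refl bar_boundary_to_int_chain) auto

text \<open>The inclusion \<open>exact\<close> says that the composite of two differentials vanishes; it is established in the degrees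
  1 and 2, where it is a short computation with faces.\<close>
locale bar_homology2 = group G for G :: "('g, 'm) monoid_scheme" (structure) +
  fixes n :: nat
  assumes n: "n > 0" and exact: "boundaries2 G n \<subseteq> cycles2 G n"
begin

abbreviation "H \<equiv> group_homology R2 G n"

text \<open>The homology class of a cycle, as a coset in the carrier of the homology module.\<close>
definition hom_class :: "('g list \<Rightarrow> bit) \<Rightarrow> ('g list \<Rightarrow> int) set" where
  "hom_class w = to_int_chain ` ((\<lambda>u. u + w) ` boundaries2 G n)"

lemma boundaries2_add: "u \<in> boundaries2 G n \<Longrightarrow> v \<in> boundaries2 G n \<Longrightarrow> u + v \<in> boundaries2 G n"
  unfolding boundaries2_def
  by (auto simp: boundary2_add[symmetric] chains2_fin_supp intro!: imageI chains2_add)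

lemma boundaries2_zero: "0 \<in> boundaries2 G n"
proof -
  have "boundary2 G (Suc n) 0 = 0" by (simp add: boundary2_def)
  then show ?thesis unfolding boundaries2_def using chains2_zero[of G "Suc n"] by (rule image_eqI[OF sym])
qed

lemma cycles2_add: "u \<in> cycles2 G n \<Longrightarrow> v \<in> cycles2 G n \<Longrightarrow> u + v \<in> cycles2 G n"
  unfolding cycles2_def
  using boundary2_add[OF chains2_fin_supp[of u G n] chains2_fin_supp[of v G n], of G n] by (simp add: chains2_add)

lemma cycles2_zero: "0 \<in> cycles2 G n"
  using exact boundaries2_zero by blast

lemma hom_class_eq_iff: "hom_class v = hom_class w \<longleftrightarrow> v + w \<in> boundaries2 G n"
proof
  assume eq: "hom_class v = hom_class w"
  have "to_int_chain (0 + v) \<in> hom_class v" unfolding hom_class_def using boundaries2_zero by (intro imageI)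
  then have "to_int_chain (0 + v) \<in> to_int_chain ` ((\<lambda>u. u + w) ` boundaries2 G n)"
    unfolding eq unfolding hom_class_def .
  then obtain u where "u \<in> boundaries2 G n" "to_int_chain (0 + v) = to_int_chain (u + w)"
    by (elim imageE) simp
  then have "u \<in> boundaries2 G n" "v = u + w" by (simp_all add: to_int_chain_inj)
  then show "v + w \<in> boundaries2 G n" by (simp add: add.assoc)
next
  assume vw: "v + w \<in> boundaries2 G n"
  have "(\<lambda>u. u + v) ` boundaries2 G n \<subseteq> (\<lambda>u. u + w) ` boundaries2 G n"
    if "v + w \<in> boundaries2 G n" for v w
  proof (rule image_subsetI)
    fix u assume "u \<in> boundaries2 G n"
    then have "u + (v + w) \<in> boundaries2 G n" using that by (rule boundaries2_add)
    moreover have "u + v = (u + (v + w)) + w" by (simp add: add.assoc)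
    ultimately show "u + v \<in> (\<lambda>u. u + w) ` boundaries2 G n" by blast
  qed
  from this[OF vw] this[of w v] vw show "hom_class v = hom_class w"
    unfolding hom_class_def by (metis add.commute subset_antisym)
qed

lemma to_int_chain_add: "(\<lambda>xs. to_int_chain u xs \<oplus>\<^bsub>R2\<^esub> to_int_chain v xs) = to_int_chain (u + v)"
  by (simp add: to_int_chain_def R2_simps int_of_bit_add fun_eq_iff)

lemma H_carrier: "carrier H = hom_class ` cycles2 G n"
  unfolding group_homology_def quotient_module_def partial_object.simps A_RCOSETS_def' a_r_coset_def'
    bar_boundaries_eq bar_cycles_eq[OF n]
  by (simp add: bar_chains_def to_int_chain_add hom_class_def UNION_singleton_eq_range image_image)

lemma H_add: "hom_class u \<oplus>\<^bsub>H\<^esub> hom_class v = hom_class (u + v)"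
proof -
  have "hom_class u \<oplus>\<^bsub>H\<^esub> hom_class v = to_int_chain ` {(a + u) + (b + v) | a b. a \<in> boundaries2 G n \<and> b \<in> boundaries2 G n}"
    unfolding group_homology_def quotient_module_def ring.simps set_add_def'
    by (auto simp: bar_chains_def to_int_chain_add hom_class_def)
  also have "{(a + u) + (b + v) | a b. a \<in> boundaries2 G n \<and> b \<in> boundaries2 G n} = (\<lambda>a. a + (u + v)) ` boundaries2 G n"
  proof (intro equalityI subsetI)
    fix x assume "x \<in> {(a + u) + (b + v) | a b. a \<in> boundaries2 G n \<and> b \<in> boundaries2 G n}"
    then obtain a b where "x = (a + b) + (u + v)" "a + b \<in> boundaries2 G n"
      using boundaries2_add by (auto simp: add_ac)
    then show "x \<in> (\<lambda>a. a + (u + v)) ` boundaries2 G n" by blast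
  next
    fix x assume "x \<in> (\<lambda>a. a + (u + v)) ` boundaries2 G n"
    then obtain a where "a \<in> boundaries2 G n" "x = (a + u) + (0 + v)" by (auto simp: add_ac)
    then show "x \<in> {(a + u) + (b + v) | a b. a \<in> boundaries2 G n \<and> b \<in> boundaries2 G n}"
      using boundaries2_zero by blast
  qed
  finally show ?thesis by (simp add: hom_class_def)
qed

lemma H_zero: "\<zero>\<^bsub>H\<^esub> = hom_class 0"
  unfolding group_homology_def quotient_module_def bar_boundaries_eq by (simp add: hom_class_def)

lemma H_smult:
  "(0::int) \<odot>\<^bsub>H\<^esub> hom_class w = hom_class 0" "(1::int) \<odot>\<^bsub>H\<^esub> hom_class w = hom_class w"
proof -
  let ?M = "(bar_chains R2 G n)\<lparr>carrier := bar_cycles R2 G n\<rparr>"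
  have sm: "a \<odot>\<^bsub>H\<^esub> X = hom_class 0 <+>\<^bsub>?M\<^esub> ((\<lambda>x. a \<odot>\<^bsub>?M\<^esub> x) ` X)" for a X
    unfolding group_homology_def quotient_module_def bar_boundaries_eq by (simp add: hom_class_def)
  have ad: "hom_class u <+>\<^bsub>?M\<^esub> hom_class v = hom_class (u + v)" for u v
    using H_add[of u v] unfolding group_homology_def quotient_module_def by simp
  have 1: "(\<lambda>x. 1 \<odot>\<^bsub>?M\<^esub> x) ` hom_class w = hom_class w"
  proof -
    have "1 \<odot>\<^bsub>?M\<^esub> to_int_chain u = to_int_chain u" for u
      by (simp add: bar_chains_def R2_simps to_int_chain_def int_of_bit_def fun_eq_iff)
    then show ?thesis unfolding hom_class_def image_image by simp
  qed
  have 0: "hom_class 0 <+>\<^bsub>?M\<^esub> ((\<lambda>x. 0 \<odot>\<^bsub>?M\<^esub> x) ` hom_class w) = hom_class 0"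
  proof -
    have "0 \<odot>\<^bsub>?M\<^esub> to_int_chain u = to_int_chain 0" for u
      by (simp add: bar_chains_def R2_simps to_int_chain_def fun_eq_iff)
    then have "(\<lambda>x. 0 \<odot>\<^bsub>?M\<^esub> x) ` hom_class w = {to_int_chain 0}"
      unfolding hom_class_def image_image using boundaries2_zero by auto
    then show ?thesis unfolding set_add_def'
      by (auto simp: bar_chains_def to_int_chain_add hom_class_def image_image)
  qed
  show "(0::int) \<odot>\<^bsub>H\<^esub> hom_class w = hom_class 0" unfolding sm by (rule 0)
  show "(1::int) \<odot>\<^bsub>H\<^esub> hom_class w = hom_class w" unfolding sm 1 by (simp add: ad)
qed

lemma H_carrierE: assumes "X \<in> carrier H" obtains w where "w \<in> cycles2 G n" "X = hom_class w"
  using assms unfolding H_carrier by blast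

lemma H_carrierI: "w \<in> cycles2 G n \<Longrightarrow> hom_class w \<in> carrier H"
  unfolding H_carrier by blast

text \<open>All module operations are determined by their effect on classes of cycles, where they are addition of
  chains; the only scalars are 0 and 1.\<close>
lemma vectorspace_H: "vectorspace R2 H"
proof -
  have "module R2 H"
  proof (rule moduleI)
    show "cring R2" using field_R2 by (simp add: field.axioms domain.axioms)
    show "abelian_group H"
    proof (rule abelian_groupI)
      show "\<exists>Y\<in>carrier H. Y \<oplus>\<^bsub>H\<^esub> X = \<zero>\<^bsub>H\<^esub>" if "X \<in> carrier H" for X
        using that by (intro bexI[of _ X]) (auto elim!: H_carrierE simp: H_add H_zero)
    qed (auto elim!: H_carrierE simp: H_add H_zero add_ac intro!: H_carrierI cycles2_add cycles2_zero)
    fix a b X assume ab: "a \<in> carrier R2" "b \<in> carrier R2" and X: "X \<in> carrier H"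
    then show "(a \<oplus>\<^bsub>R2\<^esub> b) \<odot>\<^bsub>H\<^esub> X = a \<odot>\<^bsub>H\<^esub> X \<oplus>\<^bsub>H\<^esub> b \<odot>\<^bsub>H\<^esub> X"
      and "(a \<otimes>\<^bsub>R2\<^esub> b) \<odot>\<^bsub>H\<^esub> X = a \<odot>\<^bsub>H\<^esub> (b \<odot>\<^bsub>H\<^esub> X)"
      by (auto elim!: H_carrierE simp: R2_simps H_smult H_add)
  next
    fix a X Y assume "a \<in> carrier R2" "X \<in> carrier H" "Y \<in> carrier H"
    then show "a \<odot>\<^bsub>H\<^esub> (X \<oplus>\<^bsub>H\<^esub> Y) = a \<odot>\<^bsub>H\<^esub> X \<oplus>\<^bsub>H\<^esub> a \<odot>\<^bsub>H\<^esub> Y"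
      by (auto elim!: H_carrierE simp: R2_simps H_smult H_add)
  qed (auto elim!: H_carrierE simp: R2_simps H_smult intro!: H_carrierI cycles2_zero)
  then show ?thesis using field_R2 by (rule vectorspace.intro)
qed

end

lemma (in group) bar_homology2_1: "bar_homology2 G 1"
proof (rule bar_homology2.intro)
  have "boundary2 G 1 w = 0" if "w \<in> chains2 G 1" for w
    unfolding boundary2_def
  proof (rule sum.neutral, rule ballI)
    fix xs assume "xs \<in> {xs. w xs \<noteq> 0}"
    then have "length xs = 1" using chains2_supp[OF that] by simp
    then obtain x where "xs = [x]" by (auto simp: length_Suc_conv)
    then show "(\<Sum>i\<le>1. single (bar_face G 1 i xs)) = 0"
      by (simp add: bar_face_def)
  qed
  then have "chains2 G 1 \<subseteq> cycles2 G 1" by (auto simp: cycles2_def)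
  moreover have "boundaries2 G 1 \<subseteq> chains2 G 1" using boundary2_closed by (auto simp: boundaries2_def)
  ultimately show "bar_homology2_axioms G 1" by (intro bar_homology2_axioms.intro) auto
qed (rule is_group)

lemma (in group) coboundary2_pair: "coboundary2 G 2 f [x, y] = f [y] + f [x \<otimes> y] + f [x]"
  by (simp add: coboundary2_def bar_face_def numeral_2_eq_2)

lemma (in group) coboundary2_triple:
  "coboundary2 G 3 f [x, y, z] = f [y, z] + f [x \<otimes> y, z] + f [x, y \<otimes> z] + f [x, y]"
  by (simp add: coboundary2_def bar_face_def numeral_3_eq_3)

lemma length_3_conv: "length xs = 3 \<Longrightarrow> \<exists>x y z. xs = [x, y, z]"
  by (auto simp: numeral_3_eq_3 length_Suc_conv)

lemma length_2_conv: "length xs = 2 \<Longrightarrow> \<exists>x y. xs = [x, y]"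
  by (auto simp: numeral_2_eq_2 length_Suc_conv)

lemma (in group) bar_homology2_2: "bar_homology2 G 2"
proof (rule bar_homology2.intro)
  have "boundary2 G 2 (boundary2 G 3 w) = 0" if w: "w \<in> chains2 G 3" for w
  proof
    fix ys
    have "boundary2 G 2 (boundary2 G 3 w) ys = pairing (coboundary2 G 3 (coboundary2 G 2 (single ys))) w"
      by (simp add: boundary2_apply[of G 2] pairing_boundary2)
    also have "\<dots> = 0" unfolding pairing_def
    proof (intro sum.neutral ballI)
      fix xs assume "xs \<in> {xs. w xs \<noteq> 0}"
      then have "length xs = 3" "set xs \<subseteq> carrier G" using chains2_supp[OF w] by auto
      then obtain x y z where xs: "xs = [x, y, z]" "x \<in> carrier G" "y \<in> carrier G" "z \<in> carrier G"
        using length_3_conv[of xs] by auto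
      show "coboundary2 G 3 (coboundary2 G 2 (single ys)) xs = 0"
        unfolding xs(1) coboundary2_triple coboundary2_pair m_assoc[OF xs(2-4)] by (simp add: add_ac)
    qed
    finally show "boundary2 G 2 (boundary2 G 3 w) ys = 0 ys" by simp
  qed
  then show "bar_homology2_axioms G 2"
    using boundary2_closed[of _ 2]
    by (intro bar_homology2_axioms.intro) (auto simp: boundaries2_def cycles2_def)
qed (rule is_group)

context bar_homology2
begin

interpretation H: vectorspace R2 H
  by (rule vectorspace_H)

lemma span_H_closed:
  assumes "S \<subseteq> carrier H"
  shows "hom_class 0 \<in> H.span S" "u \<in> cycles2 G n \<Longrightarrow> v \<in> cycles2 G n \<Longrightarrow> hom_class u \<in> H.span S \<Longrightarrow> hom_class v \<in> H.span S \<Longrightarrow> hom_class (u + v) \<in> H.span S"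
proof -
  interpret S: LinearCombinations.submodule R2 "H.span S" H
    by (rule H.span_is_submodule[OF assms])
  show "hom_class 0 \<in> H.span S" using S.zero_closed by (simp add: H_zero)
  show "hom_class (u + v) \<in> H.span S" if "hom_class u \<in> H.span S" "hom_class v \<in> H.span S"
    using S.m_closed[OF that] by (simp add: H_add)
qed

lemma vs_edim_le:
  assumes fin: "finite I" and cyc: "\<And>i. i \<in> I \<Longrightarrow> z i \<in> cycles2 G n"
    and gen: "\<And>w. w \<in> cycles2 G n \<Longrightarrow> \<exists>J\<subseteq>I. w + (\<Sum>j\<in>J. z j) \<in> boundaries2 G n"
  shows "vs_edim R2 H \<le> enat (card I)"
proof -
  define S where "S = (\<lambda>i. hom_class (z i)) ` I"
  have S: "S \<subseteq> carrier H" "finite S" "card S \<le> card I"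
    using cyc fin by (auto simp: S_def H_carrierI card_image_le)
  have span_sum: "hom_class (\<Sum>j\<in>J. z j) \<in> H.span S \<and> (\<Sum>j\<in>J. z j) \<in> cycles2 G n" if "J \<subseteq> I" for J
    using finite_subset[OF that fin] that
  proof (induction J rule: finite_induct)
    case empty
    show ?case unfolding sum.empty using span_H_closed(1)[OF S(1)] cycles2_zero by (rule conjI)
  next
    case (insert j J)
    then have IH: "hom_class (\<Sum>j\<in>J. z j) \<in> H.span S" "(\<Sum>j\<in>J. z j) \<in> cycles2 G n" and j: "j \<in> I" by auto
    have "hom_class (z j) \<in> S" using j by (simp add: S_def)
    then have "hom_class (z j) \<in> H.span S" using H.in_own_span[OF S(1)] by blast
    then show ?case unfolding sum.insert[OF insert.hyps]
      using \<open>hom_class (z j) \<in> H.span S\<close>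
      by (intro conjI span_H_closed(2)[OF S(1) cyc[OF j] IH(2) _ IH(1)] cycles2_add[OF cyc[OF j] IH(2)])
  qed
  have "carrier H \<subseteq> H.span S"
  proof
    fix X assume "X \<in> carrier H"
    then obtain w where w: "w \<in> cycles2 G n" "X = hom_class w" by (elim H_carrierE)
    from gen[OF w(1)] obtain J where J: "J \<subseteq> I" "w + (\<Sum>j\<in>J. z j) \<in> boundaries2 G n" by (elim exE conjE)
    have "X = hom_class (\<Sum>j\<in>J. z j)" unfolding w(2) hom_class_eq_iff by (rule J(2))
    then show "X \<in> H.span S" using span_sum[OF J(1)] by simp
  qed
  then have gen_set: "H.span S = carrier H" using H.span_is_subset2[OF S(1)] by blast
  then have "H.fin_dim" unfolding H.fin_dim_def using S by blast
  moreover have "H.dim \<le> card S" by (rule H.gen_ge_dim[OF S(2,1) gen_set])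
  ultimately show ?thesis using S(3) by (simp add: vs_edim_def)
qed

text \<open>Cycles representing a basis of the homology: a cochain that kills boundaries induces a functional on
  homology, and the classes on which it vanishes form a submodule.\<close>
lemma spanning_cycles_exist:
  assumes "vs_edim R2 H = enat c"
  obtains z where "\<And>j. j < c \<Longrightarrow> z j \<in> cycles2 G n"
    "\<And>f w. (\<And>j. j < c \<Longrightarrow> pairing f (z j) = 0) \<Longrightarrow> (\<And>u. u \<in> boundaries2 G n \<Longrightarrow> pairing f u = 0) \<Longrightarrow>
       w \<in> cycles2 G n \<Longrightarrow> pairing f w = 0"
proof -
  have fd: "H.fin_dim" and dim: "H.dim = c" using assms by (auto simp: vs_edim_def split: if_splits)
  obtain \<beta> where \<beta>: "finite \<beta>" "H.basis \<beta>" using H.finite_basis_exists[OF fd] by blast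
  have c: "card \<beta> = c" using H.dim_basis[OF \<beta>] dim by simp
  have \<beta>': "\<beta> \<subseteq> carrier H" "H.span \<beta> = carrier H" using \<beta>(2) by (auto simp: H.basis_def)
  obtain e where e: "bij_betw e {..<c} \<beta>" using ex_bij_betw_nat_finite[OF \<beta>(1)] by (auto simp: c atLeast0LessThan)
  have "\<exists>w. w \<in> cycles2 G n \<and> e j = hom_class w" if "j < c" for j
  proof -
    have "e j \<in> carrier H" using bij_betwE[OF e] \<beta>'(1) that by auto
    then show ?thesis by (elim H_carrierE) blast
  qed
  then have "\<forall>j. \<exists>w. j < c \<longrightarrow> w \<in> cycles2 G n \<and> e j = hom_class w" by blast
  then obtain z where z: "\<forall>j. j < c \<longrightarrow> z j \<in> cycles2 G n \<and> e j = hom_class (z j)" by (rule choice[THEN exE])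
  show thesis
  proof (rule that)
    show "z j \<in> cycles2 G n" if "j < c" for j using z that by blast
    fix f w
    assume fz: "\<And>j. j < c \<Longrightarrow> pairing f (z j) = 0" and fb: "\<And>u. u \<in> boundaries2 G n \<Longrightarrow> pairing f u = 0"
      and w: "w \<in> cycles2 G n"
    have cyc_fin: "u \<in> fin_supp" if "u \<in> cycles2 G n" for u using that by (simp add: cycles2_def chains2_def)
    \<comment> \<open>The classes of cycles killed by \<open>f\<close>; this contains the basis, hence everything.\<close>
    define N where "N = {hom_class u | u. u \<in> cycles2 G n \<and> pairing f u = 0}"
    have p0: "pairing f 0 = 0" by (simp add: pairing_def)
    have "LinearCombinations.submodule R2 N H"
    proof (rule LinearCombinations.submodule.intro)
      show "module R2 H" by (rule H.module_axioms)
      show "N \<subseteq> carrier H" by (auto simp: N_def H_carrierI)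
      show "\<zero>\<^bsub>H\<^esub> \<in> N" using cycles2_zero p0 by (auto simp: N_def H_zero)
      show "X \<oplus>\<^bsub>H\<^esub> Y \<in> N" if XY: "X \<in> N" "Y \<in> N" for X Y
      proof -
        obtain u v where "X = hom_class u" "Y = hom_class v" "u \<in> cycles2 G n" "v \<in> cycles2 G n" "pairing f u = 0" "pairing f v = 0"
          using XY by (auto simp: N_def)
        moreover from this have "pairing f (u + v) = 0" by (simp add: pairing_add_right cyc_fin)
        ultimately show ?thesis unfolding N_def using H_add cycles2_add by blast
      qed
      show "a \<odot>\<^bsub>H\<^esub> X \<in> N" if a: "a \<in> carrier R2" and X: "X \<in> N" for a X
      proof -
        obtain u where u: "X = hom_class u" using X by (auto simp: N_def)
        have "hom_class 0 \<in> N" using cycles2_zero p0 by (auto simp: N_def)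
        then show ?thesis using a X unfolding u by (auto simp: R2_simps(1) H_smult)
      qed
    qed
    moreover have "\<beta> \<subseteq> N"
    proof
      fix X assume "X \<in> \<beta>"
      then have "X \<in> e ` {..<c}" using bij_betw_imp_surj_on[OF e] by simp
      then show "X \<in> N" using z fz by (auto simp: N_def)
    qed
    ultimately have "H.span \<beta> \<subseteq> N" by (intro H.span_is_subset)
    then have "hom_class w \<in> N" using H_carrierI[OF w] \<beta>'(2) by blast
    then obtain u where u: "hom_class w = hom_class u" "u \<in> cycles2 G n" "pairing f u = 0" by (auto simp: N_def)
    have "pairing f (w + u) = 0" using u(1) fb by (simp add: hom_class_eq_iff)
    then show "pairing f w = 0" using u(3) by (simp add: pairing_add_right[OF cyc_fin[OF w] cyc_fin[OF u(2)]])
  qed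
qed

end

lemma (in group) boundary2_pair:
  "boundary2 G 2 (single [x, y]) = single [y] + single [x \<otimes> y] + single [x]"
proof -
  have "{xs. single [x, y] xs \<noteq> 0} = {[x, y]}" by (auto simp: single_def)
  then show ?thesis unfolding boundary2_def by (simp add: bar_face_def numeral_2_eq_2)
qed

text \<open>The first homology is spanned by the classes of the dual elements \<open>[g j]\<close>. Correcting a chain by these makes it
  vanish under every homomorphism to \<open>F\<^sub>2\<close>; such a chain is a boundary, since a functional separating it
  from the boundaries would itself restrict to a homomorphism on the group.\<close>
lemma (in hom2_basis) betti_1_le: "betti 1 G 2 \<le> enat b"
proof -
  interpret bar_homology2 G 1 by (rule bar_homology2_1)
  have S2: "Suc 1 = 2" by simp
  define p where "p = (\<lambda>i w. pairing (\<lambda>xs. \<phi> i (hd xs)) w)"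
  have sz: "single [g j] \<in> cycles2 G 1" if "j < b" for j
  proof -
    have "{xs. single [g j] xs \<noteq> 0} = {[g j]}" by (auto simp: single_def)
    then have "boundary2 G 1 (single [g j]) = 0"
      unfolding boundary2_def by (simp add: bar_face_def)
    moreover have "single [g j] \<in> chains2 G 1" using g[OF that] by (intro single_chains2) auto
    ultimately show ?thesis by (simp add: cycles2_def)
  qed
  have "vs_edim R2 H \<le> enat (card {..<b})"
  proof (rule vs_edim_le)
    fix w assume w: "w \<in> cycles2 G 1"
    then have wc: "w \<in> chains2 G 1" by (simp add: cycles2_def)
    define J where "J = {j. j < b \<and> p j w \<noteq> 0}"
    have J: "J \<subseteq> {..<b}" "finite J" by (auto simp: J_def)
    define w' where "w' = w + (\<Sum>j\<in>J. single [g j])"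
    have w'_fin: "w' \<in> fin_supp"
      unfolding w'_def by (intro fin_supp_add fin_supp_sum chains2_fin_supp[OF wc] single_fin_supp)
    have supp: "\<exists>x\<in>carrier G. xs = [x]" if "w' xs \<noteq> 0" for xs
    proof -
      have "w xs \<noteq> 0 \<or> (\<exists>j\<in>J. single [g j] xs \<noteq> 0)"
      proof (rule ccontr)
        assume "\<not> ?thesis"
        then have "w' xs = 0" unfolding w'_def plus_fun_apply sum_fun_apply by simp
        then show False using that by simp
      qed
      then show ?thesis
      proof
        assume "w xs \<noteq> 0"
        then have "length xs = 1" "set xs \<subseteq> carrier G" using chains2_supp[OF wc] by blast+
        then show ?thesis by (cases xs) auto
      next
        assume "\<exists>j\<in>J. single [g j] xs \<noteq> 0"
        then show ?thesis using g J by (auto simp: single_def split: if_splits)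
      qed
    qed
    have p0: "p i w' = 0" if i: "i < b" for i
    proof -
      have "p i w' = p i w + (\<Sum>j\<in>J. \<phi> i (g j))"
        unfolding w'_def p_def
        by (subst pairing_add_right) (auto intro!: fin_supp_sum chains2_fin_supp[OF wc] simp: pairing_sum)
      also have "(\<Sum>j\<in>J. \<phi> i (g j)) = (\<Sum>j\<in>J. if i = j then 1 else 0)"
        using dual[OF i] by (intro sum.cong) (auto simp: J_def)
      also have "\<dots> = p i w" using J(2) i by (simp add: J_def)
      finally show ?thesis by simp
    qed
    have "w' \<in> boundaries2 G 1"
    proof (rule ccontr)
      assume "w' \<notin> boundaries2 G 1"
      from additive_separation[OF bit_fun_add_self boundaries2_zero boundaries2_add this]
      obtain L :: "('g list \<Rightarrow> bit) \<Rightarrow> bit"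
        where L: "\<And>u v. L (u + v) = L u + L v" "\<And>s. s \<in> boundaries2 G 1 \<Longrightarrow> L s = 0" "L w' = 1"
        by blast
      define h where "h = (\<lambda>x. if x \<in> carrier G then L (single [x]) else 0)"
      have "h (x \<otimes> y) = h x + h y" if xy: "x \<in> carrier G" "y \<in> carrier G" for x y
      proof -
        have "single [x, y] \<in> chains2 G (Suc 1)" using xy by (intro single_chains2) auto
        then have "boundary2 G (Suc 1) (single [x, y]) \<in> boundaries2 G 1" unfolding boundaries2_def by (rule imageI)
        then have "single [y] + single [x \<otimes> y] + single [x] \<in> boundaries2 G 1"
          unfolding S2 boundary2_pair .
        then have "L (single [y]) + L (single [x \<otimes> y]) + L (single [x]) = 0" unfolding L(1)[symmetric] by (rule L(2))
        then have "L (single [x \<otimes> y]) = L (single [x]) + L (single [y])"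
          by (simp add: bit_add_eq_0_iff add_ac)
        then show ?thesis using xy by (simp add: h_def)
      qed
      then have h: "h \<in> hom2 G" unfolding hom2_def by (simp add: h_def)
      have "L w' = pairing (\<lambda>xs. L (single xs)) w'" by (rule additive_eq_pairing[OF L(1) w'_fin])
      also have "\<dots> = pairing (\<lambda>xs. \<Sum>i<b. h (g i) * \<phi> i (hd xs)) w'"
        unfolding pairing_def
      proof (intro sum.cong[OF refl])
        fix xs assume "xs \<in> {xs. w' xs \<noteq> 0}"
        then obtain x where x: "x \<in> carrier G" "xs = [x]" using supp by blast
        then have "L (single xs) = h x" by (simp add: h_def)
        also have "\<dots> = (\<Sum>i<b. h (g i) * \<phi> i (hd xs))" using expand[OF h, of x] x(2) by simp
        finally show "L (single xs) = (\<Sum>i<b. h (g i) * \<phi> i (hd xs))" .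
      qed
      also have "\<dots> = (\<Sum>i<b. h (g i) * p i w')"
        unfolding p_def pairing_def sum_distrib_left by (rule sum.swap)
      also have "\<dots> = 0" using p0 by (intro sum.neutral) auto
      finally show False using L(3) by simp
    qed
    then show "\<exists>J\<subseteq>{..<b}. w + (\<Sum>j\<in>J. single [g j]) \<in> boundaries2 G 1"
      using J(1) unfolding w'_def by blast
  qed (use sz in auto)
  then show ?thesis by (simp add: betti_def)
qed

text \<open>Let \<open>f\<close> vanish on the chosen cycles, hence on all cycles. Then the graph of \<open>f\<close> over the boundary map, the
  set of all \<open>(d w, f w)\<close>, misses \<open>(0, 1)\<close>. A functional separating this point from the graph takes the
  value \<open>f w\<close> at \<open>(d w, 0)\<close>, and its values at \<open>([x], 0)\<close> are the required cochain.\<close>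
lemma (in group) h2_detected_by_betti_2:
  assumes "betti 2 G 2 = enat c"
  obtains Z where "h2_detected_by G c Z"
proof -
  interpret bar_homology2 G 2 by (rule bar_homology2_2)
  have S3: "Suc 2 = 3" by simp
  obtain z where z: "\<And>j. j < c \<Longrightarrow> z j \<in> cycles2 G 2"
    and detect: "\<And>f w. (\<And>j. j < c \<Longrightarrow> pairing f (z j) = 0) \<Longrightarrow> (\<And>u. u \<in> boundaries2 G 2 \<Longrightarrow> pairing f u = 0) \<Longrightarrow>
       w \<in> cycles2 G 2 \<Longrightarrow> pairing f w = 0"
    using spanning_cycles_exist[of c] assms by (auto simp: betti_def)
  define Z where "Z = (\<lambda>j. {(x, y). z j [x, y] \<noteq> 0})"
  have "h2_detected_by G c Z" unfolding h2_detected_by_def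
  proof (intro ballI impI)
    fix f assume f: "f \<in> cocycles2 G" and fZ: "\<forall>j<c. (\<Sum>(x, y)\<in>Z j. f x y) = 0"
    define F where "F = (\<lambda>xs. f (xs ! 0) (xs ! 1))"
    have "pairing F (z j) = 0" if j: "j < c" for j
    proof -
      have zj: "z j \<in> chains2 G 2" using z[OF j] by (simp add: cycles2_def)
      have "pairing F (z j) = (\<Sum>(x, y)\<in>Z j. f x y)"
        unfolding pairing_def
      proof (rule sum.reindex_bij_witness[of _ "\<lambda>(x, y). [x, y]" "\<lambda>xs. (xs ! 0, xs ! 1)"])
        fix xs assume "xs \<in> {xs. z j xs \<noteq> 0}"
        then have "z j xs \<noteq> 0" "\<exists>x y. xs = [x, y]" using chains2_supp[OF zj, of xs] length_2_conv[of xs] by auto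
        then show "(case (xs ! 0, xs ! 1) of (x, y) \<Rightarrow> [x, y]) = xs" "(xs ! 0, xs ! 1) \<in> Z j"
            "(case (xs ! 0, xs ! 1) of (x, y) \<Rightarrow> f x y) = F xs"
          by (auto simp: Z_def F_def)
      qed (auto simp: Z_def)
      then show ?thesis using fZ j by simp
    qed
    moreover have "pairing F u = 0" if u: "u \<in> boundaries2 G 2" for u
    proof -
      obtain w where w: "u = boundary2 G 3 w" "w \<in> chains2 G 3" using u by (auto simp: boundaries2_def)
      have "pairing F u = pairing (coboundary2 G 3 F) w" by (simp add: w(1) pairing_boundary2)
      also have "\<dots> = 0" unfolding pairing_def
      proof (intro sum.neutral ballI)
        fix xs assume "xs \<in> {xs. w xs \<noteq> 0}"
        then have "length xs = 3" "set xs \<subseteq> carrier G" using chains2_supp[OF w(2)] by auto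
        then obtain x y t where xs: "xs = [x, y, t]" "x \<in> carrier G" "y \<in> carrier G" "t \<in> carrier G"
          using length_3_conv[of xs] by auto
        show "coboundary2 G 3 F xs = 0"
          using f xs(2-4) unfolding xs(1) coboundary2_triple by (simp add: F_def cocycles2_def)
      qed
      finally show ?thesis .
    qed
    ultimately have F0: "pairing F w = 0" if "w \<in> cycles2 G 2" for w
      using detect[of F w] that by blast
    define S where "S = (\<lambda>w. (boundary2 G 2 w, pairing F w)) ` chains2 G 2"
    have notin: "(0, 1) \<notin> S" using F0 by (auto simp: S_def cycles2_def)
    have S0: "0 \<in> S"
    proof -
      have "(boundary2 G 2 0, pairing F 0) = 0" by (simp add: boundary2_def pairing_def zero_prod_def)
      then show ?thesis unfolding S_def using chains2_zero by (rule image_eqI[OF sym])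
    qed
    have Sadd: "s + t \<in> S" if "s \<in> S" "t \<in> S" for s t
    proof -
      obtain u v where uv: "s = (boundary2 G 2 u, pairing F u)" "t = (boundary2 G 2 v, pairing F v)"
          "u \<in> chains2 G 2" "v \<in> chains2 G 2" using \<open>s \<in> S\<close> \<open>t \<in> S\<close> unfolding S_def by (elim imageE)
      have "s + t = (boundary2 G 2 (u + v), pairing F (u + v))"
        unfolding uv(1,2) boundary2_add[OF chains2_fin_supp[OF uv(3)] chains2_fin_supp[OF uv(4)]]
          pairing_add_right[OF chains2_fin_supp[OF uv(3)] chains2_fin_supp[OF uv(4)]] by simp
      then show ?thesis unfolding S_def using chains2_add[OF uv(3,4)] by (rule image_eqI)
    qed
    have char2: "s + s = 0" for s :: "('a list \<Rightarrow> bit) \<times> bit" by (cases s) (simp add: zero_prod_def)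
    from additive_separation[OF char2 S0 Sadd notin]
    obtain L :: "('a list \<Rightarrow> bit) \<times> bit \<Rightarrow> bit"
      where L: "\<And>s t. L (s + t) = L s + L t" "\<And>s. s \<in> S \<Longrightarrow> L s = 0" "L (0, 1) = 1"
      by blast
    define u where "u = (\<lambda>x. L (single [x], 0))"
    have "f x y = u x + u y + u (x \<otimes> y)" if xy: "x \<in> carrier G" "y \<in> carrier G" for x y
    proof -
      have "single [x, y] \<in> chains2 G 2" using xy by (intro single_chains2) auto
      then have "(boundary2 G 2 (single [x, y]), pairing F (single [x, y])) \<in> S" unfolding S_def by (rule imageI)
      then have "(single [y] + single [x \<otimes> y] + single [x], f x y) \<in> S"
        unfolding boundary2_pair pairing_single by (simp add: F_def)
      then have "L ((single [y], 0) + (single [x \<otimes> y], 0) + (single [x], 0) + (0, f x y)) = 0"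
        using L(2) by simp
      then have "u y + u (x \<otimes> y) + u x + L (0, f x y) = 0" unfolding L(1) u_def .
      moreover have "L (0, f x y) = f x y"
      proof (cases "f x y = 0")
        case True
        have "L 0 = 0" using L(2)[OF S0] .
        then show ?thesis using True by (simp add: zero_prod_def)
      next
        case False
        then show ?thesis using L(3) by simp
      qed
      ultimately show ?thesis by (simp add: bit_add_eq_0_iff add_ac)
    qed
    then show "\<exists>u. \<forall>x\<in>carrier G. \<forall>y\<in>carrier G. f x y = u x + u y + u (x \<otimes> y)" by blast
  qed
  then show thesis by (rule that)
qed

section \<open>Finite index subgroups\<close>

context group
begin

text \<open>A coset of \<open>K\<close> with representative \<open>g\<close> is recorded by the coset of \<open>H\<close> containing \<open>g\<close> and by the value of \<open>\<kappa>\<close>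
  at the \<open>H\<close>-part of \<open>g\<close> relative to a fixed representative of that coset.\<close>
lemma card_rcosets_le:
  assumes H: "subgroup H G" "finite (rcosets H)" and K: "subgroup K G"
    and B: "finite B" "\<kappa> ` H \<subseteq> B"
    and sep: "\<And>x y. x \<in> H \<Longrightarrow> y \<in> H \<Longrightarrow> \<kappa> x = \<kappa> y \<Longrightarrow> x \<otimes> inv y \<in> K"
  shows "finite (rcosets K)" "card (rcosets K) \<le> card (rcosets H) * card B"
proof -
  have rep: "\<exists>g. \<forall>X. X \<in> rcosets L \<longrightarrow> g X \<in> carrier G \<and> X = L #> g X" for L
    by (rule choice) (auto simp: RCOSETS_def)
  obtain g where "\<forall>X. X \<in> rcosets K \<longrightarrow> g X \<in> carrier G \<and> X = K #> g X"
    using rep[of K] by (elim exE)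
  then have g: "\<And>X. X \<in> rcosets K \<Longrightarrow> g X \<in> carrier G" "\<And>X. X \<in> rcosets K \<Longrightarrow> X = K #> g X"
    by blast+
  obtain r where "\<forall>Y. Y \<in> rcosets H \<longrightarrow> r Y \<in> carrier G \<and> Y = H #> r Y"
    using rep[of H] by (elim exE)
  then have r: "\<And>Y. Y \<in> rcosets H \<Longrightarrow> r Y \<in> carrier G" "\<And>Y. Y \<in> rcosets H \<Longrightarrow> Y = H #> r Y"
    by blast+
  have HG: "H \<subseteq> carrier G" using H(1) by (rule subgroup.subset)
  have Hg: "H #> g X \<in> rcosets H" if "X \<in> rcosets K" for X
    using g(1)[OF that] HG by (auto simp: RCOSETS_def)
  define h where "h = (\<lambda>X. g X \<otimes> inv (r (H #> g X)))"
  have h: "h X \<in> H" if X: "X \<in> rcosets K" for X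
  proof -
    have "g X \<in> H #> r (H #> g X)"
      using rcos_self[OF g(1)[OF X] H(1)] unfolding r(2)[OF Hg[OF X], symmetric] .
    moreover define r' where "r' = r (H #> g X)"
    ultimately obtain y where y: "y \<in> H" "g X = y \<otimes> r'" unfolding r_coset_def by blast
    have "r' \<in> carrier G" "y \<in> carrier G" using r(1)[OF Hg[OF X]] y(1) HG by (auto simp: r'_def)
    then have "g X \<otimes> inv r' = y" unfolding y(2) by (simp add: m_assoc)
    then show ?thesis using y(1) by (simp add: h_def r'_def)
  qed
  define F where "F = (\<lambda>X. (H #> g X, \<kappa> (h X)))"
  have "inj_on F (rcosets K)"
  proof (rule inj_onI)
    fix X Y assume X: "X \<in> rcosets K" and Y: "Y \<in> rcosets K" and eq: "F X = F Y"
    have "h X \<otimes> inv (h Y) \<in> K" using eq by (intro sep h X Y) (simp add: F_def)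
    moreover have "h X \<otimes> inv (h Y) = g X \<otimes> inv (g Y)"
    proof -
      have "H #> g X = H #> g Y" using eq by (simp add: F_def)
      then show ?thesis using g(1)[OF X] g(1)[OF Y] r(1)[OF Hg[OF X]] r(1)[OF Hg[OF Y]]
        by (simp add: h_def inv_mult_group m_assoc) (simp flip: m_assoc)
    qed
    ultimately have "g X \<otimes> inv (g Y) \<in> K" by simp
    then have "K #> (g X \<otimes> inv (g Y)) = K" using K by (intro coset_join2) (auto dest: subgroup.mem_carrier)
    then have "K #> g X = K #> g Y"
      using coset_mult_inv1[of K "g X" "g Y"] g(1)[OF X] g(1)[OF Y] subgroup.subset[OF K] by simp
    then show "X = Y" unfolding g(2)[OF X, symmetric] g(2)[OF Y, symmetric] .
  qed
  moreover have "F ` (rcosets K) \<subseteq> (rcosets H) \<times> B" using Hg h B(2) by (auto simp: F_def)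
  moreover have "finite ((rcosets H) \<times> B)" using H(2) B(1) by simp
  ultimately show "finite (rcosets K)" "card (rcosets K) \<le> card (rcosets H) * card B"
    by (auto simp: inj_on_finite card_inj_on_le simp flip: card_cartesian_product)
qed

lemma subgroup_rcos_eq_iff:
  assumes "subgroup H G" "x \<in> carrier G" "y \<in> carrier G"
  shows "H #> x = H #> y \<longleftrightarrow> x \<otimes> inv y \<in> H"
proof
  assume "H #> x = H #> y"
  then have "x \<in> H #> y" using rcos_self[OF assms(2,1)] by simp
  then obtain h where h: "h \<in> H" "x = h \<otimes> y" by (auto simp: r_coset_def)
  moreover have "h \<in> carrier G" using h(1) subgroup.mem_carrier[OF assms(1)] by blast
  ultimately show "x \<otimes> inv y \<in> H" using assms(3) by (simp add: m_assoc)
next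
  assume "x \<otimes> inv y \<in> H"
  then have "H #> (x \<otimes> inv y) = H" using assms by (intro coset_join2) auto
  then show "H #> x = H #> y"
    using coset_mult_inv1[of H x y] assms subgroup.subset[OF assms(1)] by simp
qed

text \<open>Number the cosets of each subgroup. The resulting coset table, which lists how the generators and their
  inverses permute the numbers, together with the number of the subgroup itself, recovers the subgroup: words in the
  generators are traced from the base coset. There are finitely many tables.\<close>
lemma finite_subgroups_of_bounded_index:
  assumes S: "finite S" "S \<subseteq> carrier G" "generate G S = carrier G"
  shows "finite {H. subgroup H G \<and> finite (rcosets H) \<and> card (rcosets H) \<le> n}"
proof -
  define \<H> where "\<H> = {H. subgroup H G \<and> finite (rcosets H) \<and> card (rcosets H) \<le> n}"
  define S' where "S' = S \<union> m_inv G ` S"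
  have S': "finite S'" "S' \<subseteq> carrier G" using S(1,2) by (auto simp: S'_def)
  have "\<exists>e. inj_on e (rcosets H) \<and> e ` (rcosets H) \<subseteq> {..<n}" if "H \<in> \<H>" for H
  proof -
    have "card (rcosets H) \<le> card {..<n}" "finite (rcosets H)" using that by (auto simp: \<H>_def)
    then show ?thesis using card_le_inj[of "rcosets H" "{..<n}"] by blast
  qed
  then have "\<forall>H. \<exists>e. H \<in> \<H> \<longrightarrow> inj_on e (rcosets H) \<and> e ` (rcosets H) \<subseteq> {..<n}" by blast
  then obtain e where e: "\<forall>H. H \<in> \<H> \<longrightarrow> inj_on (e H) (rcosets H) \<and> e H ` (rcosets H) \<subseteq> {..<n}"
    by (rule choice[THEN exE])
  define f where "f = (\<lambda>H x. e H (H #> x))"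
  have rc: "H #> x \<in> rcosets H" if "x \<in> carrier G" for H x using that by (auto simp: RCOSETS_def)
  have f_eq: "f H x = f H y \<longleftrightarrow> H #> x = H #> y" if "H \<in> \<H>" "x \<in> carrier G" "y \<in> carrier G" for H x y
  proof -
    have "inj_on (e H) (rcosets H)" using e that(1) by blast
    then show ?thesis unfolding f_def using rc[OF that(2), of H] rc[OF that(3), of H] by (rule inj_on_eq_iff)
  qed
  have f_range: "f H x < n" if "H \<in> \<H>" "x \<in> carrier G" for H x
    using e that(1) rc[OF that(2), of H] by (auto simp: f_def)
  \<comment> \<open>The number of the coset \<open>H\<close> and the coset table.\<close>
  define \<tau> where "\<tau> = (\<lambda>H. (f H \<one>, {(f H x, s, f H (x \<otimes> s)) | x s. x \<in> carrier G \<and> s \<in> S'}))"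
  have "inj_on \<tau> \<H>"
  proof (rule inj_onI)
    fix H H' assume H: "H \<in> \<H>" and H': "H' \<in> \<H>" and eq: "\<tau> H = \<tau> H'"
    have sub: "subgroup H G" "subgroup H' G" using H H' by (auto simp: \<H>_def)
    have one: "f H \<one> = f H' \<one>" using eq by (simp add: \<tau>_def)
    have table: "{(f H x, s, f H (x \<otimes> s)) | x s. x \<in> carrier G \<and> s \<in> S'} =
        {(f H' x, s, f H' (x \<otimes> s)) | x s. x \<in> carrier G \<and> s \<in> S'}" using eq by (simp add: \<tau>_def)
    have step: "f H (x \<otimes> s) = f H' (x \<otimes> s)"
      if x: "x \<in> carrier G" "f H x = f H' x" and s: "s \<in> S'" for x s
    proof -
      have "(f H x, s, f H (x \<otimes> s)) \<in> {(f H' x, s, f H' (x \<otimes> s)) | x s. x \<in> carrier G \<and> s \<in> S'}"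
        unfolding table[symmetric] using x(1) s by blast
      then obtain y where y: "y \<in> carrier G" "f H x = f H' y" "f H (x \<otimes> s) = f H' (y \<otimes> s)" by blast
      have sG: "s \<in> carrier G" using s S'(2) by blast
      have "H' #> x = H' #> y" using y(2) x(2) f_eq[OF H' x(1) y(1)] by simp
      then have "H' #> (x \<otimes> s) = H' #> (y \<otimes> s)"
        using subgroup.subset[OF sub(2)] x(1) y(1) sG by (simp flip: coset_mult_assoc)
      then show ?thesis using y(3) f_eq[OF H', of "x \<otimes> s" "y \<otimes> s"] x(1) y(1) sG by simp
    qed
    have gen: "f H (x \<otimes> g) = f H' (x \<otimes> g)"
      if "g \<in> generate G S" "x \<in> carrier G" "f H x = f H' x" for x g
      using that
    proof (induction g arbitrary: x rule: generate.induct)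
      case one
      then show ?case by simp
    next
      case (incl s)
      then show ?case by (intro step) (auto simp: S'_def)
    next
      case (inv s)
      then show ?case by (intro step) (auto simp: S'_def)
    next
      case (eng g1 g2)
      have G12: "g1 \<in> carrier G" "g2 \<in> carrier G" using eng.hyps S(3) by auto
      have "f H ((x \<otimes> g1) \<otimes> g2) = f H' ((x \<otimes> g1) \<otimes> g2)"
        using eng G12 by (intro eng.IH(2)) auto
      then show ?case using G12 eng.prems(1) by (simp add: m_assoc)
    qed
    have mem: "g \<in> L \<longleftrightarrow> f L g = f L \<one>" if L: "L \<in> \<H>" and g: "g \<in> carrier G" for L g
    proof -
      have "subgroup L G" using L by (simp add: \<H>_def)
      then have "L #> g = L #> \<one> \<longleftrightarrow> g \<in> L" using subgroup_rcos_eq_iff[of L g \<one>] g by simp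
      then show ?thesis using f_eq[OF L g one_closed] by simp
    qed
    have "g \<in> H \<longleftrightarrow> g \<in> H'" if g: "g \<in> carrier G" for g
      using mem[OF H g] mem[OF H' g] gen[of g \<one>] one g S(3) by simp
    then show "H = H'" using subgroup.mem_carrier[OF sub(1)] subgroup.mem_carrier[OF sub(2)] by blast
  qed
  moreover have "\<tau> ` \<H> \<subseteq> {..<n} \<times> Pow ({..<n} \<times> S' \<times> {..<n})"
    using f_range S'(2) by (auto simp: \<tau>_def)
  moreover have "finite ({..<n} \<times> Pow ({..<n} \<times> S' \<times> {..<n}))" using S'(1) by simp
  ultimately have "finite \<H>" using inj_on_finite by blast
  then show ?thesis by (simp add: \<H>_def)
qed

definition ker2 :: "'a set \<Rightarrow> ('a \<Rightarrow> bit) \<Rightarrow> 'a set" where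
  "ker2 H f = {x \<in> H. f x = 0}"

lemma hom2_on_mult: "f \<in> hom2 (G\<lparr>carrier := H\<rparr>) \<Longrightarrow> x \<in> H \<Longrightarrow> y \<in> H \<Longrightarrow> f (x \<otimes> y) = f x + f y"
  by (simp add: hom2_def)

lemma hom2_on_outside: "f \<in> hom2 (G\<lparr>carrier := H\<rparr>) \<Longrightarrow> x \<notin> H \<Longrightarrow> f x = 0"
  by (simp add: hom2_def)

lemma hom2_on_one: "f \<in> hom2 (G\<lparr>carrier := H\<rparr>) \<Longrightarrow> subgroup H G \<Longrightarrow> f \<one> = 0"
  using hom2_on_mult[of f H \<one> \<one>] subgroup.one_closed[of H G] by simp

lemma hom2_on_inv: "f \<in> hom2 (G\<lparr>carrier := H\<rparr>) \<Longrightarrow> subgroup H G \<Longrightarrow> x \<in> H \<Longrightarrow> f (inv x) = f x"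
  using hom2_on_mult[of f H x "inv x"] hom2_on_one[of f H] subgroup.m_inv_closed[of H G x] subgroup.mem_carrier[of H G x]
  by (simp add: bit_add_eq_0_iff)

lemma normal_inI:
  assumes "subgroup H G" "subgroup K G" "K \<subseteq> H"
    and "\<And>h k. h \<in> H \<Longrightarrow> k \<in> K \<Longrightarrow> h \<otimes> k \<otimes> inv h \<in> K"
  shows "K \<lhd> G\<lparr>carrier := H\<rparr>"
proof -
  interpret H: group "G\<lparr>carrier := H\<rparr>" by (rule subgroup.subgroup_is_group[OF assms(1) is_group])
  show ?thesis
  proof (rule H.normal_invI)
    show "subgroup K (G\<lparr>carrier := H\<rparr>)" by (rule subgroup_incl[OF assms(2,1,3)])
    fix x h assume "x \<in> carrier (G\<lparr>carrier := H\<rparr>)" "h \<in> K"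
    then show "x \<otimes>\<^bsub>G\<lparr>carrier := H\<rparr>\<^esub> h \<otimes>\<^bsub>G\<lparr>carrier := H\<rparr>\<^esub> inv\<^bsub>G\<lparr>carrier := H\<rparr>\<^esub> x \<in> K"
      using assms(4) m_inv_consistent[OF assms(1)] by simp
  qed
qed

lemma kernel_of_homs:
  assumes H: "subgroup H G" and A: "A \<subseteq> hom2 (G\<lparr>carrier := H\<rparr>)"
  shows "subgroup {x \<in> H. \<forall>f\<in>A. f x = 0} G" "{x \<in> H. \<forall>f\<in>A. f x = 0} \<lhd> G\<lparr>carrier := H\<rparr>"
proof -
  let ?K = "{x \<in> H. \<forall>f\<in>A. f x = 0}"
  have mult: "f (x \<otimes> y) = f x + f y" if "f \<in> A" "x \<in> H" "y \<in> H" for f x y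
    using hom2_on_mult that A by blast
  have inv: "f (inv x) = f x" if "f \<in> A" "x \<in> H" for f x using hom2_on_inv that A H by blast
  show K: "subgroup ?K G"
  proof (rule subgroupI)
    show "?K \<subseteq> carrier G" using subgroup.subset[OF H] by auto
    have "f \<one> = 0" if "f \<in> A" for f using hom2_on_one that A H by blast
    then show "?K \<noteq> {}" using subgroup.one_closed[OF H] by blast
    show "inv a \<in> ?K" if a: "a \<in> ?K" for a
    proof -
      have "f (inv a) = 0" if "f \<in> A" for f using inv[OF that, of a] a that by simp
      then show ?thesis using a subgroup.m_inv_closed[OF H] by simp
    qed
    show "a \<otimes> b \<in> ?K" if a: "a \<in> ?K" and b: "b \<in> ?K" for a b
    proof -
      have "f (a \<otimes> b) = 0" if f: "f \<in> A" for f
      proof -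
        have "f a = 0" "f b = 0" using a b f by blast+
        then show ?thesis using mult[OF f, of a b] a b by simp
      qed
      then show ?thesis using a b subgroup.m_closed[OF H] by simp
    qed
  qed
  show "?K \<lhd> G\<lparr>carrier := H\<rparr>"
  proof (rule normal_inI[OF H K])
    show "?K \<subseteq> H" by auto
    fix h k assume h: "h \<in> H" and k: "k \<in> ?K"
    have cl: "h \<otimes> k \<in> H" "inv h \<in> H" using h k subgroup.m_closed[OF H] subgroup.m_inv_closed[OF H] by auto
    have "f (h \<otimes> k \<otimes> inv h) = 0" if "f \<in> A" for f
      using mult[OF that cl] mult[OF that h, of k] inv[OF that h] k that by simp
    then show "h \<otimes> k \<otimes> inv h \<in> ?K" using cl subgroup.m_closed[OF H] by simp
  qed
qed

lemma ker2_subgroup: "subgroup H G \<Longrightarrow> f \<in> hom2 (G\<lparr>carrier := H\<rparr>) \<Longrightarrow> subgroup (ker2 H f) G"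
  using kernel_of_homs(1)[of H "{f}"] by (simp add: ker2_def)

lemma ker2_normal: "subgroup H G \<Longrightarrow> f \<in> hom2 (G\<lparr>carrier := H\<rparr>) \<Longrightarrow> ker2 H f \<lhd> G\<lparr>carrier := H\<rparr>"
  using kernel_of_homs(2)[of H "{f}"] by (simp add: ker2_def)

lemma ker2_index:
  assumes H: "subgroup H G" "finite (rcosets H)" and f: "f \<in> hom2 (G\<lparr>carrier := H\<rparr>)"
  shows "finite (rcosets (ker2 H f))" "card (rcosets (ker2 H f)) \<le> 2 * card (rcosets H)"
proof -
  have B: "finite {0, 1 :: bit}" "f ` H \<subseteq> {0, 1}" by auto
  have sep: "x \<otimes> inv y \<in> ker2 H f" if xy: "x \<in> H" "y \<in> H" "f x = f y" for x y
    using xy subgroup.m_closed[OF H(1)] subgroup.m_inv_closed[OF H(1)] hom2_on_mult[OF f] hom2_on_inv[OF f H(1)]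
    by (simp add: ker2_def)
  note * = card_rcosets_le[OF H ker2_subgroup[OF H(1) f] B sep]
  show "finite (rcosets (ker2 H f))" by (rule *(1))
  show "card (rcosets (ker2 H f)) \<le> 2 * card (rcosets H)" 
  proof -
    have "card {0, 1 :: bit} = 2" by simp
    from *(2)[unfolded this] show ?thesis by linarith
  qed
qed

lemma ker2_inj: "inj_on (ker2 H) (hom2 (G\<lparr>carrier := H\<rparr>))"
proof (intro inj_onI ext)
  fix f f' x assume f: "f \<in> hom2 (G\<lparr>carrier := H\<rparr>)" "f' \<in> hom2 (G\<lparr>carrier := H\<rparr>)" and eq: "ker2 H f = ker2 H f'"
  show "f x = f' x"
  proof (cases "x \<in> H")
    case True
    then have "f x = 0 \<longleftrightarrow> f' x = 0" using eq by (auto simp: ker2_def)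
    then show ?thesis by (cases "f x = 0") auto
  next
    case False
    then show ?thesis using hom2_on_outside[OF f(1)] hom2_on_outside[OF f(2)] by simp
  qed
qed

text \<open>A homomorphism to \<open>F\<^sub>2\<close> is determined by its kernel, whose index is at most twice that of \<open>H\<close>, and
  there are finitely many such subgroups.\<close>
lemma finite_hom2_finite_index:
  assumes S: "finite S" "S \<subseteq> carrier G" "generate G S = carrier G"
    and H: "subgroup H G" "finite (rcosets H)"
  shows "finite (hom2 (G\<lparr>carrier := H\<rparr>))"
proof -
  have "ker2 H ` hom2 (G\<lparr>carrier := H\<rparr>) \<subseteq> {K. subgroup K G \<and> finite (rcosets K) \<and> card (rcosets K) \<le> 2 * card (rcosets H)}"
  proof (rule image_subsetI)
    fix f assume f: "f \<in> hom2 (G\<lparr>carrier := H\<rparr>)"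
    show "ker2 H f \<in> {K. subgroup K G \<and> finite (rcosets K) \<and> card (rcosets K) \<le> 2 * card (rcosets H)}"
      using ker2_subgroup[OF H(1) f] ker2_index[OF H f] by simp
  qed
  then show ?thesis by (rule inj_on_finite[OF ker2_inj _ finite_subgroups_of_bounded_index[OF S]])
qed

lemma subnormal_carrier: "subnormal (carrier G) G"
  unfolding subnormal_def using subgroup_self
  by (intro exI[of _ "\<lambda>_. carrier G"] exI[of _ 1]) auto

lemma subnormal_step:
  assumes "subnormal H G" "subgroup K G" "K \<lhd> G\<lparr>carrier := H\<rparr>"
  shows "subnormal K G"
proof -
  obtain S and r :: nat where r: "1 \<le> r" "S 1 = carrier G" "S r = H"
    and sub: "\<forall>i\<in>{1..r}. subgroup (S i) G" and nrm: "\<forall>i\<in>{2..r}. S i \<lhd> G\<lparr>carrier := S (i - 1)\<rparr>"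
    using assms(1) unfolding subnormal_def by blast
  define S' where "S' = S(Suc r := K)"
  have S'_r: "S' i = S i" if "i \<le> r" for i using that by (simp add: S'_def)
  have S'_Suc: "S' (Suc r) = K" by (simp add: S'_def)
  show ?thesis unfolding subnormal_def
  proof (intro exI[of _ S'] exI[of _ "Suc r"] conjI ballI)
    fix i assume "i \<in> {1..Suc r}"
    then show "subgroup (S' i) G" using sub assms(2) S'_r S'_Suc by (cases "i = Suc r") auto
  next
    fix i assume "i \<in> {2..Suc r}"
    then show "S' i \<lhd> G\<lparr>carrier := S' (i - 1)\<rparr>"
      using nrm assms(3) S'_r[of i] S'_r[of "i - 1"] S'_Suc r(3) by (cases "i = Suc r") auto
  qed (use r S'_r S'_Suc in auto)
qed

definition normal_core :: "'a set \<Rightarrow> 'a set" where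
  "normal_core H = {g \<in> carrier G. \<forall>x\<in>carrier G. x \<otimes> g \<otimes> inv x \<in> H}"

lemma normal_core_subgroup: assumes H: "subgroup H G" shows "subgroup (normal_core H) G"
proof (rule subgroupI)
  show "normal_core H \<subseteq> carrier G" by (auto simp: normal_core_def)
  have "\<one> \<in> normal_core H" using subgroup.one_closed[OF H] by (simp add: normal_core_def)
  then show "normal_core H \<noteq> {}" by blast
  fix a assume a: "a \<in> normal_core H"
  show "inv a \<in> normal_core H" unfolding normal_core_def mem_Collect_eq
  proof (intro conjI ballI)
    show "inv a \<in> carrier G" using a by (simp add: normal_core_def)
    fix x assume x: "x \<in> carrier G"
    have "inv (x \<otimes> a \<otimes> inv x) \<in> H" using a x by (intro subgroup.m_inv_closed[OF H]) (simp add: normal_core_def)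
    then show "x \<otimes> inv a \<otimes> inv x \<in> H" using a x by (simp add: normal_core_def inv_mult_group m_assoc)
  qed
  fix b assume b: "b \<in> normal_core H"
  show "a \<otimes> b \<in> normal_core H" unfolding normal_core_def mem_Collect_eq
  proof (intro conjI ballI)
    show "a \<otimes> b \<in> carrier G" using a b by (simp add: normal_core_def)
    fix x assume x: "x \<in> carrier G"
    have ab: "a \<in> carrier G" "b \<in> carrier G" using a b by (auto simp: normal_core_def)
    have "(x \<otimes> a \<otimes> inv x) \<otimes> (x \<otimes> b \<otimes> inv x) \<in> H"
      by (rule subgroup.m_closed[OF H]) (use a b x in \<open>auto simp: normal_core_def\<close>)
    moreover have "(x \<otimes> a \<otimes> inv x) \<otimes> (x \<otimes> b \<otimes> inv x) = x \<otimes> (a \<otimes> b) \<otimes> inv x"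
    proof -
      have "inv x \<otimes> (x \<otimes> c) = c" if "c \<in> carrier G" for c using that x by (simp flip: m_assoc)
      then show ?thesis using x ab by (simp add: m_assoc)
    qed
    ultimately show "x \<otimes> (a \<otimes> b) \<otimes> inv x \<in> H" by simp
  qed
qed

lemma normal_core_normal: assumes H: "subgroup H G" shows "normal_core H \<lhd> G\<lparr>carrier := carrier G\<rparr>"
proof (rule normal_inI[OF subgroup_self normal_core_subgroup[OF H]])
  show "normal_core H \<subseteq> carrier G" by (auto simp: normal_core_def)
  fix h k assume h: "h \<in> carrier G" and k: "k \<in> normal_core H"
  have kG: "k \<in> carrier G" using k by (simp add: normal_core_def)
  show "h \<otimes> k \<otimes> inv h \<in> normal_core H" unfolding normal_core_def mem_Collect_eq
  proof (intro conjI ballI)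
    show "h \<otimes> k \<otimes> inv h \<in> carrier G" using h kG by simp
    fix x assume x: "x \<in> carrier G"
    have "(x \<otimes> h) \<otimes> k \<otimes> inv (x \<otimes> h) \<in> H" using k x h by (simp add: normal_core_def)
    then show "x \<otimes> (h \<otimes> k \<otimes> inv h) \<otimes> inv x \<in> H" using x h kG by (simp add: inv_mult_group m_assoc)
  qed
qed

lemma rcosets_carrier: "rcosets (carrier G) = {carrier G}"
  using coset_join2[OF _ subgroup_self] by (auto simp: RCOSETS_def)

text \<open>The normal core is the kernel of the action on the cosets of \<open>H\<close>.\<close>
lemma normal_core_finite_index:
  assumes H: "subgroup H G" "finite (rcosets H)"
  shows "finite (rcosets (normal_core H))"
proof (rule card_rcosets_le(1)[OF subgroup_self _ normal_core_subgroup[OF H(1)]])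
  have HG: "H \<subseteq> carrier G" by (rule subgroup.subset[OF H(1)])
  define \<kappa> where "\<kappa> = (\<lambda>g. \<lambda>X\<in>rcosets H. X #> g)"
  show "finite (rcosets (carrier G))" by (simp add: rcosets_carrier)
  show "finite (PiE (rcosets H) (\<lambda>_. rcosets H))" using H(2) by (intro finite_PiE) auto
  show "\<kappa> ` carrier G \<subseteq> PiE (rcosets H) (\<lambda>_. rcosets H)"
  proof (rule image_subsetI)
    fix g assume g: "g \<in> carrier G"
    have "X #> g \<in> rcosets H" if "X \<in> rcosets H" for X
    proof -
      from that obtain a where a: "a \<in> carrier G" "X = H #> a" by (auto simp: RCOSETS_def)
      have "X #> g = H #> (a \<otimes> g)" unfolding a(2) by (rule coset_mult_assoc[OF HG a(1) g])
      then show ?thesis using a(1) g by (auto simp: RCOSETS_def)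
    qed
    then show "\<kappa> g \<in> PiE (rcosets H) (\<lambda>_. rcosets H)" by (simp add: \<kappa>_def)
  qed
  fix g g' assume g: "g \<in> carrier G" "g' \<in> carrier G" and eq: "\<kappa> g = \<kappa> g'"
  show "g \<otimes> inv g' \<in> normal_core H" unfolding normal_core_def mem_Collect_eq
  proof (intro conjI ballI)
    show "g \<otimes> inv g' \<in> carrier G" using g by simp
    fix x assume x: "x \<in> carrier G"
    then have "H #> x \<in> rcosets H" by (auto simp: RCOSETS_def)
    then have "(H #> x) #> g = (H #> x) #> g'" using fun_cong[OF eq, of "H #> x"] by (simp add: \<kappa>_def)
    then have "H #> (x \<otimes> g) = H #> (x \<otimes> g')" using HG x g by (simp add: coset_mult_assoc)
    then have "(x \<otimes> g) \<otimes> inv (x \<otimes> g') \<in> H" using subgroup_rcos_eq_iff[OF H(1)] x g by simp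
    then show "x \<otimes> (g \<otimes> inv g') \<otimes> inv x \<in> H" using x g by (simp add: inv_mult_group m_assoc)
  qed
qed

text \<open>A homomorphism on \<open>H\<close> that vanishes on \<open>N \<inter> H\<close> is constant on each \<open>X \<inter> H\<close> with \<open>X\<close> a coset of \<open>N\<close>, so it
  corresponds to a set of cosets of \<open>N\<close>; restriction to \<open>N \<inter> H\<close> therefore has small kernel.\<close>
lemma card_hom2_le_inter:
  assumes N: "subgroup N G" "finite (rcosets N)" and H: "subgroup H G"
    and fin: "finite (hom2 (G\<lparr>carrier := N \<inter> H\<rparr>))"
  shows "card (hom2 (G\<lparr>carrier := H\<rparr>)) \<le> 2 ^ card (rcosets N) * card (hom2 (G\<lparr>carrier := N \<inter> H\<rparr>))"
proof -
  define \<kappa> where "\<kappa> = (\<lambda>(f :: 'a \<Rightarrow> bit) x. if x \<in> N \<inter> H then f x else 0)"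
  define B0 where "B0 = {f \<in> hom2 (G\<lparr>carrier := H\<rparr>). \<forall>x\<in>N \<inter> H. f x = 0}"
  define F where "F = (\<lambda>f :: 'a \<Rightarrow> bit. {X \<in> rcosets N. \<exists>x\<in>X \<inter> H. f x = 1})"
  have F1: "f x = 1 \<longleftrightarrow> N #> x \<in> F f" if f: "f \<in> B0" and x: "x \<in> H" for f x
  proof
    have xG: "x \<in> carrier G" by (rule subgroup.mem_carrier[OF H x])
    then show "f x = 1 \<Longrightarrow> N #> x \<in> F f"
      using x rcos_self[OF xG N(1)] by (auto simp: F_def RCOSETS_def)
    assume "N #> x \<in> F f"
    then obtain y where y: "y \<in> N #> x" "y \<in> H" "f y = 1" by (auto simp: F_def)
    then obtain k where k: "k \<in> N" "y = k \<otimes> x" by (auto simp: r_coset_def)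
    have kG: "k \<in> carrier G" by (rule subgroup.mem_carrier[OF N(1) k(1)])
    have "k = y \<otimes> inv x" using k(2) xG kG by (simp add: m_assoc)
    then have "k \<in> H" using y(2) x subgroup.m_closed[OF H] subgroup.m_inv_closed[OF H] by simp
    then have "f y = f k + f x" unfolding k(2) using f x hom2_on_mult[of f H k x] by (simp add: B0_def)
    moreover have "f k = 0" using f k(1) \<open>k \<in> H\<close> by (simp add: B0_def)
    ultimately show "f x = 1" using y(3) by simp
  qed
  have "inj_on F B0"
  proof (intro inj_onI ext)
    fix f f' x assume f: "f \<in> B0" "f' \<in> B0" and eq: "F f = F f'"
    show "f x = f' x"
    proof (cases "x \<in> H")
      case True
      then have "f x = 1 \<longleftrightarrow> f' x = 1" using F1[OF f(1)] F1[OF f(2)] eq by simp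
      then show ?thesis by (cases "f x = 0"; cases "f' x = 0") auto
    next
      case False
      then show ?thesis using hom2_on_outside[of f H x] hom2_on_outside[of f' H x] f by (simp add: B0_def)
    qed
  qed
  moreover have "F ` B0 \<subseteq> Pow (rcosets N)" by (auto simp: F_def)
  ultimately have B0: "finite B0" "card B0 \<le> 2 ^ card (rcosets N)"
    using N(2) inj_on_finite[of F B0 "Pow (rcosets N)"] card_inj_on_le[of F B0 "Pow (rcosets N)"]
    by (auto simp: card_Pow)
  have "card (hom2 (G\<lparr>carrier := H\<rparr>)) \<le> card B0 * card (hom2 (G\<lparr>carrier := N \<inter> H\<rparr>))"
  proof (rule card_le_fibres(2)[OF fin _ B0(1)])
    show "\<kappa> ` hom2 (G\<lparr>carrier := H\<rparr>) \<subseteq> hom2 (G\<lparr>carrier := N \<inter> H\<rparr>)"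
    proof (rule image_subsetI)
      fix f assume f: "f \<in> hom2 (G\<lparr>carrier := H\<rparr>)"
      show "\<kappa> f \<in> hom2 (G\<lparr>carrier := N \<inter> H\<rparr>)"
        unfolding hom2_def mem_Collect_eq
      proof (intro conjI ballI allI impI)
        fix x y assume "x \<in> carrier (G\<lparr>carrier := N \<inter> H\<rparr>)" "y \<in> carrier (G\<lparr>carrier := N \<inter> H\<rparr>)"
        then have xy: "x \<in> N" "x \<in> H" "y \<in> N" "y \<in> H" by auto
        then have "x \<otimes> y \<in> N \<inter> H" using subgroup.m_closed[OF N(1)] subgroup.m_closed[OF H] by blast
        then show "\<kappa> f (x \<otimes>\<^bsub>G\<lparr>carrier := N \<inter> H\<rparr>\<^esub> y) = \<kappa> f x + \<kappa> f y"
          using hom2_on_mult[OF f xy(2,4)] xy by (simp add: \<kappa>_def)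
      next
        fix x assume "x \<notin> carrier (G\<lparr>carrier := N \<inter> H\<rparr>)"
        then show "\<kappa> f x = 0" by (auto simp: \<kappa>_def)
      qed
    qed
    fix f f' assume f: "f \<in> hom2 (G\<lparr>carrier := H\<rparr>)" "f' \<in> hom2 (G\<lparr>carrier := H\<rparr>)" and eq: "\<kappa> f = \<kappa> f'"
    have "f x = f' x" if "x \<in> N \<inter> H" for x using fun_cong[OF eq, of x] that by (simp add: \<kappa>_def)
    moreover have "f - f' \<in> hom2 (G\<lparr>carrier := H\<rparr>)"
      using hom2_add[OF f] by (simp add: fun_diff_def plus_fun_def)
    ultimately show "f - f' \<in> B0" by (simp add: B0_def)
  qed
  also have "\<dots> \<le> 2 ^ card (rcosets N) * card (hom2 (G\<lparr>carrier := N \<inter> H\<rparr>))"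
    using B0(2) by (rule mult_le_mono1)
  finally show ?thesis .
qed

lemma inter_normal_in:
  assumes N: "subgroup N G" and H: "subgroup H G" and K: "subgroup K G" "K \<lhd> G\<lparr>carrier := H\<rparr>"
  shows "N \<inter> K \<lhd> G\<lparr>carrier := N \<inter> H\<rparr>"
proof (rule normal_inI)
  have KH: "K \<subseteq> H" using normal.axioms(1)[OF K(2)] subgroup.subset by fastforce
  show "subgroup (N \<inter> H) G" "subgroup (N \<inter> K) G" using N H K(1) by (auto intro: subgroups_Inter_pair)
  show "N \<inter> K \<subseteq> N \<inter> H" using KH by auto
  fix h k assume hk: "h \<in> N \<inter> H" "k \<in> N \<inter> K"
  have "h \<otimes> k \<otimes> inv h \<in> K"
    using normal.inv_op_closed2[OF K(2), of h k] hk m_inv_consistent[OF H, of h] by simp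
  moreover have "h \<otimes> k \<otimes> inv h \<in> N"
    using hk subgroup.m_closed[OF N] subgroup.m_inv_closed[OF N] by auto
  ultimately show "h \<otimes> k \<otimes> inv h \<in> N \<inter> K" by blast
qed

end

section \<open>Growth estimates\<close>

text \<open>Squared, the claim follows by induction from \<open>4 m (m + 1) \<le> (2 m + 1)\<^sup>2\<close>. A bound of the exact order
  \<open>4\<^sup>m / sqrt m\<close> is essential, since the resulting factor \<open>sqrt b\<close> has to beat the constant \<open>C + 1\<close> below.\<close>
lemma central_binomial_ge: "4 ^ m \<le> 2 * sqrt m * real ((2 * m) choose m)" if "m > 0" for m :: nat
proof -
  have *: "16 ^ m \<le> 4 * real m * (real ((2 * m) choose m))\<^sup>2" using that
  proof (induction m rule: nat_induct_non_zero)
    case (Suc m)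
    define B where "B = real ((2 * m) choose m)"
    define X Y where "X = (2 * Suc m) choose (Suc m)" and "Y = (2 * m + 1) choose m"
    have "Suc m * X = Suc m * (2 * Y)"
      using Suc_times_binomial[of m "2 * m + 1"] by (simp add: X_def Y_def)
    then have X: "X = 2 * Y" by (simp only: mult_cancel1) simp
    have "Suc m * Y = (2 * m + 1) * ((2 * m) choose m)"
      using Suc_times_binomial_eq[of "2 * m" m] binomial_symmetric[of m "2 * m + 1"]
      by (simp add: Y_def mult.commute)
    then have "real (Suc m * Y) = real ((2 * m + 1) * ((2 * m) choose m))" by (simp only:)
    then have Y: "real (Suc m) * Y = real (2 * m + 1) * B"
      unfolding B_def by (simp only: of_nat_mult)
    have e: "real ((2 * Suc m) choose (Suc m)) = 2 * real (2 * m + 1) * B / Suc m"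
      using Y unfolding X_def[symmetric] X by (simp add: field_simps)
    have "16 ^ Suc m \<le> 16 * (4 * real m * B\<^sup>2)" using Suc by (simp add: B_def)
    also have "\<dots> \<le> 4 * (2 * (2 * real m + 1))\<^sup>2 / Suc m * B\<^sup>2"
    proof -
      have "16 * (4 * real m) * Suc m \<le> 4 * (2 * (2 * real m + 1))\<^sup>2"
        by (simp add: power2_eq_square algebra_simps)
      then have "16 * (4 * real m) \<le> 4 * (2 * (2 * real m + 1))\<^sup>2 / Suc m"
        by (simp add: field_simps)
      then show ?thesis using mult_right_mono[of _ _ "B\<^sup>2"] by (metis mult.assoc zero_le_power2)
    qed
    also have "\<dots> = 4 * real (Suc m) * (real ((2 * Suc m) choose (Suc m)))\<^sup>2"
    proof -
      have "4 * x\<^sup>2 / y * B\<^sup>2 = 4 * y * (x * B / y)\<^sup>2" if "y > 0" for x y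
        using that by (simp add: power2_eq_square field_simps)
      from this[of "real (Suc m)" "2 * real (2 * m + 1)"] show ?thesis
        unfolding e by (simp add: add.commute)
    qed
    finally show ?case .
  qed simp
  have "(4 ^ m)\<^sup>2 \<le> (2 * sqrt m * real ((2 * m) choose m))\<^sup>2"
  proof -
    have "(4 ^ m)\<^sup>2 = (16::real) ^ m" by (simp flip: power_mult_distrib power_even_eq add: power2_eq_square)
    moreover have "(2 * sqrt m * x)\<^sup>2 = 4 * real m * x\<^sup>2" for x by (simp add: power_mult_distrib)
    ultimately show ?thesis using * by (simp only:)
  qed
  then show ?thesis by (rule power2_le_imp_le) simp
qed

lemma middle_binomial_ge: "2 ^ n \<le> 2 * sqrt n * real (n choose (n div 2))" if "n > 0"
proof (cases "even n")
  case True
  then obtain m where n: "n = 2 * m" by blast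
  with that have "m > 0" by simp
  have "2 ^ n \<le> 2 * sqrt m * real (n choose m)"
    using central_binomial_ge[OF \<open>m > 0\<close>] by (simp add: n power_mult)
  also have "\<dots> \<le> 2 * sqrt n * real (n choose m)"
    by (intro mult_right_mono mult_left_mono) (auto simp: n)
  finally show ?thesis by (simp add: n)
next
  case False
  then obtain m where n: "n = 2 * m + 1" by (auto elim: oddE)
  have "((2 * Suc m) choose (Suc m)) = 2 * (n choose m)"
    using binomial_symmetric[of m n] by (simp add: n)
  then have "2 * 2 ^ n \<le> 2 * sqrt (Suc m) * (2 * real (n choose m))"
    using central_binomial_ge[of "Suc m"] by (simp add: n power_mult)
  also have "\<dots> \<le> 2 * sqrt n * (2 * real (n choose m))"
    by (intro mult_right_mono mult_left_mono) (auto simp: n)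
  finally show ?thesis by (simp add: n)
qed

text \<open>The main term is at least \<open>sqrt b \<cdot> 2\<^sup>b / 2\<close>, and the hypothesis on \<open>b\<close> says \<open>C + 1 \<le> sqrt b / 4\<close>.\<close>
lemma sqrt_growth_of_binomial_bound:
  fixes b b' C :: nat
  assumes b: "16 * (C + 1)\<^sup>2 \<le> b" "0 < b"
    and h: "b * (b choose (b div 2)) \<le> b' + (C + 1) * 2 ^ b"
  shows "sqrt b * 2 ^ b / 4 \<le> b'"
proof -
  have "(real (4 * (C + 1)))\<^sup>2 \<le> b"
    using b(1) unfolding of_nat_power[symmetric] of_nat_le_iff by (simp only: power_mult_distrib) simp
  then have s: "real (4 * (C + 1)) \<le> sqrt b" using real_le_rsqrt by blast
  have "sqrt b * 2 ^ b \<le> sqrt b * (2 * sqrt b * real (b choose (b div 2)))"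
    using middle_binomial_ge[OF b(2)] by (intro mult_left_mono) auto
  also have "\<dots> = 2 * real (b * (b choose (b div 2)))" by simp
  also have "\<dots> \<le> 2 * real (b' + (C + 1) * 2 ^ b)" using h by (intro mult_left_mono) (simp_all only: of_nat_le_iff)
  also have "\<dots> = 2 * b' + real (4 * (C + 1)) * 2 ^ b / 2" by (simp add: algebra_simps)
  also have "\<dots> \<le> 2 * b' + sqrt b * 2 ^ b / 2"
    using s by (intro add_left_mono divide_right_mono mult_right_mono) auto
  finally show ?thesis by simp
qed

lemma eight_times_le_two_power: "8 * n \<le> 2 ^ n" if "6 \<le> n" for n :: nat
  using that by (induction n rule: dec_induct) auto

text \<open>Here \<open>2 ^ e i\<close> bounds the index of the \<open>i\<close>-th group of the tower. Since \<open>b\<close> grows at least like an iterated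
  exponential while \<open>e\<close> only accumulates it, eventually \<open>b i \<ge> 3 e i + 20\<close>. Two steps later
  \<open>ln n\<close> is at least \<open>b (i + 2) / 2\<close> and \<open>ln (ln n)\<close> is at least \<open>b (i + 1) / 4\<close> for
  \<open>n = 2 \<cdot> 2 ^ e (i + 3)\<close>, and the claim reduces to
  \<open>2^10 \<cdot> 2 ^ e (i + 1) \<le> b (i + 1) \<cdot> sqrt (b (i + 1))\<close>.\<close>
lemma growth_along_tower:
  fixes b e :: "nat \<Rightarrow> nat"
  assumes b0: "16 \<le> b 0"
    and step: "\<And>i. sqrt (b i) * 2 ^ b i / 4 \<le> b (Suc i)"
    and e: "\<And>i. e (Suc i) = e i + b i"
  shows "\<forall>\<^sub>F i in sequentially.
           2 * 2 ^ e i / (sqrt (ln (2 * 2 ^ e i)) * ln (ln (2 * 2 ^ e i))) < b i"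
proof -
  have pow: "2 ^ b i \<le> b (Suc i)" if "16 \<le> b i" for i
  proof -
    have "sqrt 16 \<le> sqrt (b i)" using that by (subst real_sqrt_le_iff) simp
    then have "1 * 2 ^ b i \<le> sqrt (b i) / 4 * (2::real) ^ b i" by (intro mult_right_mono) auto
    then have "real (2 ^ b i) \<le> real (b (Suc i))" using step[of i] unfolding of_nat_power of_nat_numeral by linarith
    then show ?thesis by (simp only: of_nat_le_iff)
  qed
  have b16: "16 \<le> b i" for i
  proof (induction i)
    case (Suc i)
    have "b i \<le> 2 ^ b i" by (simp add: less_imp_le)
    then show ?case using pow[OF Suc] Suc by linarith
  qed (rule b0)
  have b8: "8 * b i \<le> b (Suc i)" for i
    using eight_times_le_two_power[of "b i"] b16[of i] pow[OF b16, of i] by linarith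
  \<comment> \<open>Here \<open>8 b i \<le> b (i + 1)\<close> leaves \<open>b - 3 e\<close> growing by at least \<open>4 b i \<ge> 64\<close> in each step.\<close>
  have slack: "3 * e i + 64 * i \<le> b i + 3 * e 0" for i
  proof (induction i)
    case (Suc i)
    then show ?case using b8[of i] b16[of i] e[of i] by simp
  qed simp
  have pB: "2 ^ b i \<le> real (b (Suc i))" for i
    using pow[OF b16[of i]] by (metis of_nat_le_iff of_nat_numeral of_nat_power)
  \<comment> \<open>As \<open>b (i + 1) \<ge> 2 ^ b i\<close>, its square root is at least \<open>2 ^ (b i / 2)\<close>, which dominates \<open>2 ^ e i\<close>.\<close>
  have big: "2 ^ 10 * 2 ^ e (Suc i) \<le> real (b (Suc i)) * sqrt (b (Suc i))" if i: "3 * e i + 20 \<le> b i" for i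
  proof -
    have "2 ^ 10 * 2 ^ e i \<le> sqrt (b (Suc i))"
    proof (rule real_le_rsqrt)
      have "(2 ^ 10 * 2 ^ e i)\<^sup>2 = (2::real) ^ (2 * e i + 20)"
        by (simp add: power_add power_even_eq power_mult_distrib)
      also have "\<dots> \<le> 2 ^ b i" using i by (intro power_increasing) auto
      also have "\<dots> \<le> b (Suc i)" by (rule pB)
      finally show "(2 ^ 10 * 2 ^ e i)\<^sup>2 \<le> real (b (Suc i))" .
    qed
    then have "2 ^ b i * (2 ^ 10 * 2 ^ e i) \<le> real (b (Suc i)) * sqrt (b (Suc i))"
      using pB by (intro mult_mono) auto
    then show ?thesis by (simp add: e power_add mult.commute mult.left_commute)
  qed
  have key: "2 * 2 ^ e (Suc (Suc i)) / (sqrt (ln (2 * 2 ^ e (Suc (Suc i)))) * ln (ln (2 * 2 ^ e (Suc (Suc i))))) < b (Suc (Suc i))"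
    if i: "2 ^ 10 * 2 ^ e i \<le> real (b i) * sqrt (b i)" for i
  proof -
    define B where "B = real (b i)"
    define B' where "B' = real (b (Suc i))"
    define D where "D = (2::real) ^ e i"
    define n where "n = (2::real) * 2 ^ e (Suc (Suc i))"
    define P P' where "P = (2::real) ^ b i" and "P' = (2::real) ^ b (Suc i)"
    have B: "16 \<le> B" using b16[of i] by (simp add: B_def)
    have B': "16 \<le> B'" using b16[of "Suc i"] by (simp add: B'_def)
    have Dpos: "1 \<le> D" and Ppos: "1 \<le> P" and P'pos: "1 \<le> P'" by (simp_all add: D_def P_def P'_def)
    have ln2: "1 / 2 \<le> ln (2::real)" 
    proof -
      have "1 \<le> ln (2 ^ 2 :: real)" using exp_le by (subst ln_ge_iff) auto
      then show ?thesis by (subst (asm) ln_realpow) auto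
    qed
    have n: "n = 2 * (D * P) * P'"
      by (simp add: e D_def n_def P_def P'_def power_add)
    have "1 * 1 \<le> D * P" using Dpos Ppos by (intro mult_mono) auto
    then have "1 * P' \<le> 2 * (D * P) * P'" using P'pos by (intro mult_right_mono) auto
    then have n2: "P' \<le> n" by (simp add: n)
    then have npos: "0 < n" using P'pos by linarith
    have lnn: "B' / 2 \<le> ln n"
    proof -
      have "B' * (1 / 2) \<le> B' * ln 2" using ln2 B' by (intro mult_left_mono) auto
      also have "\<dots> = ln P'" by (simp add: B'_def P'_def ln_realpow)
      also have "\<dots> \<le> ln n" using n2 P'pos npos by (subst ln_le_cancel_iff) auto
      finally show ?thesis by simp
    qed
    have pB': "P \<le> B'" using pB by (simp add: P_def B'_def)
    have lnln: "B / 4 \<le> ln (ln n)"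
    proof -
      have "B / 4 \<le> (B - 1) * (1 / 2)" using B by simp
      also have "\<dots> \<le> (B - 1) * ln 2" using ln2 B by (intro mult_left_mono) auto
      also have "\<dots> = ln (P / 2)" by (simp add: P_def B_def ln_div ln_realpow algebra_simps)
      also have "\<dots> \<le> ln (ln n)" using lnn pB' Ppos by (subst ln_le_cancel_iff) auto
      finally show ?thesis .
    qed
    have stepi: "sqrt B * P / 4 \<le> B'" using step[of i] by (simp add: B_def B'_def P_def)
    have stepS: "sqrt B' * P' / 4 \<le> b (Suc (Suc i))" using step[of "Suc i"] by (simp add: B'_def P'_def)
    have pos: "0 < sqrt (B' / 2) * (B / 4)" using B B' by simp
    have den: "sqrt (B' / 2) * (B / 4) \<le> sqrt (ln n) * ln (ln n)"
      using lnn lnln B B' by (intro mult_mono) auto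
    have "n / (sqrt (ln n) * ln (ln n)) \<le> n / (sqrt (B' / 2) * (B / 4))"
      using den pos npos less_le_trans[OF pos den] by (intro divide_left_mono) (auto intro: mult_pos_pos)
    also have "\<dots> < sqrt B' * P' / 4"
    proof -
      have "512 * (D * P) = (2 ^ 10 * D) * P / 2" by simp
      also have "\<dots> \<le> (B * sqrt B) * P / 2"
        using i Ppos by (intro divide_right_mono mult_right_mono) (auto simp: B_def D_def)
      also have "\<dots> = B * (sqrt B * P / 4) * 2" by simp
      also have "\<dots> \<le> B * B' * 2" using stepi B by (intro mult_right_mono mult_left_mono) auto
      finally have "256 * (D * P) \<le> B * B'" by linarith
      moreover have "0 < D * P" using Dpos Ppos by simp
      ultimately have less: "64 * (D * P) < B * B'" by linarith
      have half: "B' / 2 \<le> sqrt B' * sqrt (B' / 2)"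
      proof -
        have "B' / 2 = sqrt (B' / 2) * sqrt (B' / 2)" using B' by simp
        also have "\<dots> \<le> sqrt B' * sqrt (B' / 2)" using B' by (intro mult_right_mono) auto
        finally show ?thesis .
      qed
      have "4 * n < B * B' * P' / 8"
        using mult_strict_right_mono[OF less, of P'] P'pos by (simp add: n algebra_simps)
      also have "\<dots> = (B' / 2) * (P' * (B / 4))" by simp
      also have "\<dots> \<le> (sqrt B' * sqrt (B' / 2)) * (P' * (B / 4))"
        using half B P'pos by (intro mult_right_mono) auto
      finally have "4 * n < (sqrt B' * P') * (sqrt (B' / 2) * (B / 4))" by (simp only: mult_ac)
      then have "n < (sqrt B' * P' / 4) * (sqrt (B' / 2) * (B / 4))" by simp
      then show ?thesis using pos by (simp only: pos_divide_less_eq)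
    qed
    also have "\<dots> \<le> b (Suc (Suc i))" by (rule stepS)
    finally show ?thesis unfolding n_def .
  qed
  show ?thesis
    unfolding eventually_sequentially
  proof (intro exI allI impI)
    fix k assume k: "3 * e 0 + 23 \<le> k"
    define i where "i = k - 3"
    have i: "k = Suc (Suc (Suc i))" "3 * e 0 + 20 \<le> i" using k by (auto simp: i_def)
    show "2 * 2 ^ e k / (sqrt (ln (2 * 2 ^ e k)) * ln (ln (2 * 2 ^ e k))) < b k"
      unfolding i(1) by (rule key, rule big) (use slack[of i] i(2) in linarith)
  qed
qed

section \<open>The tower of Frattini subgroups\<close>

lemma (in hom2_basis) common_kernel_eq: "common_kernel = {x \<in> carrier G. \<forall>f\<in>hom2 G. f x = 0}"
proof (intro equalityI subsetI)
  fix x assume x: "x \<in> common_kernel"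
  have "f x = 0" if f: "f \<in> hom2 G" for f
  proof -
    have "(\<Sum>i<b. f (g i) * \<phi> i x) = 0" using x by (intro sum.neutral) (simp add: common_kernel_def)
    then show ?thesis unfolding expand[OF f, of x] .
  qed
  then show "x \<in> {x \<in> carrier G. \<forall>f\<in>hom2 G. f x = 0}" using x by (simp add: common_kernel_def)
next
  fix x assume "x \<in> {x \<in> carrier G. \<forall>f\<in>hom2 G. f x = 0}"
  then show "x \<in> common_kernel" using \<phi> by (auto simp: common_kernel_def)
qed

text \<open>A bound on the difference makes \<open>b\<^sub>2\<close> finite wherever \<open>b\<^sub>1\<close> is, since \<open>\<infinity> - k = \<infinity>\<close>.\<close>
lemma b2_b1_property_bound:
  assumes "b2_b1_property G 2"
  shows "\<exists>C. \<forall>H\<in>finite_index_subgroups G. \<forall>b. betti 1 (G\<lparr>carrier := H\<rparr>) 2 \<le> enat b \<longrightarrow>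
    (\<exists>c\<le>b + C. betti 2 (G\<lparr>carrier := H\<rparr>) 2 = enat c)"
proof -
  obtain C :: real where C: "\<forall>H\<in>finite_index_subgroups G.
      ereal_of_enat (betti 2 (G\<lparr>carrier := H\<rparr>) 2) - ereal_of_enat (betti 1 (G\<lparr>carrier := H\<rparr>) 2) \<le> ereal C"
    using assms unfolding b2_b1_property_def by blast
  show ?thesis
  proof (rule exI[of _ "nat \<lceil>C\<rceil>"], intro ballI allI impI)
    fix H b assume H: "H \<in> finite_index_subgroups G" and b: "betti 1 (G\<lparr>carrier := H\<rparr>) 2 \<le> enat b"
    obtain k where k: "betti 1 (G\<lparr>carrier := H\<rparr>) 2 = enat k" "k \<le> b"
      using b by (cases "betti 1 (G\<lparr>carrier := H\<rparr>) 2") auto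
    have le: "ereal_of_enat (betti 2 (G\<lparr>carrier := H\<rparr>) 2) - ereal (real k) \<le> ereal C"
      using bspec[OF C H] unfolding k(1) by simp
    show "\<exists>c\<le>b + nat \<lceil>C\<rceil>. betti 2 (G\<lparr>carrier := H\<rparr>) 2 = enat c"
    proof (cases "betti 2 (G\<lparr>carrier := H\<rparr>) 2")
      case (enat c)
      then have "real c - real k \<le> C" using le by simp
      then have "c \<le> k + nat \<lceil>C\<rceil>" by linarith
      then show ?thesis using enat k(2) by (intro exI[of _ c]) auto
    next
      case infinity
      then show ?thesis using le by simp
    qed
  qed
qed

locale fg_group = group G for G :: "('g, 'm) monoid_scheme" (structure) +
  assumes fg: "\<exists>S. finite S \<and> S \<subseteq> carrier G \<and> generate G S = carrier G"
begin

lemma finite_index_subgroups_iff: "H \<in> finite_index_subgroups G \<longleftrightarrow> subgroup H G \<and> finite (rcosets H)"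
  by (simp add: finite_index_subgroups_def)

lemma finite_bounded_index: "finite {H \<in> finite_index_subgroups G. card (rcosets H) \<le> n}"
proof -
  obtain S where S: "finite S" "S \<subseteq> carrier G" "generate G S = carrier G" using fg by blast
  show ?thesis
    using finite_subgroups_of_bounded_index[OF S, of n] by (simp add: finite_index_subgroups_def conj_assoc)
qed

lemma finite_hom2_of_finite_index: assumes "H \<in> finite_index_subgroups G" shows "finite (hom2 (G\<lparr>carrier := H\<rparr>))"
proof -
  obtain S where S: "finite S" "S \<subseteq> carrier G" "generate G S = carrier G" using fg by blast
  show ?thesis using assms by (intro finite_hom2_finite_index[OF S]) (auto simp: finite_index_subgroups_iff)
qed

lemma hom2_basis_of_subgroup:
  assumes "H \<in> finite_index_subgroups G"
  obtains b \<phi> g where "hom2_basis (G\<lparr>carrier := H\<rparr>) b \<phi> g"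
proof -
  have "group (G\<lparr>carrier := H\<rparr>)"
    using assms subgroup.subgroup_is_group[OF _ is_group] by (simp add: finite_index_subgroups_iff)
  from group.hom2_basis_exists[OF this finite_hom2_of_finite_index[OF assms]] show thesis using that by blast
qed

definition rank2 :: "'g set \<Rightarrow> nat" where
  "rank2 H = (THE b. card (hom2 (G\<lparr>carrier := H\<rparr>)) = 2 ^ b)"

lemma rank2_eqI: "card (hom2 (G\<lparr>carrier := H\<rparr>)) = 2 ^ b \<Longrightarrow> rank2 H = b"
  unfolding rank2_def by (rule the_equality) simp_all

lemma card_hom2_eq:
  assumes "H \<in> finite_index_subgroups G" shows "card (hom2 (G\<lparr>carrier := H\<rparr>)) = 2 ^ rank2 H"
proof -
  obtain b \<phi> g where "hom2_basis (G\<lparr>carrier := H\<rparr>) b \<phi> g" by (rule hom2_basis_of_subgroup[OF assms])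
  then have "card (hom2 (G\<lparr>carrier := H\<rparr>)) = 2 ^ b" by (rule hom2_basis.card_hom2)
  moreover from this have "rank2 H = b" by (rule rank2_eqI)
  ultimately show ?thesis by simp
qed

lemma betti_1_le_rank2:
  assumes "H \<in> finite_index_subgroups G" shows "betti 1 (G\<lparr>carrier := H\<rparr>) 2 \<le> enat (rank2 H)"
proof -
  obtain b \<phi> g where b: "hom2_basis (G\<lparr>carrier := H\<rparr>) b \<phi> g" by (rule hom2_basis_of_subgroup[OF assms])
  show ?thesis using hom2_basis.betti_1_le[OF b] rank2_eqI[OF hom2_basis.card_hom2[OF b]] by simp
qed

text \<open>The subgroup generated by the squares in \<open>H\<close>; for a finite 2-group, the Frattini subgroup.\<close>
definition frattini2 :: "'g set \<Rightarrow> 'g set" where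
  "frattini2 H = {x \<in> H. \<forall>f\<in>hom2 (G\<lparr>carrier := H\<rparr>). f x = 0}"

lemma frattini2_subgroup:
  assumes "subgroup H G" shows "subgroup (frattini2 H) G" "frattini2 H \<lhd> G\<lparr>carrier := H\<rparr>"
  using kernel_of_homs[OF assms, of "hom2 (G\<lparr>carrier := H\<rparr>)"] by (auto simp: frattini2_def)

lemma frattini2_index:
  assumes "H \<in> finite_index_subgroups G"
  shows "frattini2 H \<in> finite_index_subgroups G" "card (rcosets (frattini2 H)) \<le> card (rcosets H) * 2 ^ rank2 H"
proof -
  have H: "subgroup H G" "finite (rcosets H)" using assms by (auto simp: finite_index_subgroups_iff)
  obtain b \<phi> g where b: "hom2_basis (G\<lparr>carrier := H\<rparr>) b \<phi> g" by (rule hom2_basis_of_subgroup[OF assms])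
  have rank: "rank2 H = b" by (rule rank2_eqI[OF hom2_basis.card_hom2[OF b]])
  have ker: "frattini2 H = {x \<in> H. \<forall>i<b. \<phi> i x = 0}"
    using hom2_basis.common_kernel_eq[OF b] hom2_basis.common_kernel_def[OF b] by (simp add: frattini2_def)
  define \<kappa> where "\<kappa> = (\<lambda>x. {i. i < b \<and> \<phi> i x = 1})"
  have \<kappa>: "\<kappa> ` H \<subseteq> Pow {..<b}" by (auto simp: \<kappa>_def)
  have sep: "x \<otimes> inv y \<in> frattini2 H" if xy: "x \<in> H" "y \<in> H" and eq: "\<kappa> x = \<kappa> y" for x y
  proof -
    have inv: "inv y \<in> H" using subgroup.m_inv_closed[OF H(1) xy(2)] .
    have "\<phi> i (x \<otimes> inv y) = 0" if i: "i < b" for i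
    proof -
      have \<phi>: "\<phi> i \<in> hom2 (G\<lparr>carrier := H\<rparr>)" by (rule hom2_basis.\<phi>[OF b i])
      have "i \<in> \<kappa> x \<longleftrightarrow> i \<in> \<kappa> y" using eq by simp
      then have "\<phi> i x = \<phi> i y" using i by (cases "\<phi> i x = 0"; cases "\<phi> i y = 0") (auto simp: \<kappa>_def)
      then show ?thesis
        using hom2_on_mult[OF \<phi> xy(1) inv] hom2_on_inv[OF \<phi> H(1) xy(2)] by simp
    qed
    then show ?thesis using subgroup.m_closed[OF H(1) xy(1) inv] by (simp add: ker)
  qed
  note * = card_rcosets_le[OF H frattini2_subgroup(1)[OF H(1)] finite_Pow_iff[THEN iffD2, OF finite_lessThan] \<kappa> sep]
  show "frattini2 H \<in> finite_index_subgroups G"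
    unfolding finite_index_subgroups_iff using *(1) frattini2_subgroup(1)[OF H(1)] by blast
  have "card (Pow {..<b}) = 2 ^ b" by (simp add: card_Pow)
  from *(2)[unfolded this] show "card (rcosets (frattini2 H)) \<le> card (rcosets H) * 2 ^ rank2 H" unfolding rank .
qed

lemma rank2_frattini2_ge:
  assumes H: "H \<in> finite_index_subgroups G"
    and betti_2: "betti 2 (G\<lparr>carrier := H\<rparr>) 2 = enat c" "c \<le> rank2 H + C"
  shows "rank2 H * (rank2 H choose (rank2 H div 2)) \<le> rank2 (frattini2 H) + (C + 1) * 2 ^ rank2 H"
proof -
  obtain b \<phi> g where b: "hom2_basis (G\<lparr>carrier := H\<rparr>) b \<phi> g" by (rule hom2_basis_of_subgroup[OF H])
  have rank: "rank2 H = b" by (rule rank2_eqI[OF hom2_basis.card_hom2[OF b]])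
  have "group (G\<lparr>carrier := H\<rparr>)" using b by (simp add: hom2_basis_def)
  then obtain Z where Z: "h2_detected_by (G\<lparr>carrier := H\<rparr>) c Z"
    using group.h2_detected_by_betti_2[OF _ betti_2(1)] by blast
  have K: "hom2_basis.common_kernel (G\<lparr>carrier := H\<rparr>) b \<phi> = frattini2 H"
    using hom2_basis.common_kernel_eq[OF b] by (simp add: frattini2_def)
  have K': "(G\<lparr>carrier := H\<rparr>)\<lparr>carrier := frattini2 H\<rparr> = G\<lparr>carrier := frattini2 H\<rparr>" by simp
  have "2 ^ (b * (b choose (b div 2))) \<le> 2 ^ ((C + 1) * 2 ^ b) * card (hom2 (G\<lparr>carrier := frattini2 H\<rparr>))"
    using hom2_basis.card_hom2_common_kernel_ge[OF b finite_hom2_of_finite_index[OF H] Z, of C] betti_2(2)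
      finite_hom2_of_finite_index[OF frattini2_index(1)[OF H]]
    unfolding K K' rank by blast
  also have "\<dots> = 2 ^ ((C + 1) * 2 ^ b + rank2 (frattini2 H))"
    by (simp only: card_hom2_eq[OF frattini2_index(1)[OF H]] power_add)
  finally have "b * (b choose (b div 2)) \<le> (C + 1) * 2 ^ b + rank2 (frattini2 H)"
    by (rule power_le_imp_le_exp[rotated]) simp
  then show ?thesis unfolding rank by linarith
qed

text \<open>Distinct homomorphisms to \<open>F\<^sub>2\<close> have distinct kernels; the zero homomorphism contributes \<open>H\<close> itself.\<close>
lemma subnormal_growth_ge:
  assumes H: "H \<in> finite_index_subgroups G" "subnormal H G" and n: "2 * card (rcosets H) \<le> n"
  shows "2 ^ rank2 H \<le> subnormal_growth G n"
proof -
  have H': "subgroup H G" "finite (rcosets H)" using H(1) by (auto simp: finite_index_subgroups_iff)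
  let ?A = "{K \<in> finite_index_subgroups G. subnormal K G \<and> card (rcosets K) \<le> n}"
  have "ker2 H ` hom2 (G\<lparr>carrier := H\<rparr>) \<subseteq> ?A"
  proof (rule image_subsetI)
    fix f assume f: "f \<in> hom2 (G\<lparr>carrier := H\<rparr>)"
    have "subnormal (ker2 H f) G"
      by (rule subnormal_step[OF H(2) ker2_subgroup[OF H'(1) f] ker2_normal[OF H'(1) f]])
    then show "ker2 H f \<in> ?A"
      using ker2_subgroup[OF H'(1) f] ker2_index[OF H' f] n by (simp add: finite_index_subgroups_iff)
  qed
  moreover have "finite ?A" by (rule finite_subset[OF _ finite_bounded_index[of n]]) auto
  ultimately have "card (hom2 (G\<lparr>carrier := H\<rparr>)) \<le> card ?A"
    by (intro card_inj_on_le[OF ker2_inj])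
  then show ?thesis unfolding subnormal_growth_def card_hom2_eq[OF H(1)] .
qed

lemma subnormal_growth_le: "subnormal_growth G n \<le> subgroup_growth G n"
  unfolding subnormal_growth_def subgroup_growth_def
  by (rule card_mono[OF finite_bounded_index]) auto

definition tower :: "'g set \<Rightarrow> nat \<Rightarrow> 'g set" where
  "tower H i = (frattini2 ^^ i) H"

lemma tower_simps: "tower H 0 = H" "tower H (Suc i) = frattini2 (tower H i)"
  by (simp_all add: tower_def)

lemma tower_finite_index: "H \<in> finite_index_subgroups G \<Longrightarrow> tower H i \<in> finite_index_subgroups G"
  by (induction i) (simp_all add: tower_simps frattini2_index(1))

text \<open>The threshold on the rank persists because each step strictly increases it.\<close>
lemma tower_rank2:
  assumes H: "H \<in> finite_index_subgroups G"
    and C: "\<forall>H\<in>finite_index_subgroups G. \<forall>b. betti 1 (G\<lparr>carrier := H\<rparr>) 2 \<le> enat b \<longrightarrow>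
      (\<exists>c\<le>b + C. betti 2 (G\<lparr>carrier := H\<rparr>) 2 = enat c)"
    and start: "16 * (C + 1)\<^sup>2 \<le> rank2 H"
  shows "rank2 H + i \<le> rank2 (tower H i) \<and>
    sqrt (rank2 (tower H i)) * 2 ^ rank2 (tower H i) / 4 \<le> rank2 (tower H (Suc i))"
proof -
  have step: "sqrt (rank2 K) * 2 ^ rank2 K / 4 \<le> rank2 (frattini2 K)"
    if K: "K \<in> finite_index_subgroups G" and large: "16 * (C + 1)\<^sup>2 \<le> rank2 K" for K
  proof (rule sqrt_growth_of_binomial_bound[OF large])
    show "0 < rank2 K" using large by (cases "rank2 K = 0") auto
    obtain c where c: "c \<le> rank2 K + C" "betti 2 (G\<lparr>carrier := K\<rparr>) 2 = enat c"
      using C K betti_1_le_rank2[OF K] by blast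
    show "rank2 K * (rank2 K choose (rank2 K div 2)) \<le> rank2 (frattini2 K) + (C + 1) * 2 ^ rank2 K"
      by (rule rank2_frattini2_ge[OF K c(2,1)])
  qed
  have grow: "rank2 K < rank2 (frattini2 K)"
    if K: "K \<in> finite_index_subgroups G" and large: "16 * (C + 1)\<^sup>2 \<le> rank2 K" for K
  proof -
    have "16 * 1 \<le> 16 * (C + 1)\<^sup>2" by (intro mult_le_mono2) simp
    then have "16 \<le> real (rank2 K)" using large by linarith
    then have "sqrt 16 \<le> sqrt (rank2 K)" by (rule real_sqrt_le_mono)
    then have "1 * 2 ^ rank2 K \<le> sqrt (rank2 K) / 4 * 2 ^ rank2 K" by (intro mult_right_mono) auto
    then have "(2::real) ^ rank2 K \<le> rank2 (frattini2 K)" using step[OF K large] by linarith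
    moreover have "real (rank2 K) < 2 ^ rank2 K" by (rule of_nat_less_two_power)
    ultimately have "real (rank2 K) < real (rank2 (frattini2 K))" by linarith
    then show ?thesis by simp
  qed
  have ge: "rank2 H + i \<le> rank2 (tower H i)" for i
  proof (induction i)
    case (Suc i)
    then have "rank2 (tower H i) < rank2 (tower H (Suc i))"
      unfolding tower_simps using start by (intro grow tower_finite_index[OF H]) linarith
    then show ?case using Suc by linarith
  qed (simp add: tower_simps)
  have "16 * (C + 1)\<^sup>2 \<le> rank2 (tower H i)" using ge[of i] start by linarith
  then show ?thesis using ge[of i] step[OF tower_finite_index[OF H, of i]] by (simp add: tower_simps)
qed

lemma tower_subnormal:
  assumes "H \<in> finite_index_subgroups G" "subnormal H G"
  shows "subnormal (tower H i) G"
proof (induction i)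
  case (Suc i)
  have "subgroup (tower H i) G" using tower_finite_index[OF assms(1)] by (simp add: finite_index_subgroups_iff)
  then show ?case unfolding tower_simps by (intro subnormal_step[OF Suc] frattini2_subgroup)
qed (simp add: tower_simps assms)

lemma inter_tower_subnormal:
  assumes N: "subgroup N G" "subnormal N G" and H: "H \<in> finite_index_subgroups G" "N \<subseteq> H"
  shows "subnormal (N \<inter> tower H i) G"
proof (induction i)
  case 0
  then show ?case using N(2) H(2) by (simp add: tower_simps Int_absorb2)
next
  case (Suc i)
  have T: "subgroup (tower H j) G" for j using tower_finite_index[OF H(1)] by (simp add: finite_index_subgroups_iff)
  have "N \<inter> tower H (Suc i) \<lhd> G\<lparr>carrier := N \<inter> tower H i\<rparr>"
    unfolding tower_simps
    by (rule inter_normal_in[OF N(1) T frattini2_subgroup[OF T]])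
  then show ?case by (rule subnormal_step[OF Suc subgroups_Inter_pair[OF N(1) T]])
qed

lemma finite_index_inter:
  assumes "N \<in> finite_index_subgroups G" "H \<in> finite_index_subgroups G"
  shows "N \<inter> H \<in> finite_index_subgroups G"
proof -
  have N: "subgroup N G" "finite (rcosets N)" and H: "subgroup H G" "finite (rcosets H)"
    using assms by (auto simp: finite_index_subgroups_iff)
  have NH: "subgroup (N \<inter> H) G" by (rule subgroups_Inter_pair[OF N(1) H(1)])
  have sub: "(\<lambda>x. N #> x) ` H \<subseteq> rcosets N" using subgroup.subset[OF H(1)] by (auto simp: RCOSETS_def)
  have sep: "x \<otimes> inv y \<in> N \<inter> H" if "x \<in> H" "y \<in> H" "N #> x = N #> y" for x y
    using that subgroup_rcos_eq_iff[OF N(1)] subgroup.mem_carrier[OF H(1)]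
      subgroup.m_closed[OF H(1)] subgroup.m_inv_closed[OF H(1)] by simp
  have "finite (rcosets (N \<inter> H))" by (rule card_rcosets_le(1)[OF H NH N(2) sub sep])
  then show ?thesis using NH by (simp add: finite_index_subgroups_iff)
qed

text \<open>Intersecting the tower of \<open>H\<close> with the normal core \<open>N\<close> of \<open>H\<close> makes it subnormal and lowers the rank by at most
  the index of \<open>N\<close>, a constant that the growing rank of the tower eventually exceeds.\<close>
lemma subnormal_of_large_rank2:
  assumes H: "H \<in> finite_index_subgroups G"
    and C: "\<forall>H\<in>finite_index_subgroups G. \<forall>b. betti 1 (G\<lparr>carrier := H\<rparr>) 2 \<le> enat b \<longrightarrow>
      (\<exists>c\<le>b + C. betti 2 (G\<lparr>carrier := H\<rparr>) 2 = enat c)"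
    and start: "16 * (C + 1)\<^sup>2 \<le> rank2 H"
  shows "\<exists>K\<in>finite_index_subgroups G. subnormal K G \<and> B \<le> rank2 K"
proof -
  have H': "subgroup H G" "finite (rcosets H)" using H by (auto simp: finite_index_subgroups_iff)
  define N where "N = normal_core H"
  have N: "subgroup N G" "finite (rcosets N)" unfolding N_def by (rule normal_core_subgroup normal_core_finite_index; rule H')+
  have NH: "N \<subseteq> H"
  proof
    fix x assume "x \<in> N"
    then have "x \<in> carrier G" "\<one> \<otimes> x \<otimes> inv \<one> \<in> H" using one_closed unfolding N_def normal_core_def by blast+
    then show "x \<in> H" by simp
  qed
  have "subnormal N G"
    unfolding N_def by (rule subnormal_step[OF subnormal_carrier normal_core_subgroup normal_core_normal]) (rule H')+
  \<comment> \<open>At this stage the rank is large enough to stay above \<open>B\<close> after the loss of at most the index of \<open>N\<close>.\<close>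
  define i where "i = card (rcosets N) + B"
  define K where "K = N \<inter> tower H i"
  have T: "tower H i \<in> finite_index_subgroups G" by (rule tower_finite_index[OF H])
  have K: "K \<in> finite_index_subgroups G"
    unfolding K_def by (rule finite_index_inter[OF _ T]) (use N in \<open>simp add: finite_index_subgroups_iff\<close>)
  have "subnormal K G" unfolding K_def by (rule inter_tower_subnormal[OF N(1) \<open>subnormal N G\<close> H NH])
  moreover have "B \<le> rank2 K"
  proof -
    have "2 ^ rank2 (tower H i) \<le> 2 ^ card (rcosets N) * card (hom2 (G\<lparr>carrier := K\<rparr>))"
      unfolding card_hom2_eq[OF T, symmetric] K_def
      using T finite_hom2_of_finite_index[OF K] by (intro card_hom2_le_inter[OF N]) (simp_all add: finite_index_subgroups_iff K_def)
    also have "\<dots> = 2 ^ (card (rcosets N) + rank2 K)" by (simp only: card_hom2_eq[OF K] power_add)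
    finally have "rank2 (tower H i) \<le> card (rcosets N) + rank2 K" by (rule power_le_imp_le_exp[rotated]) simp
    moreover have "i \<le> rank2 (tower H i)" using tower_rank2[OF H C start, of i] by linarith
    ultimately show ?thesis by (simp add: i_def)
  qed
  ultimately show ?thesis using K by blast
qed

end

theorem theorem1p1:
  fixes G :: "('g, 'm) monoid_scheme"
  assumes "finitely_generated_group G"
    and "b2_b1_property G 2"
    and "(SUP H \<in> finite_index_subgroups G. betti 1 (G\<lparr>carrier := H\<rparr>) 2) = \<infinity>"
  shows "\<exists>\<^sub>\<infinity>n. subgroup_growth G n \<ge> subnormal_growth G n
           \<and> real (subnormal_growth G n) > 2 powr (real n / (sqrt (ln (real n)) * ln (ln (real n))))"
proof -
  interpret fg_group G
    using assms(1) by (intro fg_group.intro fg_group_axioms.intro) (auto simp: finitely_generated_group_def)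
  obtain C where C: "\<forall>H\<in>finite_index_subgroups G. \<forall>b. betti 1 (G\<lparr>carrier := H\<rparr>) 2 \<le> enat b \<longrightarrow>
      (\<exists>c\<le>b + C. betti 2 (G\<lparr>carrier := H\<rparr>) 2 = enat c)"
    using b2_b1_property_bound[OF assms(2)] by blast
  define B where "B = 16 * (C + 1)\<^sup>2"
  have "enat B < (SUP H \<in> finite_index_subgroups G. betti 1 (G\<lparr>carrier := H\<rparr>) 2)"
    unfolding assms(3) by simp
  then obtain H0 where H0: "H0 \<in> finite_index_subgroups G" "enat B < betti 1 (G\<lparr>carrier := H0\<rparr>) 2"
    by (auto simp: less_SUP_iff)
  have "enat B < enat (rank2 H0)" using betti_1_le_rank2[OF H0(1)] by (rule less_le_trans[OF H0(2)])
  then have "16 * (C + 1)\<^sup>2 \<le> rank2 H0" by (simp add: B_def)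
  from subnormal_of_large_rank2[OF H0(1) C this, of B]
  obtain H where H: "H \<in> finite_index_subgroups G" "subnormal H G" "B \<le> rank2 H" by blast
  note T = tower_rank2[OF H(1) C H(3)[unfolded B_def]]
  define b where "b = (\<lambda>i. rank2 (tower H i))"
  \<comment> \<open>The start value is any exponent with \<open>[G : H] \<le> 2 ^ e 0\<close>; the index itself is one.\<close>
  define e where "e = (\<lambda>i. card (rcosets\<^bsub>G\<^esub> H) + (\<Sum>j<i. b j))"
  have "16 * 1 \<le> B" unfolding B_def by (intro mult_le_mono2) simp
  then have b16: "16 \<le> b i" for i using T[of i] H(3) unfolding b_def by linarith
  have index: "card (rcosets\<^bsub>G\<^esub> (tower H i)) \<le> 2 ^ e i" for i
  proof (induction i)
    case 0
    then show ?case by (simp add: tower_simps e_def less_imp_le)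
  next
    case (Suc i)
    have "card (rcosets\<^bsub>G\<^esub> (tower H (Suc i))) \<le> card (rcosets\<^bsub>G\<^esub> (tower H i)) * 2 ^ b i"
      unfolding tower_simps b_def by (rule frattini2_index(2)[OF tower_finite_index[OF H(1)]])
    also have "\<dots> \<le> 2 ^ e i * 2 ^ b i" using Suc by (rule mult_le_mono1)
    finally show ?case by (simp add: e_def power_add)
  qed
  have "\<forall>\<^sub>F i in sequentially. 2 * 2 ^ e i / (sqrt (ln (2 * 2 ^ e i)) * ln (ln (2 * 2 ^ e i))) < b i"
  proof (rule growth_along_tower)
    show "16 \<le> b 0" by (rule b16)
    show "sqrt (b i) * 2 ^ b i / 4 \<le> b (Suc i)" for i using T[of i] unfolding b_def by blast
    show "e (Suc i) = e i + b i" for i by (simp add: e_def)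
  qed
  then obtain k where k: "\<And>i. k \<le> i \<Longrightarrow> 2 * 2 ^ e i / (sqrt (ln (2 * 2 ^ e i)) * ln (ln (2 * 2 ^ e i))) < b i"
    unfolding eventually_sequentially by blast
  have ei: "i \<le> e i" for i
  proof -
    have "(\<Sum>j<i. 1) \<le> (\<Sum>j<i. b j)"
    proof (rule sum_mono)
      show "1 \<le> b j" for j using b16[of j] by linarith
    qed
    then show ?thesis by (simp add: e_def)
  qed
  show ?thesis unfolding INFM_nat
  proof
    fix m
    define i where "i = max m k"
    define n :: nat where "n = 2 * 2 ^ e i"
    have "m < n"
    proof -
      have "m \<le> e i" using ei[of i] by (simp add: i_def)
      also have "e i < 2 ^ e i" by simp
      finally show ?thesis by (simp add: n_def)
    qed
    moreover have "2 powr (real n / (sqrt (ln (real n)) * ln (ln (real n)))) < real (subnormal_growth G n)"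
    proof -
      have "real n / (sqrt (ln (real n)) * ln (ln (real n))) < b i"
        using k[of i] by (simp add: n_def i_def)
      then have "2 powr (real n / (sqrt (ln (real n)) * ln (ln (real n)))) < 2 powr real (b i)"
        by (intro powr_less_mono) auto
      also have "\<dots> = real (2 ^ b i)" by (simp add: powr_realpow)
      also have "\<dots> \<le> real (subnormal_growth G n)"
        using index[of i] unfolding of_nat_le_iff b_def
        by (intro subnormal_growth_ge tower_finite_index tower_subnormal H) (simp add: n_def)
      finally show ?thesis .
    qed
    ultimately show "\<exists>n>m. subgroup_growth G n \<ge> subnormal_growth G n
           \<and> real (subnormal_growth G n) > 2 powr (real n / (sqrt (ln (real n)) * ln (ln (real n))))"
      using subnormal_growth_le by blast
  qed
qed

end
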